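(* Let $1\le k\le d$ be integers. Let $X$ be a random vector in $\mathbb{R}^d$ with $\mathbb{E}X=0$ and $\mathbb{E}\left[|X|^2\right]=\sigma^2 d$ (where $\sigma>0$), and let $$B:=\sup_{\xi\in\mathbb{S}^{d-1}}\mathbb{E}\langle X,\xi\rangle^2 .$$ Let $Z=(Z_1,\ldots,Z_k)$ be a standard normal random vector in $\mathbb{R}^k$. For $\theta=(\theta_1,\ldots,\theta_k)\in\mathfrak{W}_{d,k}$, let $$d_{BL}(X_\theta,\sigma Z)=\sup_{\|f\|_1\le 1}\left|\mathbb{E}\left[f(\langle X,\theta_1\rangle,\ldots,\langle X,\theta_k\rangle)\,\big|\,\theta\right]-\mathbb{E}f(\sigma Z_1,\ldots,\sigma Z_k)\right|,$$ that is, the conditional bounded-Lipschitz distance from $X_\theta=(\langle X,\theta_1\rangle,\ldots,\langle X,\theta_k\rangle)$ to $\sigma Z$, conditioned on $\theta$. Let $\theta$ be a random point of $\mathfrak{W}_{d,k}$, distributed according to Haar measure and independent of $X$. Then for every $\epsilon>2\pi\sqrt{\frac{B}{d}}$, $$\mathbb{P}\left[\big|d_{BL}(X_\theta,\sigma Z)-\mathbb{E}\,d_{BL}(X_\theta,\sigma Z)\big|>\epsilon\right]\le\sqrt{\frac{\pi}{2}}\,e^{-\frac{d\epsilon^2}{32B}}.$$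
   Context: $|\cdot|$ denotes the Euclidean norm and $\mathbb{S}^{d-1}$ the unit sphere of $\mathbb{R}^d$. The Stiefel manifold is $\mathfrak{W}_{d,k}=\{\theta=(\theta_1,\ldots,\theta_k):\theta_i\in\mathbb{R}^d,\ \langle\theta_i,\theta_j\rangle=\delta_{ij}\text{ for all }1\le i,j\le k\}$; Haar measure on it is the unique rotation-invariant probability measure. For $f:\mathbb{R}^k\to\mathbb{R}$, $\|f\|_1:=\max\left\{\|f\|_\infty,\ \sup_{x\ne y}\frac{|f(x)-f(y)|}{|x-y|}\right\}$. The conditional distance $d_{BL}(X_\theta,\sigma Z)$ is a random variable, being a function of the random point $\theta$; the outer probability and expectation are over $\theta$. *)

theory Defs
  imports "HOL-Probability.Probability"
begin

text \<open>
  The type \<open>real ^ 'd ^ 'k\<close> holds \<open>k\<close>-tuples of vectors of \<open>\<real>\<^sup>d\<close>; the components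
  \<open>\<theta> $ i\<close> are the vectors of the tuple.
\<close>

definition stiefel :: "(real ^ 'd ^ 'k) set" where
  "stiefel = {\<theta>. \<forall>i j. (\<theta> $ i) \<bullet> (\<theta> $ j) = (if i = j then 1 else 0)}"

definition stiefel_space :: "(real ^ 'd ^ 'k) measure" where
  "stiefel_space = restrict_space borel stiefel"

text \<open>
  Rotations act on all components simultaneously. They range over the full orthogonal group:
  for \<open>k < d\<close> this gives the same invariant probability measure as \<open>SO(d)\<close>, and for \<open>k = d\<close>
  invariance under \<open>SO(d)\<close> alone would not determine the measure.
\<close>

definition stiefel_haar :: "(real ^ 'd ^ 'k) measure \<Rightarrow> bool" where
  "stiefel_haar \<mu> \<longleftrightarrow> prob_space \<mu> \<and> sets \<mu> = sets stiefel_space \<and>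
     (\<forall>U. orthogonal_transformation U \<longrightarrow> distr \<mu> \<mu> (\<lambda>\<theta>. \<chi> i. U (\<theta> $ i)) = \<mu>)"

definition frame_coords :: "real ^ 'd ^ 'k \<Rightarrow> real ^ 'd \<Rightarrow> real ^ 'k" where
  "frame_coords \<theta> x = (\<chi> i. x \<bullet> (\<theta> $ i))"

definition standard_normal_vector :: "'b measure \<Rightarrow> ('b \<Rightarrow> real ^ 'k) \<Rightarrow> bool" where
  "standard_normal_vector N Z \<longleftrightarrow>
     prob_space.indep_vars N (\<lambda>_. borel) (\<lambda>i \<omega>. Z \<omega> $ i) UNIV \<and>
     (\<forall>i. distributed N lborel (\<lambda>\<omega>. Z \<omega> $ i) std_normal_density)"

text \<open>
  Independence of two random variables with possibly different codomains: the generated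
  \<open>\<sigma>\<close>-algebras are independent. (The library's \<open>indep_var\<close> requires equal codomain types.)
\<close>

definition indep_pair ::
    "'a measure \<Rightarrow> 'x measure \<Rightarrow> ('a \<Rightarrow> 'x) \<Rightarrow> 't measure \<Rightarrow> ('a \<Rightarrow> 't) \<Rightarrow> bool" where
  "indep_pair M R X S T \<longleftrightarrow> X \<in> measurable M R \<and> T \<in> measurable M S \<and>
     prob_space.indep_set M (sets (vimage_algebra (space M) X R)) (sets (vimage_algebra (space M) T S))"

text \<open>The value is \<open>\<infinity>\<close> for functions that are unbounded or not Lipschitz.\<close>

definition bl_norm :: "(real ^ 'k \<Rightarrow> real) \<Rightarrow> ereal" where
  "bl_norm f = max (SUP x. ereal \<bar>f x\<bar>)
     (SUP (x, y) \<in> {(x, y). x \<noteq> y}. ereal (\<bar>f x - f y\<bar> / norm (x - y)))"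

text \<open>
  The bounded-Lipschitz distance between the laws of two random vectors, which may live on
  different probability spaces; for those the supremum is over a nonempty subset of \<open>{0..2}\<close>.
\<close>

definition bl_dist ::
    "'a measure \<Rightarrow> ('a \<Rightarrow> real ^ 'k) \<Rightarrow> 'b measure \<Rightarrow> ('b \<Rightarrow> real ^ 'k) \<Rightarrow> real" where
  "bl_dist M V N W =
     (SUP f \<in> {f. bl_norm f \<le> 1}. \<bar>(\<integral>\<omega>. f (V \<omega>) \<partial>M) - (\<integral>\<omega>. f (W \<omega>) \<partial>N)\<bar>)"

text \<open>
  A conditional expectation given \<open>\<theta>\<close> is only determined up to null sets, so a supremum over
  uncountably many of them needs a fixed version. The version used is the one coming from
  independence: the expectation over \<open>X\<close> with \<open>\<theta>\<close> held fixed. The last lemma below confirms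
  that this is a version of the conditional expectation for every admissible \<open>f\<close>.
\<close>

definition cond_bl_dist ::
    "'a measure \<Rightarrow> ('a \<Rightarrow> real ^ 'd) \<Rightarrow> 'b measure \<Rightarrow> ('b \<Rightarrow> real ^ 'k) \<Rightarrow> real \<Rightarrow>
     real ^ 'd ^ 'k \<Rightarrow> real" where
  "cond_bl_dist M X N Z \<sigma> \<theta> =
     bl_dist M (\<lambda>\<omega>. frame_coords \<theta> (X \<omega>)) N (\<lambda>\<omega>. \<sigma> *\<^sub>R Z \<omega>)"

lemma bl_norm_le_1_iff:
  "bl_norm f \<le> 1 \<longleftrightarrow> (\<forall>x. \<bar>f x\<bar> \<le> 1) \<and> 1-lipschitz_on UNIV f"
proof -
  have "(\<bar>f x - f y\<bar> / norm (x - y) \<le> 1) \<longleftrightarrow> dist (f x) (f y) \<le> 1 * dist x y" if "x \<noteq> y" for x y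
    using that by (simp add: dist_norm)
  moreover have "dist (f x) (f x) \<le> 1 * dist x x" for x by simp
  ultimately show ?thesis
    unfolding bl_norm_def lipschitz_on_def by (auto simp: SUP_le_iff one_ereal_def dist_norm split: if_splits)
      (metis diff_self abs_zero norm_ge_zero real_norm_def)
qed

lemma (in prob_space) indep_pair_distr:
  assumes "indep_pair M R X S T"
  shows "distr M (S \<Otimes>\<^sub>M R) (\<lambda>\<omega>. (T \<omega>, X \<omega>)) = distr M S T \<Otimes>\<^sub>M distr M R X"
proof -
  have X [measurable]: "X \<in> measurable M R" and T [measurable]: "T \<in> measurable M S"
    and ind: "indep_set (sets (vimage_algebra (space M) X R)) (sets (vimage_algebra (space M) T S))"
    using assms by (auto simp: indep_pair_def)
  interpret P: prob_space "distr M R X" by (rule prob_space_distr) simp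
  interpret Q: prob_space "distr M S T" by (rule prob_space_distr) simp
  interpret QP: pair_prob_space "distr M S T" "distr M R X" ..
  show ?thesis
  proof (rule pair_measure_eqI[symmetric])
    show "sigma_finite_measure (distr M S T)" "sigma_finite_measure (distr M R X)"
      by unfold_locales
    show "sets (distr M S T \<Otimes>\<^sub>M distr M R X) = sets (distr M (S \<Otimes>\<^sub>M R) (\<lambda>\<omega>. (T \<omega>, X \<omega>)))"
      by simp
    fix A B assume "A \<in> sets (distr M S T)" "B \<in> sets (distr M R X)"
    then have A [measurable]: "A \<in> sets S" and B [measurable]: "B \<in> sets R" by auto
    have "prob ((X -` B \<inter> space M) \<inter> (T -` A \<inter> space M)) =
        prob (X -` B \<inter> space M) * prob (T -` A \<inter> space M)"
      by (rule indep_setD[OF ind]) (auto intro: in_vimage_algebra)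
    moreover have "(\<lambda>\<omega>. (T \<omega>, X \<omega>)) -` (A \<times> B) \<inter> space M =
        (X -` B \<inter> space M) \<inter> (T -` A \<inter> space M)" by auto
    ultimately show "emeasure (distr M S T) A * emeasure (distr M R X) B =
        emeasure (distr M (S \<Otimes>\<^sub>M R) (\<lambda>\<omega>. (T \<omega>, X \<omega>))) (A \<times> B)"
      by (simp add: emeasure_distr emeasure_eq_measure ennreal_mult'' mult.commute)
  qed
qed

lemma (in prob_space) real_cond_exp_indep:
  fixes h :: "'t \<times> 'x \<Rightarrow> real"
  assumes ind: "indep_pair M R X S \<Theta>"
    and h [measurable]: "h \<in> borel_measurable (S \<Otimes>\<^sub>M R)"
    and bdd: "\<And>p. \<bar>h p\<bar> \<le> b"
  shows "AE \<omega> in M. real_cond_exp M (vimage_algebra (space M) \<Theta> S) (\<lambda>\<omega>. h (\<Theta> \<omega>, X \<omega>)) \<omega> =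
           (\<integral>\<omega>'. h (\<Theta> \<omega>, X \<omega>') \<partial>M)"
proof -
  have X [measurable]: "X \<in> measurable M R" and T [measurable]: "\<Theta> \<in> measurable M S"
    using ind by (auto simp: indep_pair_def)
  let ?F = "vimage_algebra (space M) \<Theta> S"
  let ?P = "distr M R X" and ?Q = "distr M S \<Theta>"
  let ?g = "\<lambda>t. \<integral>\<omega>'. h (t, X \<omega>') \<partial>M"
  have sub: "subalgebra M ?F"
  proof -
    have "sets ?F = {\<Theta> -` A \<inter> space M | A. A \<in> sets S}"
      by (rule sets_vimage_algebra2) (use T in \<open>auto simp: measurable_space[OF T]\<close>)
    then show ?thesis
      unfolding subalgebra_def using measurable_sets[OF T] by auto
  qed
  interpret F: finite_measure_subalgebra M ?F
    by unfold_locales (rule sub)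
  interpret P: prob_space ?P by (rule prob_space_distr) simp
  interpret Q: prob_space ?Q by (rule prob_space_distr) simp
  interpret QP: pair_prob_space ?Q ?P ..
  have g [measurable]: "?g \<in> borel_measurable S"
    by measurable
  have joint: "distr M (S \<Otimes>\<^sub>M R) (\<lambda>\<omega>. (\<Theta> \<omega>, X \<omega>)) = ?Q \<Otimes>\<^sub>M ?P"
    using ind by (rule indep_pair_distr)
  show ?thesis
  proof (rule F.real_cond_exp_charact)
    show "integrable M (\<lambda>\<omega>. h (\<Theta> \<omega>, X \<omega>))"
      by (rule integrable_const_bound[of _ b]) (use bdd in auto)
    have "\<bar>?g t\<bar> \<le> b" if "t \<in> space S" for t
    proof -
      have "integrable M (\<lambda>\<omega>'. h (t, X \<omega>'))"
        using that by (intro integrable_const_bound[of _ b]) (use bdd in auto)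
      then have "\<bar>?g t\<bar> \<le> (\<integral>\<omega>'. b \<partial>M)"
        by (intro order_trans[OF integral_abs_bound integral_mono]) (use bdd in auto)
      then show ?thesis by (simp add: prob_space)
    qed
    then show "integrable M (\<lambda>\<omega>. ?g (\<Theta> \<omega>))"
      by (intro integrable_const_bound[of _ b]) (use T in \<open>auto simp: measurable_space[OF T]\<close>)
    show "(\<lambda>\<omega>. ?g (\<Theta> \<omega>)) \<in> borel_measurable ?F"
      by (rule measurable_compose[OF measurable_vimage_algebra1 g]) (use T in \<open>auto simp: measurable_space[OF T]\<close>)
    fix A assume "A \<in> sets ?F"
    then obtain C where C [measurable]: "C \<in> sets S" and A: "A = \<Theta> -` C \<inter> space M"
      using T by (auto simp: sets_vimage_algebra2 measurable_space[OF T] Pi_iff)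
    have int: "integrable (?Q \<Otimes>\<^sub>M ?P) (\<lambda>(t, x). indicator C t * h (t, x))"
      by (intro QP.integrable_const_bound[of _ "\<bar>b\<bar>"])
         (use bdd in \<open>auto simp: indicator_def intro!: order_trans[OF bdd abs_ge_self]\<close>)
    have "(\<integral>\<omega>\<in>A. h (\<Theta> \<omega>, X \<omega>) \<partial>M) = (\<integral>\<omega>. (\<lambda>(t, x). indicator C t * h (t, x)) (\<Theta> \<omega>, X \<omega>) \<partial>M)"
      unfolding set_lebesgue_integral_def
      by (rule Bochner_Integration.integral_cong) (auto simp: A indicator_def)
    also have "\<dots> = (\<integral>p. (\<lambda>(t, x). indicator C t * h (t, x)) p \<partial>(?Q \<Otimes>\<^sub>M ?P))"
      unfolding joint[symmetric] by (subst integral_distr) auto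
    also have "\<dots> = (\<integral>t. (\<integral>x. indicator C t * h (t, x) \<partial>?P) \<partial>?Q)"
      using QP.integral_fst'[OF int] by simp
    also have "\<dots> = (\<integral>t. indicator C t * ?g t \<partial>?Q)"
      by (rule Bochner_Integration.integral_cong) (auto simp: integral_distr)
    also have "\<dots> = (\<integral>\<omega>. indicator C (\<Theta> \<omega>) * ?g (\<Theta> \<omega>) \<partial>M)"
      by (subst integral_distr) auto
    also have "\<dots> = (\<integral>\<omega>\<in>A. ?g (\<Theta> \<omega>) \<partial>M)"
      unfolding set_lebesgue_integral_def
      by (rule Bochner_Integration.integral_cong) (auto simp: A indicator_def)
    finally show "(\<integral>\<omega>\<in>A. h (\<Theta> \<omega>, X \<omega>) \<partial>M) = (\<integral>\<omega>\<in>A. ?g (\<Theta> \<omega>) \<partial>M)" .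
  qed
qed

lemma (in prob_space) real_cond_exp_frame_coords:
  fixes X :: "'a \<Rightarrow> real ^ 'd" and \<Theta> :: "'a \<Rightarrow> real ^ 'd ^ 'k"
  assumes ind: "indep_pair M borel X stiefel_space \<Theta>"
    and f: "bl_norm f \<le> 1"
  shows "AE \<omega> in M.
    real_cond_exp M (vimage_algebra (space M) \<Theta> stiefel_space)
      (\<lambda>\<omega>. f (frame_coords (\<Theta> \<omega>) (X \<omega>))) \<omega> =
    (\<integral>\<omega>'. f (frame_coords (\<Theta> \<omega>) (X \<omega>')) \<partial>M)"
proof -
  have bdd: "\<bar>f x\<bar> \<le> 1" and lip: "1-lipschitz_on UNIV f" for x
    using f by (auto simp: bl_norm_le_1_iff)
  have fm [measurable]: "f \<in> borel_measurable borel"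
    by (intro borel_measurable_continuous_onI lipschitz_on_continuous_on[OF lip])
  have "continuous_on UNIV (\<lambda>p :: (real ^ 'd ^ 'k) \<times> (real ^ 'd). frame_coords (fst p) (snd p))"
    unfolding frame_coords_def by (intro continuous_intros)
  then have fc: "(\<lambda>p :: (real ^ 'd ^ 'k) \<times> (real ^ 'd). frame_coords (fst p) (snd p))
      \<in> borel \<Otimes>\<^sub>M borel \<rightarrow>\<^sub>M borel"
    unfolding borel_prod by (rule borel_measurable_continuous_onI)
  have id: "(\<lambda>p. p) \<in> stiefel_space \<Otimes>\<^sub>M borel \<rightarrow>\<^sub>M
      (borel :: (real ^ 'd ^ 'k) measure) \<Otimes>\<^sub>M (borel :: (real ^ 'd) measure)"
  proof -
    have [measurable]: "(\<lambda>t. t) \<in> stiefel_space \<rightarrow>\<^sub>M (borel :: (real ^ 'd ^ 'k) measure)"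
      unfolding stiefel_space_def by (rule measurable_restrict_space1) simp
    have "(\<lambda>p. (fst p, snd p)) \<in> stiefel_space \<Otimes>\<^sub>M borel \<rightarrow>\<^sub>M
      (borel :: (real ^ 'd ^ 'k) measure) \<Otimes>\<^sub>M (borel :: (real ^ 'd) measure)"
      by measurable
    then show ?thesis by simp
  qed
  have "(\<lambda>p :: (real ^ 'd ^ 'k) \<times> (real ^ 'd). f (frame_coords (fst p) (snd p))) \<in>
      borel_measurable (stiefel_space \<Otimes>\<^sub>M borel)"
    by (rule measurable_compose[OF measurable_compose[OF id fc] fm])
  from real_cond_exp_indep[OF ind this, of 1] bdd show ?thesis by simp
qed

end

theory Submission
  imports Defs
begin

text \<open>
  A frame \<open>\<theta>\<close> is a \<open>k \<times> d\<close> matrix with orthonormal rows. Orthogonal \<open>d \<times> d\<close> matrices \<open>Q\<close> rotate it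
  to \<open>\<theta> ** Q\<close>, and orthogonal \<open>k \<times> k\<close> matrices \<open>R\<close> change it to the frame \<open>R ** \<theta>\<close> with the same span. The
  proof uses three properties of the conditional distance \<open>F\<close>. It is bounded. It is
  Lipschitz with constant \<open>sqrt B\<close> for the Euclidean norm of matrices (\<open>F_lipschitz\<close>). And it depends only on
  the span of the frame (\<open>F_orthogonal_invariant\<close>), because the standard normal law and the set of test
  functions are invariant under rotations of \<open>\<real>\<^sup>k\<close>. For \<open>k = d\<close>, where the Stiefel manifold is
  disconnected, Lipschitz functions without the last property do not concentrate.

  Concentration follows from a bound on \<open>E (exp (\<tau> (F \<theta>' - F \<theta>)))\<close> for independent frames \<open>\<theta>, \<theta>'\<close>
  (\<open>stiefel_haar_mgf\<close>). By invariance of the law, the pair may be rotated by a random orthogonal matrix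
  \<open>Q\<close>, and then the average over \<open>Q\<close> is estimated for each fixed pair (\<open>rotated_pair_mgf\<close>). Such a
  pair of spans is joined by a geodesic along which the principal angles, at most \<open>pi / 2\<close>,
  grow linearly (\<open>frame_pair_normal_form\<close>). All pieces of the geodesic of equal length have the same law
  after the rotation by \<open>Q\<close>. So convexity of the exponential function bounds the average by
  \<open>E (exp (\<tau> L))\<close>, where \<open>L\<close> is the derivative of \<open>F\<close> along the geodesic at its start
  (\<open>endpoint_le_slope\<close>); for this \<open>F\<close> is first made differentiable by a radial smoothing.

  The slope \<open>L\<close> is the trace of an \<open>n \<times> n\<close> matrix with Hilbert-Schmidt norm at most \<open>K = pi / 2 * sqrt B\<close>,
  and the law of this matrix is invariant under rotations of its second index. Here \<open>n\<close> may be \<open>k\<close>, by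
  rotations within the span of the frame, or \<open>d - k\<close>, by rotations within its orthogonal complement.
  Differentiating the invariance in every coordinate plane yields a Stein identity, and this yields
  \<open>E (exp (\<tau> L)) \<le> exp (\<tau>\<^sup>2 K\<^sup>2 / (n - 1))\<close> (\<open>rotation_invariant_trace_mgf\<close>). The larger of the two choices
  of \<open>n\<close> is at least \<open>d / 2\<close>, so that \<open>F\<close> is subgaussian at the scale \<open>sqrt (B / d)\<close>. The resulting
  exponential and Chebyshev tails are both needed for the constants of the theorem (\<open>tail_comparison\<close>).
\<close>

section \<open>A Stein identity for rotation-invariant traces\<close>

text \<open>
  Dominated convergence for difference quotients: the mean value theorem bounds each of them by the
  uniform bound \<open>C\<close> on the derivatives.
\<close>

lemma (in finite_measure) has_field_derivative_integral_param:
  fixes u :: "real \<Rightarrow> 'a \<Rightarrow> real"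
  assumes deriv: "\<And>\<omega> s. \<omega> \<in> space M \<Longrightarrow> ((\<lambda>s. u s \<omega>) has_real_derivative u' s \<omega>) (at s)"
    and bound: "\<And>\<omega> s. \<omega> \<in> space M \<Longrightarrow> \<bar>u' s \<omega>\<bar> \<le> C"
    and int: "\<And>s. integrable M (u s)"
    and meas: "u' t \<in> borel_measurable M"
  shows "((\<lambda>s. \<integral>\<omega>. u s \<omega> \<partial>M) has_real_derivative (\<integral>\<omega>. u' t \<omega> \<partial>M)) (at t)"
  unfolding has_field_derivative_iff tendsto_at_iff_sequentially
proof (intro allI impI)
  fix X :: "nat \<Rightarrow> real" assume X: "\<forall>i. X i \<in> UNIV - {t}" "X \<longlonglongrightarrow> t"
  let ?q = "\<lambda>s \<omega>. (u s \<omega> - u t \<omega>) / (s - t)"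
  have "(\<lambda>i. \<integral>\<omega>. ?q (X i) \<omega> \<partial>M) \<longlonglongrightarrow> (\<integral>\<omega>. u' t \<omega> \<partial>M)"
  proof (rule integral_dominated_convergence[where w="\<lambda>_. C"])
    show "?q (X i) \<in> borel_measurable M" for i
      using borel_measurable_integrable[OF int] by measurable
    show "AE \<omega> in M. (\<lambda>i. ?q (X i) \<omega>) \<longlonglongrightarrow> u' t \<omega>"
    proof (rule AE_I2)
      fix \<omega> assume "\<omega> \<in> space M"
      from deriv[OF this, of t] have "((\<lambda>s. ?q s \<omega>) \<longlongrightarrow> u' t \<omega>) (at t)"
        unfolding has_field_derivative_iff .
      with X show "(\<lambda>i. ?q (X i) \<omega>) \<longlonglongrightarrow> u' t \<omega>"
        by (auto simp: tendsto_at_iff_sequentially o_def)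
    qed
    show "AE \<omega> in M. norm (?q (X i) \<omega>) \<le> C" for i
    proof (rule AE_I2)
      fix \<omega> assume w: "\<omega> \<in> space M"
      have "norm (u (X i) \<omega> - u t \<omega>) \<le> C * norm (X i - t)"
        by (rule field_differentiable_bound[of UNIV "\<lambda>s. u s \<omega>" "\<lambda>s. u' s \<omega>"])
          (use deriv[OF w] bound[OF w] in auto)
      then show "norm (?q (X i) \<omega>) \<le> C"
        using X by (auto simp: divide_simps)
    qed
  qed (use meas in auto)
  then show "((\<lambda>s. ((\<integral>\<omega>. u s \<omega> \<partial>M) - (\<integral>\<omega>. u t \<omega> \<partial>M)) / (s - t)) \<circ> X) \<longlonglongrightarrow> (\<integral>\<omega>. u' t \<omega> \<partial>M)"
    using int by (simp add: o_def)
qed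

context prob_space
begin

lemma integrable_bounded:
  fixes f :: "'a \<Rightarrow> real"
  assumes "f \<in> borel_measurable M" "\<And>\<omega>. \<omega> \<in> space M \<Longrightarrow> \<bar>f \<omega>\<bar> \<le> C"
  shows "integrable M f"
  by (rule integrable_const_bound[of _ C]) (use assms in auto)

text \<open>
  If the law is invariant under a one-parameter family of rotations which moves \<open>L\<close> with velocity \<open>d\<close>
  and acceleration \<open>- s\<close> at time \<open>0\<close>, then the expectation of \<open>d exp (\<tau> L)\<close> does not change along the
  family. Its vanishing derivative at \<open>0\<close> is the identity below, an integration by parts.
\<close>

lemma rotation_stein_identity:
  fixes s d L :: "'a \<Rightarrow> real"
  assumes "s \<in> borel_measurable M" "d \<in> borel_measurable M" "L \<in> borel_measurable M"
    and bd: "\<And>\<omega>. \<omega> \<in> space M \<Longrightarrow> \<bar>s \<omega>\<bar> \<le> C \<and> \<bar>d \<omega>\<bar> \<le> C \<and> \<bar>L \<omega>\<bar> \<le> C"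
    and inv: "\<And>t. \<exists>T. T \<in> measurable M M \<and> distr M M T = M \<and> (\<forall>\<omega>\<in>space M.
                d (T \<omega>) = cos t * d \<omega> - sin t * s \<omega> \<and>
                L (T \<omega>) = L \<omega> + (cos t - 1) * s \<omega> + sin t * d \<omega>)"
  shows "expectation (\<lambda>\<omega>. s \<omega> * exp (\<tau> * L \<omega>)) = \<tau> * expectation (\<lambda>\<omega>. (d \<omega>)\<^sup>2 * exp (\<tau> * L \<omega>))"
proof -
  have [measurable]: "s \<in> borel_measurable M" "d \<in> borel_measurable M" "L \<in> borel_measurable M" by fact+
  define y where "y t \<omega> = cos t * d \<omega> - sin t * s \<omega>" for t \<omega>
  define l where "l t \<omega> = L \<omega> + (cos t - 1) * s \<omega> + sin t * d \<omega>" for t \<omega>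
  define u where "u t \<omega> = y t \<omega> * exp (\<tau> * l t \<omega>)" for t \<omega>
  define u' where "u' t \<omega> = (- sin t * d \<omega> - cos t * s \<omega> + \<tau> * (y t \<omega>)\<^sup>2) * exp (\<tau> * l t \<omega>)" for t \<omega>
  have [measurable]: "y t \<in> borel_measurable M" "l t \<in> borel_measurable M" for t
    unfolding y_def l_def by measurable
  have [measurable]: "u t \<in> borel_measurable M" "u' t \<in> borel_measurable M" for t
    unfolding u_def u'_def by measurable
  obtain \<omega>0 where "\<omega>0 \<in> space M" using not_empty by auto
  from bd[OF this] have C: "0 \<le> C" by linarith
  have cs: "\<bar>cos t * p\<bar> \<le> C" "\<bar>sin t * p\<bar> \<le> C" if "\<bar>p\<bar> \<le> C" for t p
    using mult_mono[of "\<bar>cos t\<bar>" 1 "\<bar>p\<bar>" C] mult_mono[of "\<bar>sin t\<bar>" 1 "\<bar>p\<bar>" C] that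
    by (auto simp: abs_mult)
  have yb: "\<bar>y t \<omega>\<bar> \<le> 2 * C" if "\<omega> \<in> space M" for t \<omega>
    using cs[of "d \<omega>" t] cs[of "s \<omega>" t] bd[OF that] unfolding y_def by linarith
  have lb: "\<bar>l t \<omega>\<bar> \<le> 4 * C" if "\<omega> \<in> space M" for t \<omega>
    using cs[of "d \<omega>" t] cs[of "s \<omega>" t] bd[OF that] unfolding l_def left_diff_distrib mult_1_left by linarith
  have eb: "exp (\<tau> * l t \<omega>) \<le> exp (\<bar>\<tau>\<bar> * (4 * C))" if "\<omega> \<in> space M" for t \<omega>
    using mult_left_mono[OF lb[OF that], of "\<bar>\<tau>\<bar>" t] by (simp add: abs_mult[symmetric])
  let ?E = "exp (\<bar>\<tau>\<bar> * (4 * C))"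
  have ub: "\<bar>u t \<omega>\<bar> \<le> 2 * C * ?E" if "\<omega> \<in> space M" for t \<omega>
    unfolding u_def abs_mult using yb[OF that] eb[OF that] C by (intro mult_mono) auto
  have u'b: "\<bar>u' t \<omega>\<bar> \<le> (2 * C + \<bar>\<tau>\<bar> * (2 * C)\<^sup>2) * ?E" if "\<omega> \<in> space M" for t \<omega>
  proof -
    have "\<bar>- sin t * d \<omega> - cos t * s \<omega>\<bar> \<le> 2 * C"
      using cs[of "d \<omega>" t] cs[of "s \<omega>" t] bd[OF that] by linarith
    moreover have "\<bar>\<tau> * (y t \<omega>)\<^sup>2\<bar> \<le> \<bar>\<tau>\<bar> * (2 * C)\<^sup>2"
      using power_mono[OF yb[OF that, of t] abs_ge_zero, of 2] by (simp add: abs_mult mult_left_mono)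
    ultimately have "\<bar>- sin t * d \<omega> - cos t * s \<omega> + \<tau> * (y t \<omega>)\<^sup>2\<bar> \<le> 2 * C + \<bar>\<tau>\<bar> * (2 * C)\<^sup>2"
      by linarith
    then show ?thesis unfolding u'_def abs_mult[of _ "exp _"] using eb[OF that] C
      by (intro mult_mono) auto
  qed
  have der: "((\<lambda>t. u t \<omega>) has_real_derivative u' t \<omega>) (at t)" for t \<omega>
    unfolding u_def y_def l_def u'_def
    by (auto intro!: derivative_eq_intros simp: algebra_simps power2_eq_square)
  have D: "((\<lambda>t. expectation (u t)) has_real_derivative expectation (u' 0)) (at 0)"
    by (rule has_field_derivative_integral_param[OF der u'b]) (auto intro!: integrable_bounded ub)
  have "expectation (u t) = expectation (u 0)" for t
  proof -
    obtain T where T [measurable]: "T \<in> measurable M M" and TM: "distr M M T = M"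
      and Tx: "\<And>\<omega>. \<omega> \<in> space M \<Longrightarrow> d (T \<omega>) = y t \<omega> \<and> L (T \<omega>) = l t \<omega>"
      using inv[of t] unfolding y_def l_def by blast
    have "expectation (u 0) = (\<integral>\<omega>. d \<omega> * exp (\<tau> * L \<omega>) \<partial>(distr M M T))"
      unfolding TM by (simp add: u_def[abs_def] y_def l_def)
    also have "\<dots> = expectation (\<lambda>\<omega>. d (T \<omega>) * exp (\<tau> * L (T \<omega>)))"
      by (rule integral_distr) measurable
    also have "\<dots> = expectation (u t)"
      by (rule Bochner_Integration.integral_cong) (auto simp: Tx u_def)
    finally show ?thesis by simp
  qed
  then have "((\<lambda>t. expectation (u t)) has_real_derivative 0) (at 0)"
    by (subst \<open>\<And>t. expectation (u t) = expectation (u 0)\<close>) auto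
  with D have "expectation (u' 0) = 0" by (rule DERIV_unique)
  moreover have "u' 0 = (\<lambda>\<omega>. \<tau> * ((d \<omega>)\<^sup>2 * exp (\<tau> * L \<omega>)) - s \<omega> * exp (\<tau> * L \<omega>))"
    by (auto simp: u'_def y_def l_def algebra_simps)
  moreover have "integrable M (\<lambda>\<omega>. (d \<omega>)\<^sup>2 * exp (\<tau> * L \<omega>))"
  proof (rule integrable_bounded)
    fix \<omega> assume w: "\<omega> \<in> space M"
    show "\<bar>(d \<omega>)\<^sup>2 * exp (\<tau> * L \<omega>)\<bar> \<le> C\<^sup>2 * ?E"
      using eb[OF w, of 0] bd[OF w] C unfolding abs_mult
      by (intro mult_mono) (auto simp: l_def abs_le_square_iff[symmetric])
  qed measurable
  moreover have "integrable M (\<lambda>\<omega>. s \<omega> * exp (\<tau> * L \<omega>))"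
  proof (rule integrable_bounded)
    fix \<omega> assume w: "\<omega> \<in> space M"
    show "\<bar>s \<omega> * exp (\<tau> * L \<omega>)\<bar> \<le> C * ?E"
      using eb[OF w, of 0] bd[OF w] C unfolding abs_mult
      by (intro mult_mono) (auto simp: l_def)
  qed measurable
  ultimately show ?thesis by simp
qed

text \<open>
  A random matrix \<open>x\<close> indexed by \<open>I\<close> whose law does not change when its columns are rotated has a
  subgaussian trace \<open>L\<close>. In the plane of the indices \<open>a, b\<close> the trace moves with velocity
  \<open>x a b - x b a\<close> and acceleration \<open>- (x a a + x b b)\<close>. Summed over all ordered pairs \<open>a \<noteq> b\<close> the
  accelerations give \<open>- 2 (n - 1) L\<close>, where \<open>n = card I\<close>, and the squared velocities are at most
  \<open>4 K\<^sup>2\<close>. So the identity above gives \<open>E (L exp (\<tau> L)) \<le> 2 K\<^sup>2 / (n - 1) \<tau> E (exp (\<tau> L))\<close>,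
  a differential inequality for the moment generating function.

  The dimension enters only through \<open>n - 1\<close>. This is what concentration needs: \<open>x\<close> has \<open>n\<^sup>2\<close> entries,
  but only its Hilbert-Schmidt norm is controlled.
\<close>

lemma rotation_invariant_trace_mgf:
  fixes x :: "'i \<Rightarrow> 'i \<Rightarrow> 'a \<Rightarrow> real"
  assumes fin: "finite I" and card: "card I \<ge> 2"
    and meas: "\<And>a b. a \<in> I \<Longrightarrow> b \<in> I \<Longrightarrow> x a b \<in> borel_measurable M"
    and sq: "\<And>\<omega>. \<omega> \<in> space M \<Longrightarrow> (\<Sum>a\<in>I. \<Sum>b\<in>I. (x a b \<omega>)\<^sup>2) \<le> K\<^sup>2"
    and inv: "\<And>a b t. a \<in> I \<Longrightarrow> b \<in> I \<Longrightarrow> a \<noteq> b \<Longrightarrow> \<exists>T. T \<in> measurable M M \<and> distr M M T = M \<and>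
       (\<forall>\<omega>\<in>space M. \<forall>c\<in>I. x c a (T \<omega>) = cos t * x c a \<omega> + sin t * x c b \<omega> \<and>
          x c b (T \<omega>) = cos t * x c b \<omega> - sin t * x c a \<omega> \<and>
          (\<forall>l\<in>I - {a, b}. x c l (T \<omega>) = x c l \<omega>))"
    and l0: "0 \<le> \<tau>"
  shows "expectation (\<lambda>\<omega>. exp (\<tau> * (\<Sum>a\<in>I. x a a \<omega>))) \<le> exp (\<tau>\<^sup>2 * K\<^sup>2 / real (card I - 1))"
proof -
  define L where "L \<omega> = (\<Sum>a\<in>I. x a a \<omega>)" for \<omega>
  define n where "n = card I"
  define c where "c = K\<^sup>2 / (real n - 1)"
  have n: "n \<ge> 2" using card by (simp add: n_def)
  have [measurable]: "L \<in> borel_measurable M" unfolding L_def using meas by measurable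
  have xb: "\<bar>x a b \<omega>\<bar> \<le> \<bar>K\<bar>" if "\<omega> \<in> space M" "a \<in> I" "b \<in> I" for a b \<omega>
  proof -
    have "(x a b \<omega>)\<^sup>2 \<le> (\<Sum>b\<in>I. (x a b \<omega>)\<^sup>2)"
      using that fin by (intro member_le_sum) auto
    also have "\<dots> \<le> (\<Sum>a\<in>I. \<Sum>b\<in>I. (x a b \<omega>)\<^sup>2)"
      using that fin by (intro member_le_sum[where f="\<lambda>a. \<Sum>b\<in>I. (x a b \<omega>)\<^sup>2"]) (auto intro: sum_nonneg)
    finally show ?thesis using sq[OF that(1)] by (simp add: abs_le_square_iff)
  qed
  have Lb: "\<bar>L \<omega>\<bar> \<le> real n * \<bar>K\<bar>" if "\<omega> \<in> space M" for \<omega>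
    unfolding L_def n_def using that xb
    by (intro order_trans[OF sum_abs] sum_bounded_above[where K="\<bar>K\<bar>"]) auto
  have expb: "\<bar>exp (r * L \<omega>)\<bar> \<le> exp (\<bar>r\<bar> * (real n * \<bar>K\<bar>))" if "\<omega> \<in> space M" for \<omega> r
    using mult_left_mono[OF Lb[OF that], of "\<bar>r\<bar>"] by (simp add: abs_mult[symmetric])
  have step: "expectation (\<lambda>\<omega>. L \<omega> * exp (r * L \<omega>)) \<le> 2 * c * r * expectation (\<lambda>\<omega>. exp (r * L \<omega>))"
    if r: "0 \<le> r" for r
  proof -
    define e where "e \<omega> = exp (r * L \<omega>)" for \<omega>
    have [measurable]: "e \<in> borel_measurable M" unfolding e_def by measurable
    have int: "integrable M (\<lambda>\<omega>. f \<omega> * e \<omega>)" if f [measurable]: "f \<in> borel_measurable M"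
      and fb: "\<And>\<omega>. \<omega> \<in> space M \<Longrightarrow> \<bar>f \<omega>\<bar> \<le> B" for f B
    proof (rule integrable_bounded)
      fix \<omega> assume w: "\<omega> \<in> space M"
      from fb[OF w] have "0 \<le> B" by linarith
      then show "\<bar>f \<omega> * e \<omega>\<bar> \<le> B * exp (\<bar>r\<bar> * (real n * \<bar>K\<bar>))"
        unfolding abs_mult using fb[OF w] expb[OF w, of r] by (intro mult_mono) (auto simp: e_def)
    qed measurable
    have inte: "integrable M e" using int[of "\<lambda>_. 1" 1] by simp
    have intd: "integrable M (\<lambda>\<omega>. (x a b \<omega> - x b a \<omega>)\<^sup>2 * e \<omega>)" if "a \<in> I" "b \<in> I" for a b
      using meas[OF that] meas[OF that(2,1)]
    proof (intro int[of _ "(2 * \<bar>K\<bar>)\<^sup>2"])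
      fix \<omega> assume "\<omega> \<in> space M"
      with xb[of \<omega>] that have "\<bar>x a b \<omega> - x b a \<omega>\<bar> \<le> 2 * \<bar>K\<bar>" by (smt (verit))
      then show "\<bar>(x a b \<omega> - x b a \<omega>)\<^sup>2\<bar> \<le> (2 * \<bar>K\<bar>)\<^sup>2"
        using power_mono[of "\<bar>x a b \<omega> - x b a \<omega>\<bar>" "2 * \<bar>K\<bar>" 2] by simp
    qed measurable
    have ints: "integrable M (\<lambda>\<omega>. (x a a \<omega> + x b b \<omega>) * e \<omega>)" if "a \<in> I" "b \<in> I" for a b
      using meas[OF that(1,1)] meas[OF that(2,2)]
    proof (intro int[of _ "2 * \<bar>K\<bar>"])
      fix \<omega> assume "\<omega> \<in> space M"
      with xb[of \<omega>] that show "\<bar>x a a \<omega> + x b b \<omega>\<bar> \<le> 2 * \<bar>K\<bar>" by (smt (verit))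
    qed measurable
    have pair: "expectation (\<lambda>\<omega>. (x a a \<omega> + x b b \<omega>) * e \<omega>)
        = r * expectation (\<lambda>\<omega>. (x a b \<omega> - x b a \<omega>)\<^sup>2 * e \<omega>)" if ab: "a \<in> I" "b \<in> I" "a \<noteq> b" for a b
      unfolding e_def
    proof (rule rotation_stein_identity)
      show "(\<lambda>\<omega>. x a a \<omega> + x b b \<omega>) \<in> borel_measurable M" "(\<lambda>\<omega>. x a b \<omega> - x b a \<omega>) \<in> borel_measurable M"
        using meas ab by (intro borel_measurable_add borel_measurable_diff; simp)+
      show "L \<in> borel_measurable M" by measurable
      have "2 * \<bar>K\<bar> \<le> real n * \<bar>K\<bar>" using n by (intro mult_right_mono) auto
      then show "\<bar>x a a \<omega> + x b b \<omega>\<bar> \<le> real n * \<bar>K\<bar> \<and> \<bar>x a b \<omega> - x b a \<omega>\<bar> \<le> real n * \<bar>K\<bar> \<and> \<bar>L \<omega>\<bar> \<le> real n * \<bar>K\<bar>"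
        if "\<omega> \<in> space M" for \<omega>
        using xb[OF that] ab Lb[OF that] by (smt (verit))
      fix t
      from inv[OF ab, of t] obtain T where T: "T \<in> measurable M M" "distr M M T = M"
        "\<And>\<omega> c. \<omega> \<in> space M \<Longrightarrow> c \<in> I \<Longrightarrow> x c a (T \<omega>) = cos t * x c a \<omega> + sin t * x c b \<omega> \<and>
          x c b (T \<omega>) = cos t * x c b \<omega> - sin t * x c a \<omega> \<and>
          (\<forall>l\<in>I - {a, b}. x c l (T \<omega>) = x c l \<omega>)" by metis
      show "\<exists>T. T \<in> measurable M M \<and> distr M M T = M \<and> (\<forall>\<omega>\<in>space M.
         x a b (T \<omega>) - x b a (T \<omega>) = cos t * (x a b \<omega> - x b a \<omega>) - sin t * (x a a \<omega> + x b b \<omega>) \<and>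
         L (T \<omega>) = L \<omega> + (cos t - 1) * (x a a \<omega> + x b b \<omega>) + sin t * (x a b \<omega> - x b a \<omega>))"
      proof (intro exI conjI ballI)
        fix \<omega> assume w: "\<omega> \<in> space M"
        show "x a b (T \<omega>) - x b a (T \<omega>) = cos t * (x a b \<omega> - x b a \<omega>) - sin t * (x a a \<omega> + x b b \<omega>)"
          using T(3)[OF w] ab by (simp add: algebra_simps)
        have split: "(\<Sum>a\<in>I. g a) = g a + g b + (\<Sum>l\<in>I - {a,b}. g l)" for g :: "'i \<Rightarrow> real"
        proof -
          have "(\<Sum>l\<in>I. g l) = (\<Sum>l\<in>{a,b}. g l) + (\<Sum>l\<in>I - {a,b}. g l)"
            using ab fin by (metis sum.subset_diff add.commute empty_subsetI insert_subset)
          then show ?thesis using ab by simp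
        qed
        have "(\<Sum>l\<in>I - {a,b}. x l l (T \<omega>)) = (\<Sum>l\<in>I - {a,b}. x l l \<omega>)"
          using T(3)[OF w] by (intro sum.cong) auto
        then show "L (T \<omega>) = L \<omega> + (cos t - 1) * (x a a \<omega> + x b b \<omega>) + sin t * (x a b \<omega> - x b a \<omega>)"
          unfolding L_def split using T(3)[OF w ab(1)] T(3)[OF w ab(2)] by (simp add: algebra_simps)
      qed (use T in auto)
    qed
    have sumsq: "(\<Sum>a\<in>I. \<Sum>b\<in>I - {a}. (x a b \<omega> - x b a \<omega>)\<^sup>2) \<le> 4 * K\<^sup>2" if "\<omega> \<in> space M" for \<omega>
    proof -
      have "(\<Sum>a\<in>I. \<Sum>b\<in>I - {a}. (x a b \<omega> - x b a \<omega>)\<^sup>2) \<le> (\<Sum>a\<in>I. \<Sum>b\<in>I. 2 * (x a b \<omega>)\<^sup>2 + 2 * (x b a \<omega>)\<^sup>2)"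
      proof (rule sum_mono)
        fix a assume "a \<in> I"
        have "(\<Sum>b\<in>I - {a}. (x a b \<omega> - x b a \<omega>)\<^sup>2) \<le> (\<Sum>b\<in>I. (x a b \<omega> - x b a \<omega>)\<^sup>2)"
          using fin by (intro sum_mono2) auto
        also have "\<dots> \<le> (\<Sum>b\<in>I. 2 * (x a b \<omega>)\<^sup>2 + 2 * (x b a \<omega>)\<^sup>2)"
        proof (rule sum_mono)
          fix b show "(x a b \<omega> - x b a \<omega>)\<^sup>2 \<le> 2 * (x a b \<omega>)\<^sup>2 + 2 * (x b a \<omega>)\<^sup>2"
            using zero_le_power2[of "x a b \<omega> + x b a \<omega>"] by (simp add: power2_eq_square algebra_simps)
        qed
        finally show "(\<Sum>b\<in>I - {a}. (x a b \<omega> - x b a \<omega>)\<^sup>2) \<le> (\<Sum>b\<in>I. 2 * (x a b \<omega>)\<^sup>2 + 2 * (x b a \<omega>)\<^sup>2)" .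
      qed
      also have "\<dots> = 2 * (\<Sum>a\<in>I. \<Sum>b\<in>I. (x a b \<omega>)\<^sup>2) + 2 * (\<Sum>a\<in>I. \<Sum>b\<in>I. (x b a \<omega>)\<^sup>2)"
        by (simp add: sum.distrib sum_distrib_left)
      also have "(\<Sum>a\<in>I. \<Sum>b\<in>I. (x b a \<omega>)\<^sup>2) = (\<Sum>a\<in>I. \<Sum>b\<in>I. (x a b \<omega>)\<^sup>2)"
        by (rule sum.swap)
      finally show ?thesis using sq[OF that] by linarith
    qed
    have trace: "(\<Sum>a\<in>I. \<Sum>b\<in>I - {a}. (x a a \<omega> + x b b \<omega>)) = 2 * (real n - 1) * L \<omega>" for \<omega>
    proof -
      have "(\<Sum>b\<in>I - {a}. (x a a \<omega> + x b b \<omega>)) = (real n - 2) * x a a \<omega> + L \<omega>" if "a \<in> I" for a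
      proof -
        have "(\<Sum>b\<in>I - {a}. x b b \<omega>) = L \<omega> - x a a \<omega>"
          unfolding L_def using fin that by (subst sum_diff1) auto
        moreover have "real (card (I - {a})) = real n - 1"
          using that fin n by (simp add: n_def card_Diff_singleton of_nat_diff)
        ultimately show ?thesis by (simp only: sum.distrib sum_constant) (simp add: algebra_simps)
      qed
      then have "(\<Sum>a\<in>I. \<Sum>b\<in>I - {a}. (x a a \<omega> + x b b \<omega>)) = (\<Sum>a\<in>I. (real n - 2) * x a a \<omega> + L \<omega>)"
        by (intro sum.cong refl)
      also have "\<dots> = (real n - 2) * L \<omega> + real n * L \<omega>"
        by (simp add: sum.distrib sum_distrib_left[symmetric] L_def[symmetric] n_def)
      finally show ?thesis by (simp add: algebra_simps)
    qed
    have "2 * (real n - 1) * expectation (\<lambda>\<omega>. L \<omega> * e \<omega>)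
        = expectation (\<lambda>\<omega>. \<Sum>a\<in>I. \<Sum>b\<in>I - {a}. (x a a \<omega> + x b b \<omega>) * e \<omega>)"
      by (simp add: sum_distrib_right[symmetric] trace mult.assoc)
    also have "\<dots> = (\<Sum>a\<in>I. \<Sum>b\<in>I - {a}. expectation (\<lambda>\<omega>. (x a a \<omega> + x b b \<omega>) * e \<omega>))"
      by (subst Bochner_Integration.integral_sum; (intro Bochner_Integration.integrable_sum ints)?) 
        (auto intro!: sum.cong Bochner_Integration.integral_sum ints)
    also have "\<dots> = (\<Sum>a\<in>I. \<Sum>b\<in>I - {a}. r * expectation (\<lambda>\<omega>. (x a b \<omega> - x b a \<omega>)\<^sup>2 * e \<omega>))"
      by (intro sum.cong refl pair) auto
    also have "\<dots> = r * (\<Sum>a\<in>I. \<Sum>b\<in>I - {a}. expectation (\<lambda>\<omega>. (x a b \<omega> - x b a \<omega>)\<^sup>2 * e \<omega>))"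
      by (simp add: sum_distrib_left)
    also have "(\<Sum>a\<in>I. \<Sum>b\<in>I - {a}. expectation (\<lambda>\<omega>. (x a b \<omega> - x b a \<omega>)\<^sup>2 * e \<omega>))
        = expectation (\<lambda>\<omega>. \<Sum>a\<in>I. \<Sum>b\<in>I - {a}. (x a b \<omega> - x b a \<omega>)\<^sup>2 * e \<omega>)"
      by (subst Bochner_Integration.integral_sum; (intro Bochner_Integration.integrable_sum intd)?) 
        (auto intro!: sum.cong Bochner_Integration.integral_sum[symmetric] intd)
    also have "r * \<dots> \<le> r * expectation (\<lambda>\<omega>. 4 * K\<^sup>2 * e \<omega>)"
    proof (intro mult_left_mono r integral_mono)
      fix \<omega> assume "\<omega> \<in> space M"
      from mult_right_mono[OF sumsq[OF this], of "e \<omega>"]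
      show "(\<Sum>a\<in>I. \<Sum>b\<in>I - {a}. (x a b \<omega> - x b a \<omega>)\<^sup>2 * e \<omega>) \<le> 4 * K\<^sup>2 * e \<omega>"
        by (simp add: sum_distrib_right e_def)
    qed (auto intro!: Bochner_Integration.integrable_sum intd inte)
    finally have "2 * (real n - 1) * expectation (\<lambda>\<omega>. L \<omega> * e \<omega>) \<le> r * (4 * K\<^sup>2 * expectation e)"
      by simp
    then show ?thesis using n unfolding c_def e_def by (simp add: field_simps)
  qed
  define m where "m r = expectation (\<lambda>\<omega>. exp (r * L \<omega>))" for r
  have dm: "(m has_real_derivative expectation (\<lambda>\<omega>. L \<omega> * exp (r * L \<omega>))) (at r)" for r
  proof -
    define r0 where "r0 = \<bar>r\<bar> + 1"
    \<comment> \<open>The derivatives must be dominated for all parameters at once. Replacing \<open>s\<close> by \<open>r + sin (s - r)\<close>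
      keeps the exponent bounded and changes neither the value nor the derivative at \<open>r\<close>.\<close>
    define \<phi> where "\<phi> s = r + sin (s - r)" for s
    have "\<bar>\<phi> s\<bar> \<le> r0" for s using abs_sin_le_one[of "s - r"] unfolding \<phi>_def r0_def by linarith
    then have eb: "exp (\<phi> s * L \<omega>) \<le> exp (r0 * (real n * \<bar>K\<bar>))" if "\<omega> \<in> space M" for s \<omega>
    proof -
      have "\<phi> s * L \<omega> \<le> \<bar>\<phi> s\<bar> * \<bar>L \<omega>\<bar>" by (simp add: abs_mult[symmetric])
      also have "\<dots> \<le> r0 * (real n * \<bar>K\<bar>)"
        using \<open>\<bar>\<phi> s\<bar> \<le> r0\<close> Lb[OF that] by (intro mult_mono) (auto simp: r0_def)
      finally show ?thesis by simp
    qed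
    have "((\<lambda>s. expectation (\<lambda>\<omega>. exp (\<phi> s * L \<omega>))) has_real_derivative
        expectation (\<lambda>\<omega>. cos (r - r) * L \<omega> * exp (\<phi> r * L \<omega>))) (at r)"
    proof (rule has_field_derivative_integral_param[where u'="\<lambda>s \<omega>. cos (s - r) * L \<omega> * exp (\<phi> s * L \<omega>)"])
      fix \<omega> s assume w: "\<omega> \<in> space M"
      show "((\<lambda>s. exp (\<phi> s * L \<omega>)) has_real_derivative cos (s - r) * L \<omega> * exp (\<phi> s * L \<omega>)) (at s)"
        unfolding \<phi>_def by (auto intro!: derivative_eq_intros)
      have "\<bar>cos (s - r)\<bar> * \<bar>L \<omega>\<bar> \<le> 1 * (real n * \<bar>K\<bar>)" using Lb[OF w] by (intro mult_mono) auto
      then show "\<bar>cos (s - r) * L \<omega> * exp (\<phi> s * L \<omega>)\<bar> \<le> real n * \<bar>K\<bar> * exp (r0 * (real n * \<bar>K\<bar>))"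
        using mult_mono[OF _ eb[OF w], of "\<bar>cos (s - r)\<bar> * \<bar>L \<omega>\<bar>" "real n * \<bar>K\<bar>" s]
        by (simp add: abs_mult)
    next
      fix s show "integrable M (\<lambda>\<omega>. exp (\<phi> s * L \<omega>))"
        using eb[of _ s] by (intro integrable_bounded[where C="exp (r0 * (real n * \<bar>K\<bar>))"]) auto
    qed measurable
    then have "((\<lambda>s. m (\<phi> s)) has_real_derivative expectation (\<lambda>\<omega>. L \<omega> * exp (r * L \<omega>))) (at r)"
      by (simp add: m_def \<phi>_def)
    moreover have "((\<lambda>y. r + arcsin (y - r)) has_real_derivative 1) (at r)"
      by (auto intro!: derivative_eq_intros)
    ultimately have "((\<lambda>y. m (\<phi> (r + arcsin (y - r)))) has_real_derivative expectation (\<lambda>\<omega>. L \<omega> * exp (r * L \<omega>)) * 1) (at r)"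
      by (intro DERIV_chain2[where g="\<lambda>y. r + arcsin (y - r)" and f="\<lambda>s. m (\<phi> s)"]) auto
    then have "((\<lambda>y. m (\<phi> (r + arcsin (y - r)))) has_real_derivative expectation (\<lambda>\<omega>. L \<omega> * exp (r * L \<omega>))) (at r)"
      by simp
    then show ?thesis
    proof (rule has_field_derivative_transform_within_open[of _ _ _ "ball r 1"])
      fix y assume "y \<in> ball r 1"
      then have "sin (arcsin (y - r)) = y - r" by (intro sin_arcsin) (auto simp: dist_real_def)
      then show "m (\<phi> (r + arcsin (y - r))) = m y" by (simp add: \<phi>_def)
    qed auto
  qed
  have "m \<tau> * exp (- c * \<tau>\<^sup>2) \<le> m 0 * exp (- c * 0\<^sup>2)"
  proof (rule DERIV_nonpos_imp_nonincreasing[OF l0])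
    fix r :: real assume r: "0 \<le> r" "r \<le> \<tau>"
    have "((\<lambda>r. m r * exp (- c * r\<^sup>2)) has_real_derivative
       (expectation (\<lambda>\<omega>. L \<omega> * exp (r * L \<omega>)) - 2 * c * r * m r) * exp (- c * r\<^sup>2)) (at r)"
      by (auto intro!: derivative_eq_intros dm simp: algebra_simps)
    moreover have "(expectation (\<lambda>\<omega>. L \<omega> * exp (r * L \<omega>)) - 2 * c * r * m r) * exp (- c * r\<^sup>2) \<le> 0"
      using step[OF r(1)] by (intro mult_nonpos_nonneg) (auto simp: m_def)
    ultimately show "\<exists>y. ((\<lambda>r. m r * exp (- c * r\<^sup>2)) has_real_derivative y) (at r) \<and> y \<le> 0" by blast
  qed
  moreover have "m 0 = 1" by (simp add: m_def prob_space)
  ultimately have "m \<tau> \<le> exp (c * \<tau>\<^sup>2)" by (simp add: exp_minus field_simps)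
  then show ?thesis unfolding m_def L_def c_def n_def using n by (simp add: n_def of_nat_diff mult.commute)
qed

end

section \<open>Lebesgue measure under orthogonal transformations\<close>

lemma nn_integral_lborel_shift:
  fixes f :: "'a::euclidean_space \<Rightarrow> ennreal"
  assumes [measurable]: "f \<in> borel_measurable borel"
  shows "(\<integral>\<^sup>+x. f (x + a) \<partial>lborel) = (\<integral>\<^sup>+x. f x \<partial>lborel)"
  by (subst lborel_distr_plus[symmetric, of a]) (simp add: nn_integral_distr add.commute)

text \<open>
  Let \<open>g\<close> be the indicator of the unit ball. Translation invariance, used once in each variable,
  turns the double integral of \<open>f y * g (T x)\<close> into that of \<open>f (T x) * g (T x - y)\<close>; as the integral
  of \<open>g\<close> is positive and finite and \<open>g\<close> is invariant under \<open>T\<close>, it cancels.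
\<close>

lemma lborel_distr_orthogonal:
  fixes T :: "'a::euclidean_space \<Rightarrow> 'a"
  assumes T: "orthogonal_transformation T"
  shows "distr lborel borel T = lborel"
proof -
  have lin: "linear T" using T by (rule orthogonal_transformation_linear)
  then have "T \<in> borel_measurable borel"
    by (intro borel_measurable_continuous_onI linear_continuous_on) (simp add: linear_conv_bounded_linear)
  note [measurable] = this
  obtain T' where TT: "\<And>y. T (T' y) = y"
    using orthogonal_transformation_surj[OF T] by (metis surjD)
  have *: "(\<integral>\<^sup>+x. f (T x) \<partial>lborel) = (\<integral>\<^sup>+x. f x \<partial>lborel)"
    if [measurable]: "f \<in> borel_measurable borel" for f :: "'a \<Rightarrow> ennreal"
  proof -
    define g :: "'a \<Rightarrow> ennreal" where "g = indicator (ball 0 1)"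
    have [measurable]: "g \<in> borel_measurable borel" unfolding g_def by (intro borel_measurable_indicator) simp
    define c where "c = (\<integral>\<^sup>+x. g x \<partial>lborel)"
    have c: "c = emeasure lborel (ball (0::'a) 1)" unfolding c_def g_def by simp
    have gT: "g (T x) = g x" for x
      using orthogonal_transformation_norm[OF T, of x] by (auto simp: g_def indicator_def)
    have gm: "(\<integral>\<^sup>+y. g (v - y) \<partial>lborel) = c" for v
    proof -
      have "g (v - y) = g (y + (- v))" for y by (auto simp: g_def indicator_def norm_minus_commute)
      then show ?thesis unfolding c_def by (simp add: nn_integral_lborel_shift[of g "- v", simplified])
    qed
    have "(\<integral>\<^sup>+y. f y \<partial>lborel) * c = (\<integral>\<^sup>+x. (\<integral>\<^sup>+y. f y \<partial>lborel) * g (T x) \<partial>lborel)"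
      unfolding gT c_def by (simp add: nn_integral_cmult)
    also have "\<dots> = (\<integral>\<^sup>+x. (\<integral>\<^sup>+y. f (y + T x) * g (T x) \<partial>lborel) \<partial>lborel)"
      by (simp add: nn_integral_multc nn_integral_lborel_shift)
    also have "\<dots> = (\<integral>\<^sup>+y. (\<integral>\<^sup>+x. f (y + T x) * g (T x) \<partial>lborel) \<partial>lborel)"
      by (rule lborel_pair.Fubini') measurable
    also have "\<dots> = (\<integral>\<^sup>+y. (\<integral>\<^sup>+x. f (T x) * g (T x - y) \<partial>lborel) \<partial>lborel)"
    proof (rule nn_integral_cong)
      fix y
      have "(\<integral>\<^sup>+x. f (y + T x) * g (T x) \<partial>lborel) = (\<integral>\<^sup>+x. f (T (x + T' y)) * g (T (x + T' y) - y) \<partial>lborel)"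
        by (simp add: linear_add[OF lin] TT add.commute)
      also have "\<dots> = (\<integral>\<^sup>+x. f (T x) * g (T x - y) \<partial>lborel)"
        by (rule nn_integral_lborel_shift[where f="\<lambda>x. f (T x) * g (T x - y)"]) measurable
      finally show "(\<integral>\<^sup>+x. f (y + T x) * g (T x) \<partial>lborel) = (\<integral>\<^sup>+x. f (T x) * g (T x - y) \<partial>lborel)" .
    qed
    also have "\<dots> = (\<integral>\<^sup>+x. (\<integral>\<^sup>+y. f (T x) * g (T x - y) \<partial>lborel) \<partial>lborel)"
      by (rule lborel_pair.Fubini'[symmetric]) measurable
    also have "\<dots> = (\<integral>\<^sup>+x. f (T x) \<partial>lborel) * c"
      by (simp add: nn_integral_cmult nn_integral_multc gm)
    finally have eq: "(\<integral>\<^sup>+y. f y \<partial>lborel) * c = (\<integral>\<^sup>+x. f (T x) \<partial>lborel) * c" .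
    have "c = ennreal (measure lborel (ball (0::'a) 1))"
      unfolding c using emeasure_lborel_ball_finite[of "0::'a" 1]
      by (intro emeasure_eq_ennreal_measure) auto
    moreover have "0 < measure lborel (ball (0::'a) 1)" by simp
    ultimately show ?thesis using eq by (metis mult_right_ennreal_cancel not_le)
  qed
  show ?thesis
  proof (rule measure_eqI)
    fix A assume "A \<in> sets (distr lborel borel T)"
    then have [measurable]: "A \<in> sets borel" by simp
    have "emeasure (distr lborel borel T) A = (\<integral>\<^sup>+x. indicator A x \<partial>distr lborel borel T)"
      by simp
    also have "\<dots> = (\<integral>\<^sup>+x. indicator A (T x) \<partial>lborel)"
      by (rule nn_integral_distr) auto
    finally have "emeasure (distr lborel borel T) A = (\<integral>\<^sup>+x. indicator A (T x) \<partial>lborel)" .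
    then show "emeasure (distr lborel borel T) A = emeasure lborel A"
      using *[of "indicator A"] by simp
  qed simp
qed

lemma emeasure_lborel_open_pos:
  fixes S :: "'a::euclidean_space set"
  assumes "open S" "x \<in> S"
  shows "0 < emeasure lborel S"
proof -
  obtain r where r: "r > 0" "ball x r \<subseteq> S" using assms by (meson openE)
  have "emeasure lborel (ball x r) = ennreal (measure lborel (ball x r))"
    using emeasure_lborel_ball_finite[of x r] by (intro emeasure_eq_ennreal_measure) auto
  then have "0 < emeasure lborel (ball x r)" using r by simp
  also have "\<dots> \<le> emeasure lborel S" using r assms by (intro emeasure_mono) auto
  finally show ?thesis .
qed

section \<open>Gram-Schmidt\<close>

text \<open>
  The sequence form of the process: at a vector in the span of its predecessors the value is \<open>sgn 0 = 0\<close>,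
  so the function is total. It is needed as a map that is both measurable and equivariant.
\<close>

function gram_schmidt :: "(nat \<Rightarrow> 'v::real_inner) \<Rightarrow> nat \<Rightarrow> 'v" where
  "gram_schmidt v n = sgn (v n - (\<Sum>i<n. (v n \<bullet> gram_schmidt v i) *\<^sub>R gram_schmidt v i))"
  by auto
termination by (relation "Wellfounded.measure snd") auto

declare gram_schmidt.simps [simp del]

lemma gram_schmidt_span: "gram_schmidt v n \<in> span (v ` {..n})"
proof (induction n rule: less_induct)
  case (less n)
  have "gram_schmidt v i \<in> span (v ` {..n})" if "i < n" for i
    using less[OF that] span_mono[OF image_mono[of "{..i}" "{..n}" v]] that by auto
  then show ?case
    unfolding gram_schmidt.simps[of v n] sgn_div_norm
    by (intro span_scale span_diff span_sum) (auto intro: span_base)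
qed

lemma gram_schmidt_orthonormal:
  assumes "\<And>n. n < N \<Longrightarrow> v n \<notin> span (v ` {..<n})" "m < N" "n < N"
  shows "gram_schmidt v m \<bullet> gram_schmidt v n = (if m = n then 1 else 0)"
proof -
  have "\<forall>m\<le>n. gram_schmidt v m \<bullet> gram_schmidt v n = (if m = n then 1 else 0)" if "n < N" for n
    using that
  proof (induction n rule: less_induct)
    case (less n)
    define g where "g = gram_schmidt v"
    have IH: "g i \<bullet> g j = (if i = j then 1 else 0)" if "i < n" "j < n" for i j
    proof (cases "i \<le> j")
      case True then show ?thesis using less that by (auto simp: g_def)
    next
      case False
      then show ?thesis using less.IH[of i] that less.prems
        by (auto simp: g_def inner_commute[of "gram_schmidt v i"])
    qed
    define w where "w = v n - (\<Sum>i<n. (v n \<bullet> g i) *\<^sub>R g i)"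
    have gn: "g n = sgn w" unfolding g_def w_def by (subst gram_schmidt.simps) simp
    have "(\<Sum>i<n. (v n \<bullet> g i) *\<^sub>R g i) \<in> span (v ` {..<n})"
    proof (intro span_sum span_scale)
      fix i assume "i \<in> {..<n}"
      then show "g i \<in> span (v ` {..<n})" unfolding g_def
        using gram_schmidt_span[of v i] span_mono[OF image_mono[of "{..i}" "{..<n}" v]]
        by (auto simp: subset_iff)
    qed
    then have "w \<noteq> 0" using assms(1)[OF less.prems] by (auto simp: w_def)
    then have "g n \<bullet> g n = 1" unfolding gn by (simp add: dot_square_norm norm_sgn)
    moreover have "g m \<bullet> g n = 0" if m: "m < n" for m
    proof -
      have "g m \<bullet> w = g m \<bullet> v n - (\<Sum>i<n. (v n \<bullet> g i) * (g m \<bullet> g i))"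
        by (simp add: w_def inner_diff_right inner_sum_right)
      also have "(\<Sum>i<n. (v n \<bullet> g i) * (g m \<bullet> g i)) = (\<Sum>i<n. if i = m then v n \<bullet> g i else 0)"
        using m by (intro sum.cong) (auto simp: IH)
      also have "\<dots> = v n \<bullet> g m" using m by simp
      finally show ?thesis unfolding gn by (simp add: sgn_div_norm inner_commute)
    qed
    ultimately show ?case unfolding g_def by (auto simp: le_less)
  qed
  then show ?thesis using assms(2,3) by (metis inner_commute nle_le)
qed

lemma gram_schmidt_orthogonal_transformation:
  assumes "orthogonal_transformation T"
  shows "gram_schmidt (\<lambda>n. T (v n)) n = T (gram_schmidt v n)"
proof (induction n rule: less_induct)
  case (less n)
  have lin: "linear T" using assms by (rule orthogonal_transformation_linear)
  have inn: "T a \<bullet> T b = a \<bullet> b" for a b using assms by (simp add: orthogonal_transformation_def)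
  have sgnT: "sgn (T a) = T (sgn a)" for a
    using orthogonal_transformation_norm[OF assms, of a] by (simp add: sgn_div_norm linear_scale[OF lin])
  have "(\<Sum>i<n. (T (v n) \<bullet> gram_schmidt (\<lambda>n. T (v n)) i) *\<^sub>R gram_schmidt (\<lambda>n. T (v n)) i)
      = T (\<Sum>i<n. (v n \<bullet> gram_schmidt v i) *\<^sub>R gram_schmidt v i)"
    unfolding linear_sum[OF lin] linear_scale[OF lin] by (intro sum.cong) (auto simp: less inn)
  then show ?case
    by (subst (1 2) gram_schmidt.simps) (simp add: sgnT[symmetric] linear_diff[OF lin])
qed

lemma borel_measurable_gram_schmidt:
  fixes f :: "nat \<Rightarrow> 'a \<Rightarrow> 'v::euclidean_space"
  assumes "\<And>n. f n \<in> borel_measurable M"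
  shows "(\<lambda>x. gram_schmidt (\<lambda>n. f n x) n) \<in> borel_measurable M"
proof (induction n rule: less_induct)
  case (less n)
  note [measurable] = assms
  have [measurable]: "(\<lambda>x. \<Sum>i<n. (f n x \<bullet> gram_schmidt (\<lambda>n. f n x) i) *\<^sub>R gram_schmidt (\<lambda>n. f n x) i) \<in> borel_measurable M"
    by (intro borel_measurable_sum borel_measurable_scaleR borel_measurable_inner less assms) auto
  show ?case
    by (subst gram_schmidt.simps) (unfold sgn_div_norm, measurable)
qed

section \<open>Orthogonal matrices\<close>

lemma matrix_mult_nth: "(A ** B) $ i = (A $ i) v* B"
  by (simp add: vec_eq_iff matrix_matrix_mult_def vector_matrix_mult_def mult.commute)

lemma inner_vector_matrix_orthogonal:
  fixes Q :: "real^'n^'n"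
  assumes "orthogonal_matrix Q"
  shows "(x v* Q) \<bullet> (y v* Q) = x \<bullet> y"
proof -
  have "(x v* Q) \<bullet> (y v* Q) = x \<bullet> (Q *v (y v* Q))" by (rule dot_lmul_matrix)
  also have "Q *v (y v* Q) = (Q ** transpose Q) *v y"
    by (simp add: matrix_vector_mul_assoc[symmetric])
  finally show ?thesis using assms by (simp add: orthogonal_matrix_def)
qed

lemma inner_matrix_mult_right_orthogonal:
  fixes A B :: "real^'n^'m" and Q :: "real^'n^'n"
  assumes "orthogonal_matrix Q"
  shows "(A ** Q) \<bullet> (B ** Q) = A \<bullet> B"
  by (simp add: inner_vec_def[of "_ ** _"] inner_vec_def[of A] matrix_mult_nth inner_vector_matrix_orthogonal[OF assms])

lemma inner_transpose: "transpose A \<bullet> transpose B = A \<bullet> (B :: real^'n^'m)"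
  unfolding inner_vec_def transpose_def by (simp add: sum.swap[of _ "UNIV::'m set"])

lemma inner_matrix_mult_left_orthogonal:
  fixes A B :: "real^'n^'m" and R :: "real^'m^'m"
  assumes "orthogonal_matrix R"
  shows "(R ** A) \<bullet> (R ** B) = A \<bullet> B"
  by (subst inner_transpose[symmetric])
    (simp add: matrix_transpose_mul inner_matrix_mult_right_orthogonal assms inner_transpose)

lemma norm_matrix_mult_orthogonal:
  fixes A :: "real^'n^'m"
  shows "orthogonal_matrix Q \<Longrightarrow> norm (A ** Q) = norm A" "orthogonal_matrix R \<Longrightarrow> norm (R ** A) = norm A"
  by (simp_all add: norm_eq_sqrt_inner inner_matrix_mult_right_orthogonal inner_matrix_mult_left_orthogonal)

lemma bounded_linear_matrix_mult_right: "bounded_linear (\<lambda>A::real^'n^'m. A ** (Q :: real^'p^'n))"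
  unfolding linear_conv_bounded_linear[symmetric]
  by (auto intro!: linearI simp: matrix_matrix_mult_def vec_eq_iff sum.distrib sum_distrib_left algebra_simps)

lemma bounded_linear_matrix_mult_left: "bounded_linear (\<lambda>A::real^'p^'n. (Q :: real^'n^'m) ** A)"
  unfolding linear_conv_bounded_linear[symmetric]
  by (auto intro!: linearI simp: matrix_matrix_mult_def vec_eq_iff sum.distrib sum_distrib_left algebra_simps)

lemma orthogonal_transformation_matrix_mult_left:
  fixes R :: "real^'m^'m"
  assumes "orthogonal_matrix R"
  shows "orthogonal_transformation (\<lambda>A::real^'n^'m. R ** A)"
  unfolding orthogonal_transformation_def
  using bounded_linear.linear[OF bounded_linear_matrix_mult_left[of R]] inner_matrix_mult_left_orthogonal[OF assms]
  by auto

lemma orthogonal_transformation_matrix_vector: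
  fixes R :: "real^'m^'m"
  assumes "orthogonal_matrix R"
  shows "orthogonal_transformation (\<lambda>v. R *v v)"
  by (simp add: orthogonal_transformation_matrix assms matrix_of_matrix_vector_mul)

section \<open>Haar measure on the orthogonal group\<close>

text \<open>
  An equivariant projection of the invertible matrices onto the orthogonal ones. Equivariance under
  multiplication from the left requires the process to run through the columns.
\<close>

lemma gram_schmidt_matrix_exists:
  obtains \<Phi> :: "real^'n^'n \<Rightarrow> real^'n^'n"
  where "\<Phi> \<in> borel_measurable borel"
    and "\<And>A. det A \<noteq> 0 \<Longrightarrow> orthogonal_matrix (\<Phi> A)"
    and "\<And>h A. orthogonal_matrix h \<Longrightarrow> \<Phi> (h ** A) = h ** \<Phi> A"
proof -
  let ?N = "CARD('n)"
  obtain e :: "nat \<Rightarrow> 'n" where e: "bij_betw e {..<?N} UNIV"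
    using ex_bij_betw_nat_finite[of "UNIV :: 'n set"] by (auto simp: atLeast0LessThan)
  define e' where "e' = inv_into {..<?N} e"
  have e': "e' s < ?N" "e (e' s) = s" for s
    using e by (auto simp: e'_def bij_betw_def inv_into_into[of s e "{..<?N}", simplified] f_inv_into_f)
  have e'_eq: "e' s = e' t \<longleftrightarrow> s = t" for s t using e'(2) by metis
  define c where "c A n = column (e n) A" for A :: "real^'n^'n" and n
  define \<Phi> where "\<Phi> A = (\<chi> r s. gram_schmidt (c A) (e' s) $ r)" for A
  have col: "column s (\<Phi> A) = gram_schmidt (c A) (e' s)" for s A
    by (simp add: \<Phi>_def column_def)
  show thesis
  proof
    have cm: "(\<lambda>A. c A n) \<in> borel_measurable borel" for n
      unfolding c_def column_def
      by (intro borel_measurable_continuous_onI continuous_intros)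
    have gm: "(\<lambda>A. gram_schmidt (c A) n) \<in> borel_measurable borel" for n
      by (rule borel_measurable_gram_schmidt[OF cm])
    have comp: "(\<lambda>A. \<Phi> A $ i $ j) \<in> borel_measurable borel" for i j
      unfolding \<Phi>_def using measurable_compose[OF gm borel_measurable_nth] by simp
    show "\<Phi> \<in> borel_measurable borel"
      unfolding borel_measurable_euclidean_space[of \<Phi>]
    proof
      fix b :: "real^'n^'n" assume "b \<in> Basis"
      then obtain i j where "b = axis i (axis j 1)" by (auto simp: Basis_vec_def)
      then show "(\<lambda>A. \<Phi> A \<bullet> b) \<in> borel_measurable borel"
        using comp[of i j] by (simp add: inner_axis)
    qed
    fix A :: "real^'n^'n" assume A: "det A \<noteq> 0"
    have ind: "c A n \<notin> span (c A ` {..<n})" if n: "n < ?N" for n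
    proof
      assume s: "c A n \<in> span (c A ` {..<n})"
      show False
      proof (cases "\<exists>i<n. c A i = c A n")
        case True
        then obtain i where "i < n" "c A i = c A n" by auto
        moreover from this n have "e i \<noteq> e n"
          using e by (auto simp: bij_betw_def inj_on_def)
        ultimately show False using det_identical_columns[of "e i" "e n" A] A by (simp add: c_def)
      next
        case False
        then have "c A ` {..<n} \<subseteq> columns A - {c A n}" by (auto simp: columns_def c_def)
        with s have "c A n \<in> span (columns A - {c A n})" using span_mono by blast
        then have "dependent (columns A)" unfolding dependent_def by (auto simp: columns_def c_def)
        then show False using det_dependent_columns[of A] A by (simp add: dependent_vec_eq)
      qed
    qed
    have "column s (\<Phi> A) \<bullet> column t (\<Phi> A) = (if s = t then 1 else 0)" for s t
      unfolding col using gram_schmidt_orthonormal[OF ind e'(1) e'(1)] by (simp add: e'_eq)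
    then show "orthogonal_matrix (\<Phi> A)"
      unfolding orthogonal_matrix_orthonormal_columns by (auto simp: orthogonal_def norm_eq_1)
  next
    fix h A :: "real^'n^'n" assume h: "orthogonal_matrix h"
    have "c (h ** A) n = h *v c A n" for n
      by (simp add: c_def column_def vec_eq_iff matrix_vector_mult_def matrix_matrix_mult_def)
    then have "c (h ** A) = (\<lambda>n. h *v c A n)" by auto
    then have "column s (\<Phi> (h ** A)) = h *v column s (\<Phi> A)" for s
      unfolding col by (simp add: gram_schmidt_orthogonal_transformation[OF orthogonal_transformation_matrix_vector[OF h]])
    then have "column s (\<Phi> (h ** A)) = column s (h ** \<Phi> A)" for s
      by (simp add: column_def vec_eq_iff matrix_vector_mult_def matrix_matrix_mult_def)
    then show "\<Phi> (h ** A) = h ** \<Phi> A" by (simp add: vec_eq_iff column_def)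
  qed
qed

abbreviation orthogonal_space :: "(real^'n^'n) measure" where
  "orthogonal_space \<equiv> restrict_space borel {Q. orthogonal_matrix Q}"

text \<open>
  Lebesgue measure on the matrix space is invariant under multiplication by an orthogonal matrix
  from the left, and so is the set \<open>S\<close> of the invertible matrices in a large ball, which is open and
  nonempty and hence has positive finite measure. An equivariant projection carries the uniform
  distribution on \<open>S\<close> to an invariant probability measure on the orthogonal matrices.
\<close>

theorem orthogonal_haar_exists:
  obtains \<nu> :: "(real^'n^'n) measure"
  where "prob_space \<nu>" "sets \<nu> = sets orthogonal_space"
    "\<And>h. orthogonal_matrix h \<Longrightarrow> (\<lambda>Q. h ** Q) \<in> measurable \<nu> \<nu>"
    "\<And>h. orthogonal_matrix h \<Longrightarrow> distr \<nu> \<nu> (\<lambda>Q. h ** Q) = \<nu>"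
proof -
  obtain \<Phi> :: "real^'n^'n \<Rightarrow> real^'n^'n" where \<Phi> [measurable]: "\<Phi> \<in> borel_measurable borel"
    and orth: "\<And>A. det A \<noteq> 0 \<Longrightarrow> orthogonal_matrix (\<Phi> A)"
    and eqv: "\<And>h A. orthogonal_matrix h \<Longrightarrow> \<Phi> (h ** A) = h ** \<Phi> A"
    by (rule gram_schmidt_matrix_exists) blast
  define S where "S = {A::real^'n^'n. det A \<noteq> 0} \<inter> ball 0 (norm (mat 1 :: real^'n^'n) + 1)"
  have "open {A::real^'n^'n. det A \<noteq> 0}"
    unfolding det_def by (intro open_Collect_neq continuous_intros)
  then have oS: "open S" unfolding S_def by auto
  then have [measurable]: "S \<in> sets borel" by simp
  have S1: "mat 1 \<in> S" by (simp add: S_def)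
  have Spos: "emeasure lborel S \<noteq> 0" using emeasure_lborel_open_pos[OF oS S1] by simp
  have Sfin: "emeasure lborel S \<noteq> \<infinity>"
  proof -
    have "emeasure lborel S \<le> emeasure lborel (ball (0::real^'n^'n) (norm (mat 1 :: real^'n^'n) + 1))"
      by (intro emeasure_mono) (auto simp: S_def)
    then show ?thesis using emeasure_lborel_ball_finite by (metis infinity_ennreal_def less_top neq_top_trans)
  qed
  define U where "U = uniform_measure lborel S"
  have [simp]: "sets U = sets borel" "space U = UNIV" by (simp_all add: U_def)
  interpret U: prob_space U unfolding U_def by (rule prob_space_uniform_measure[OF Spos Sfin])
  have AES: "AE A in U. A \<in> S"
    unfolding U_def by (rule AE_uniform_measureI) auto
  define \<Psi> where "\<Psi> A = (if det A \<noteq> 0 then \<Phi> A else mat 1)" for A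
  have "{A::real^'n^'n. det A \<noteq> 0} \<in> sets borel"
    using \<open>open {A::real^'n^'n. det A \<noteq> 0}\<close> by simp
  then have "\<Psi> \<in> borel_measurable borel" unfolding \<Psi>_def
    by (intro measurable_If \<Phi>) auto
  then have "\<Psi> \<in> borel_measurable U" by (simp cong: measurable_cong_sets)
  then have \<Psi> [measurable]: "\<Psi> \<in> measurable U orthogonal_space"
    by (intro measurable_restrict_space2) (auto simp: \<Psi>_def orth orthogonal_matrix_id)
  define \<nu> where "\<nu> = distr U orthogonal_space \<Psi>"
  have sets\<nu>: "sets \<nu> = sets orthogonal_space" by (simp add: \<nu>_def)
  have hm: "(\<lambda>Q. h ** Q) \<in> measurable orthogonal_space orthogonal_space" if h: "orthogonal_matrix h" for h :: "real^'n^'n"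
  proof (rule measurable_restrict_space2)
    have "(\<lambda>Q. h ** Q) \<in> borel_measurable borel"
      by (intro borel_measurable_continuous_onI linear_continuous_on bounded_linear_matrix_mult_left)
    then show "(\<lambda>Q. h ** Q) \<in> borel_measurable orthogonal_space"
      by (rule measurable_restrict_space1)
    show "(\<lambda>Q. h ** Q) \<in> space orthogonal_space \<rightarrow> {Q. orthogonal_matrix Q}"
      using h by (auto simp: orthogonal_matrix_mul space_restrict_space)
  qed
  show thesis
  proof
    show "prob_space \<nu>" unfolding \<nu>_def by (rule U.prob_space_distr) measurable
    show "sets \<nu> = sets orthogonal_space" by (rule sets\<nu>)
    fix h :: "real^'n^'n" assume h: "orthogonal_matrix h"
    show m: "(\<lambda>Q. h ** Q) \<in> measurable \<nu> \<nu>"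
      using hm[OF h] by (simp add: \<nu>_def)
    have hb [measurable]: "(\<lambda>Q::real^'n^'n. h ** Q) \<in> measurable U U"
      using borel_measurable_continuous_onI[OF linear_continuous_on[OF bounded_linear_matrix_mult_left[of h]]]
      unfolding measurable_cong_sets[OF \<open>sets U = sets borel\<close> \<open>sets U = sets borel\<close>] by simp
    have "det h \<noteq> 0" using det_orthogonal_matrix[OF h] by auto
    then have hS: "h ** A \<in> S \<longleftrightarrow> A \<in> S" for A
      by (auto simp: S_def det_mul norm_matrix_mult_orthogonal(2)[OF h])
    have U: "distr U U (\<lambda>A. h ** A) = U"
    proof (rule measure_eqI)
      fix B assume "B \<in> sets (distr U U (\<lambda>A. h ** A))"
      then have [measurable]: "B \<in> sets borel" by simp
      have hbb: "(\<lambda>Q::real^'n^'n. h ** Q) \<in> measurable borel borel" using hb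
        unfolding measurable_cong_sets[OF \<open>sets U = sets borel\<close> \<open>sets U = sets borel\<close>] .
      have pre: "(\<lambda>A. h ** A) -` B \<in> sets borel" using measurable_sets[OF hbb, of B] by simp
      have "emeasure (distr U U (\<lambda>A. h ** A)) B = emeasure U ((\<lambda>A. h ** A) -` B)"
        by (subst emeasure_distr) auto
      also have "\<dots> = emeasure lborel (S \<inter> (\<lambda>A. h ** A) -` B) / emeasure lborel S"
        unfolding U_def using pre by (subst emeasure_uniform_measure) auto
      also have "S \<inter> (\<lambda>A. h ** A) -` B = (\<lambda>A. h ** A) -` (S \<inter> B)" using hS by auto
      also have "emeasure lborel ((\<lambda>A. h ** A) -` (S \<inter> B)) = emeasure (distr lborel borel (\<lambda>A. h ** A)) (S \<inter> B)"
        using hbb by (subst emeasure_distr) auto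
      also have "distr lborel borel (\<lambda>A. h ** A) = lborel"
        by (rule lborel_distr_orthogonal[OF orthogonal_transformation_matrix_mult_left[OF h]])
      also have "emeasure lborel (S \<inter> B) / emeasure lborel S = emeasure U B"
        unfolding U_def by (subst emeasure_uniform_measure) auto
      finally show "emeasure (distr U U (\<lambda>A. h ** A)) B = emeasure U B" .
    qed simp
    have "distr \<nu> \<nu> (\<lambda>Q. h ** Q) = distr \<nu> orthogonal_space (\<lambda>Q. h ** Q)"
      by (rule distr_cong) (auto simp: sets\<nu>)
    also have "\<dots> = distr U orthogonal_space (\<lambda>A. h ** \<Psi> A)"
      unfolding \<nu>_def using hm[OF h] by (subst distr_distr) (auto simp: o_def)
    also have "\<dots> = distr U orthogonal_space (\<lambda>A. \<Psi> (h ** A))"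
    proof (rule distr_cong_AE)
      show "AE A in U. h ** \<Psi> A = \<Psi> (h ** A)"
        using AES by eventually_elim (use \<open>det h \<noteq> 0\<close> in \<open>auto simp: \<Psi>_def S_def eqv[OF h] det_mul\<close>)
      show "(\<lambda>A. h ** \<Psi> A) \<in> measurable U orthogonal_space"
        by (rule measurable_compose[OF \<Psi> hm[OF h]])
      show "(\<lambda>A. \<Psi> (h ** A)) \<in> measurable U orthogonal_space"
        by (rule measurable_compose[OF hb \<Psi>])
    qed auto
    also have "\<dots> = distr (distr U U (\<lambda>A. h ** A)) orthogonal_space \<Psi>"
      by (subst distr_distr) (auto simp: o_def)
    also have "\<dots> = \<nu>" unfolding U \<nu>_def ..
    finally show "distr \<nu> \<nu> (\<lambda>Q. h ** Q) = \<nu>" .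
  qed
qed

section \<open>Smoothing Lipschitz functions\<close>

text \<open>
  The profile \<open>r \<mapsto> (max 0 (1 - r))\<^sup>2\<close> is continuously differentiable with a Lipschitz derivative, which is
  all that the differentiability of a convolution with it needs.
\<close>

lemma truncated_square_taylor:
  fixes r s :: real
  shows "\<bar>(max 0 (1 - s))\<^sup>2 - (max 0 (1 - r))\<^sup>2 + 2 * max 0 (1 - r) * (s - r)\<bar> \<le> (s - r)\<^sup>2"
proof -
  define a where "a = max 0 (1 - r)"
  define b where "b = max 0 (1 - s)"
  define e where "e = s - r"
  have "b\<^sup>2 - a\<^sup>2 + 2 * a * e \<le> e\<^sup>2 \<and> - e\<^sup>2 \<le> b\<^sup>2 - a\<^sup>2 + 2 * a * e"
  proof -
    consider "b = a - e" | "b = 0" "0 \<le> a" "a \<le> e" | "a = 0" "0 \<le> b" "b \<le> - e" | "a = 0" "b = 0"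
      unfolding a_def b_def e_def by linarith
    then show ?thesis
    proof cases
      case 1
      then have "b\<^sup>2 - a\<^sup>2 + 2 * a * e = e\<^sup>2" unfolding 1 by (simp add: power2_eq_square algebra_simps)
      then show ?thesis using zero_le_power2[of e] by linarith
    next
      case 2
      have "a * a \<le> a * e" using 2 by (intro mult_left_mono) auto
      moreover have "0 \<le> a * a" "0 \<le> e * e" "b * b = 0" "2 * a * e = 2 * (a * e)" using 2 by simp_all
      moreover have "0 \<le> (e - a)\<^sup>2" by simp
      moreover have "(e - a)\<^sup>2 = e * e - 2 * (a * e) + a * a" by (simp add: power2_eq_square algebra_simps)
      ultimately show ?thesis unfolding power2_eq_square[of a] power2_eq_square[of b] power2_eq_square[of e]
        by linarith
    next
      case 3
      then have "b * b \<le> (- e) * (- e)" by (intro mult_mono) auto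
      then show ?thesis using 3 zero_le_square[of b] zero_le_square[of e] by (simp add: power2_eq_square del: zero_le_square)
    qed simp
  qed
  then show ?thesis unfolding a_def b_def e_def by (simp add: abs_le_iff)
qed

definition bump :: "'a::euclidean_space \<Rightarrow> real" where
  "bump u = (max 0 (1 - (norm u)\<^sup>2))\<^sup>2"

lemma bump_nonneg: "0 \<le> bump u" by (simp add: bump_def)

lemma bump_le: "bump u \<le> indicator (cball 0 1) u"
proof (cases "norm u \<le> 1")
  case True
  have "(max 0 (1 - (norm u)\<^sup>2))\<^sup>2 \<le> 1\<^sup>2" by (intro power_mono) auto
  then show ?thesis using True by (simp add: bump_def)
next
  case False
  then have "1 < (norm u)\<^sup>2" by (simp add: one_less_power)
  then show ?thesis by (simp add: bump_def)
qed

lemma integrable_cball_bounded: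
  fixes f :: "'a::euclidean_space \<Rightarrow> real"
  assumes [measurable]: "f \<in> borel_measurable borel" and b: "\<And>u. \<bar>f u\<bar> \<le> C * indicator (cball x r) u"
  shows "integrable lborel f"
proof (rule Bochner_Integration.integrable_bound)
  have "integrable lborel (indicator (cball x r) :: 'a \<Rightarrow> real)"
    using emeasure_lborel_cball_finite[of x r] by (simp add: integrable_indicator_iff)
  then show "integrable lborel (\<lambda>u. C * indicator (cball x r) u :: real)" by simp
  show "AE u in lborel. norm (f u) \<le> norm (C * indicator (cball x r) u :: real)"
    using b by (auto intro!: AE_I2 intro: order_trans[OF _ abs_ge_self])
qed simp

lemma bump_measurable [measurable]: "bump \<in> borel_measurable borel"
  unfolding bump_def by measurable

lemma integrable_bump: "integrable lborel bump"
  by (rule integrable_cball_bounded[of _ 1 0 1]) (simp_all add: bump_le abs_of_nonneg[OF bump_nonneg])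

lemma integral_bump_pos: "0 < (\<integral>u. bump (u :: 'a::euclidean_space) \<partial>lborel)"
proof -
  have "1/2 * indicator (ball 0 (1/2)) u \<le> bump u" for u :: 'a
  proof (cases "norm u < 1/2")
    case True
    then have "(norm u)\<^sup>2 \<le> (1/2)\<^sup>2" by (intro power_mono) auto
    then have "(3/4)\<^sup>2 \<le> (max 0 (1 - (norm u)\<^sup>2))\<^sup>2" by (intro power_mono) (auto simp: power2_eq_square)
    then show ?thesis using True by (simp add: bump_def power2_eq_square)
  qed (simp add: bump_nonneg)
  then have "(\<integral>u. 1/2 * indicator (ball (0::'a) (1/2)) u \<partial>lborel) \<le> (\<integral>u. bump (u :: 'a) \<partial>lborel)"
    using emeasure_lborel_ball_finite[of "0::'a" "1/2"]
    by (intro integral_mono integrable_bump) (simp_all add: integrable_indicator_iff)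
  moreover have "(\<integral>u. 1/2 * indicator (ball (0::'a) (1/2)) u \<partial>lborel) = 1/2 * measure lborel (ball (0::'a) (1/2))"
    by simp
  moreover have "0 < measure lborel (ball (0::'a) (1/2))" by simp
  ultimately show ?thesis by linarith
qed

lemma bump_taylor:
  fixes u h :: "'a::euclidean_space"
  assumes h: "norm h \<le> 1"
  shows "\<bar>bump (u - h) - bump u - 4 * max 0 (1 - (norm u)\<^sup>2) * (u \<bullet> h)\<bar>
     \<le> 27 * (norm h)\<^sup>2 * indicator (cball 0 2) u"
proof (cases "norm u \<le> 2")
  case True
  define r where "r = (norm u)\<^sup>2"
  define s where "s = (norm (u - h))\<^sup>2"
  have sr: "s - r = (norm h)\<^sup>2 - 2 * (u \<bullet> h)"
    by (simp add: s_def r_def power2_norm_eq_inner inner_diff inner_commute)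
  have "\<bar>u \<bullet> h\<bar> \<le> 2 * norm h"
    using Cauchy_Schwarz_ineq2[of u h] mult_right_mono[OF True norm_ge_zero[of h]] by linarith
  moreover have "(norm h)\<^sup>2 \<le> norm h" using h by (simp add: power2_eq_square mult_left_le)
  moreover have "0 \<le> (norm h)\<^sup>2" by simp
  ultimately have "\<bar>s - r\<bar> \<le> 5 * norm h" unfolding sr by linarith
  then have "(s - r)\<^sup>2 \<le> 25 * (norm h)\<^sup>2"
    using power_mono[of "\<bar>s - r\<bar>" "5 * norm h" 2] by (simp add: power_mult_distrib)
  moreover have "\<bar>bump (u - h) - bump u + 2 * max 0 (1 - r) * (s - r)\<bar> \<le> (s - r)\<^sup>2"
    using truncated_square_taylor[of s r] by (simp add: bump_def s_def r_def)
  moreover have "2 * max 0 (1 - r) * (s - r) = 2 * max 0 (1 - r) * (norm h)\<^sup>2 - 4 * max 0 (1 - r) * (u \<bullet> h)"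
    unfolding sr by (simp add: algebra_simps)
  moreover have "0 \<le> 2 * max 0 (1 - r) * (norm h)\<^sup>2" by simp
  moreover have "2 * max 0 (1 - r) * (norm h)\<^sup>2 \<le> 2 * (norm h)\<^sup>2"
    by (intro mult_right_mono) (auto simp: r_def)
  ultimately have "\<bar>bump (u - h) - bump u - 4 * max 0 (1 - r) * (u \<bullet> h)\<bar> \<le> 27 * (norm h)\<^sup>2"
    by linarith
  then show ?thesis using True by (simp add: r_def)
next
  case False
  then have "1 \<le> norm (u - h)" using norm_triangle_ineq2[of u h] h by linarith
  then have "1 \<le> (norm (u - h))\<^sup>2" by (simp add: one_le_power)
  moreover have "1 < (norm u)\<^sup>2" using False by (simp add: one_less_power)
  ultimately show ?thesis using False by (simp add: bump_def)
qed

lemma integral_lborel_shift: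
  fixes f :: "'a::euclidean_space \<Rightarrow> real"
  assumes [measurable]: "f \<in> borel_measurable borel"
  shows "(\<integral>x. f (x + a) \<partial>lborel) = (\<integral>x. f x \<partial>lborel)"
  by (subst lborel_distr_plus[symmetric, of a]) (simp add: integral_distr add.commute)

text \<open>
  Convolution with a normalized bump. The difference quotients fall on the bump, so that its quadratic
  Taylor remainder makes the convolution differentiable. The bump is radial and Lebesgue measure is
  invariant under orthogonal transformations; so the symmetries of \<open>F\<close> survive.
\<close>

lemma lipschitz_smoothing_unit:
  fixes F :: "'a::euclidean_space \<Rightarrow> real"
  assumes bd: "\<And>x. \<bar>F x\<bar> \<le> C" and L: "\<And>x y. \<bar>F x - F y\<bar> \<le> L * norm (x - y)" and L0: "0 \<le> L"
  obtains G where "\<And>x. G differentiable (at x)" "\<And>x y. \<bar>G x - G y\<bar> \<le> L * norm (x - y)"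
    "\<And>x. \<bar>G x - F x\<bar> \<le> L"
    "\<And>T x. orthogonal_transformation T \<Longrightarrow> (\<And>x. F (T x) = F x) \<Longrightarrow> G (T x) = G x"
proof -
  have "continuous_on UNIV F"
    by (rule lipschitz_on_continuous_on[of L]) (auto intro!: lipschitz_onI simp: L L0 dist_norm)
  then have [measurable]: "F \<in> borel_measurable borel" by (rule borel_measurable_continuous_onI)
  have C0: "0 \<le> C" using bd[of 0] by linarith
  define c where "c = (\<integral>u. bump (u :: 'a) \<partial>lborel)"
  have c: "0 < c" unfolding c_def by (rule integral_bump_pos)
  define I where "I x = (\<integral>u. F (x + u) * bump u \<partial>lborel)" for x
  have int: "integrable lborel (\<lambda>u. F (x + u) * bump u)" for x
  proof (rule integrable_cball_bounded)
    fix u show "\<bar>F (x + u) * bump u\<bar> \<le> C * indicator (cball 0 1) u"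
      unfolding abs_mult using bd[of "x + u"] bump_le[of u] bump_nonneg[of u] C0 by (intro mult_mono) auto
  qed measurable
  have I_lip: "\<bar>I x - I y\<bar> \<le> c * (L * norm (x - y))" for x y
  proof -
    have pw: "\<bar>F (x + u) * bump u - F (y + u) * bump u\<bar> \<le> L * norm (x - y) * bump u" for u
    proof -
      have "\<bar>F (x + u) - F (y + u)\<bar> * bump u \<le> L * norm (x - y) * bump u"
        using L[of "x + u" "y + u"] by (intro mult_right_mono bump_nonneg) auto
      then show ?thesis
        by (simp add: left_diff_distrib[symmetric] abs_mult bump_nonneg)
    qed
    have "\<bar>I x - I y\<bar> = \<bar>\<integral>u. F (x + u) * bump u - F (y + u) * bump u \<partial>lborel\<bar>"
      unfolding I_def using int by simp
    also have "\<dots> \<le> (\<integral>u. \<bar>F (x + u) * bump u - F (y + u) * bump u\<bar> \<partial>lborel)"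
      by (rule integral_abs_bound)
    also have "\<dots> \<le> (\<integral>u. L * norm (x - y) * bump (u :: 'a) \<partial>lborel)"
      by (rule integral_mono) (use int integrable_bump pw in auto)
    also have "\<dots> = c * (L * norm (x - y))" by (simp add: c_def)
    finally show ?thesis .
  qed
  have I_close: "\<bar>I x - c * F x\<bar> \<le> c * L" for x
  proof -
    have "\<bar>I x - c * F x\<bar> = \<bar>\<integral>u. F (x + u) * bump u - F x * bump u \<partial>lborel\<bar>"
      unfolding I_def c_def by (simp add: Bochner_Integration.integral_diff int integrable_bump mult.commute[of "F x"])
    also have "\<dots> \<le> (\<integral>u. L * bump (u :: 'a) \<partial>lborel)"
    proof (intro order_trans[OF integral_abs_bound] integral_mono)
      fix u :: 'a
      have "\<bar>F (x + u) - F x\<bar> * bump u \<le> L * bump u"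
      proof (cases "norm u \<le> 1")
        case True
        then show ?thesis using L[of "x + u" x] mult_left_mono[OF True L0] by (intro mult_right_mono bump_nonneg) auto
      next
        case False
        then have "bump u = 0" using bump_le[of u] bump_nonneg[of u] by simp
        then show ?thesis by simp
      qed
      then show "\<bar>F (x + u) * bump u - F x * bump u\<bar> \<le> L * bump u"
        by (simp add: left_diff_distrib[symmetric] abs_mult bump_nonneg)
    qed (auto intro!: int integrable_bump integrable_abs Bochner_Integration.integrable_diff integrable_mult_right)
    also have "\<dots> = c * L" by (simp add: c_def)
    finally show ?thesis .
  qed
  have I_inv: "I (T x) = I x" if T: "orthogonal_transformation T" and FT: "\<And>x. F (T x) = F x" for T x
  proof -
    have [measurable]: "T \<in> borel_measurable borel"
      using orthogonal_transformation_linear[OF T]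
      by (intro borel_measurable_continuous_onI linear_continuous_on) (simp add: linear_conv_bounded_linear)
    have "I (T x) = (\<integral>u. F (T x + u) * bump u \<partial>distr lborel borel T)"
      unfolding I_def lborel_distr_orthogonal[OF T] ..
    also have "\<dots> = (\<integral>u. F (T x + T u) * bump (T u) \<partial>lborel)"
      by (rule integral_distr) measurable
    also have "\<dots> = I x"
      by (simp add: I_def linear_add[OF orthogonal_transformation_linear[OF T], symmetric] FT bump_def
          orthogonal_transformation_norm[OF T])
    finally show ?thesis .
  qed
  have I_conv: "I x = (\<integral>t. F t * bump (t - x) \<partial>lborel)" for x
  proof -
    have "I x = (\<integral>u. F (u + x) * bump (u + x - x) \<partial>lborel)" by (simp add: I_def add.commute)
    also have "\<dots> = (\<integral>t. F t * bump (t - x) \<partial>lborel)"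
      by (rule integral_lborel_shift[where f="\<lambda>t. F t * bump (t - x)"]) measurable
    finally show ?thesis .
  qed
  have intc: "integrable lborel (\<lambda>t. F t * bump (t - x))" for x
  proof (rule integrable_cball_bounded)
    fix u show "\<bar>F u * bump (u - x)\<bar> \<le> C * indicator (cball x 1) u"
      unfolding abs_mult using bd[of u] bump_le[of "u - x"] bump_nonneg[of "u - x"] C0
      by (intro mult_mono) (auto simp: indicator_def dist_norm norm_minus_commute)
  qed measurable
  have I_diff: "I differentiable (at x)" for x
  proof -
    define k where "k h t = F t * (4 * max 0 (1 - (norm (t - x))\<^sup>2) * ((t - x) \<bullet> h))" for h t
    have [measurable]: "k h \<in> borel_measurable borel" for h unfolding k_def by measurable
    have intk: "integrable lborel (k h)" for h
    proof (rule integrable_cball_bounded)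
      fix t
      show "\<bar>k h t\<bar> \<le> (C * (4 * norm h)) * indicator (cball x 1) t"
      proof (cases "norm (t - x) \<le> 1")
        case True
        have "\<bar>(t - x) \<bullet> h\<bar> \<le> 1 * norm h"
          using Cauchy_Schwarz_ineq2[of "t - x" h] mult_right_mono[OF True norm_ge_zero[of h]] by linarith
        then have "\<bar>max 0 (1 - (norm (t - x))\<^sup>2)\<bar> * \<bar>(t - x) \<bullet> h\<bar> \<le> 1 * norm h"
          by (intro mult_mono) auto
        then have "\<bar>F t\<bar> * (4 * (\<bar>max 0 (1 - (norm (t - x))\<^sup>2)\<bar> * \<bar>(t - x) \<bullet> h\<bar>)) \<le> C * (4 * norm h)"
          using bd[of t] C0 by (intro mult_mono) auto
        then show ?thesis using True by (simp add: k_def abs_mult dist_norm norm_minus_commute mult_ac)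
      next
        case False
        then have "1 < (norm (t - x))\<^sup>2" by (simp add: one_less_power)
        then show ?thesis using C0 by (simp add: k_def)
      qed
    qed measurable
    define D where "D h = (\<integral>t. k h t \<partial>lborel)" for h
    have "linear D"
    proof (rule linearI)
      fix a b
      have "k (a + b) = (\<lambda>t. k a t + k b t)" by (simp add: k_def fun_eq_iff inner_add_right distrib_left)
      then show "D (a + b) = D a + D b"
        unfolding D_def by (simp add: Bochner_Integration.integral_add intk)
    next
      fix s :: real and a
      have "k (s *\<^sub>R a) = (\<lambda>t. s * k a t)" by (simp add: k_def fun_eq_iff mult_ac)
      then show "D (s *\<^sub>R a) = s *\<^sub>R D a" unfolding D_def by simp
    qed
    then have blD: "bounded_linear D" by (simp add: linear_conv_bounded_linear)
    define A where "A = C * (27 * measure lborel (cball x 2))"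
    have "(I has_derivative D) (at x)"
    proof (rule has_derivativeI_sandwich[where e=1 and H="\<lambda>y. A * norm (y - x)"])
      show "((\<lambda>y. A * norm (y - x)) \<longlongrightarrow> 0) (at x)"
        by (auto intro!: tendsto_eq_intros)
      fix y assume y: "y \<in> UNIV" "y \<noteq> x" "dist y x < 1"
      define h where "h = y - x"
      have h: "norm h \<le> 1" "h \<noteq> 0" using y by (auto simp: h_def dist_norm)
      have "norm (I y - I x - D (y - x)) = \<bar>\<integral>t. F t * (bump (t - x - h) - bump (t - x) - 4 * max 0 (1 - (norm (t - x))\<^sup>2) * ((t - x) \<bullet> h)) \<partial>lborel\<bar>"
      proof -
        have "F t * (bump (t - x - h) - bump (t - x) - 4 * max 0 (1 - (norm (t - x))\<^sup>2) * ((t - x) \<bullet> h))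
          = F t * bump (t - y) - F t * bump (t - x) - k h t" for t
          by (simp add: h_def k_def algebra_simps)
        then show ?thesis unfolding I_conv D_def h_def[symmetric] using intc intk by simp
      qed
      also have "\<dots> \<le> (\<integral>t. C * (27 * (norm h)\<^sup>2 * indicator (cball x 2) t) \<partial>lborel)"
      proof (intro order_trans[OF integral_abs_bound] integral_mono)
        fix t
        have "\<bar>F t\<bar> * \<bar>bump (t - x - h) - bump (t - x) - 4 * max 0 (1 - (norm (t - x))\<^sup>2) * ((t - x) \<bullet> h)\<bar>
          \<le> C * (27 * (norm h)\<^sup>2 * indicator (cball 0 2) (t - x))"
          using bd[of t] bump_taylor[OF h(1), of "t - x"] C0 by (intro mult_mono) auto
        then show "\<bar>F t * (bump (t - x - h) - bump (t - x) - 4 * max 0 (1 - (norm (t - x))\<^sup>2) * ((t - x) \<bullet> h))\<bar>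
          \<le> C * (27 * (norm h)\<^sup>2 * indicator (cball x 2) t)"
          by (simp add: abs_mult indicator_def dist_norm norm_minus_commute)
      next
        have "integrable lborel (\<lambda>t. F t * bump (t - y) - F t * bump (t - x) - k h t)"
          using intc intk by (intro Bochner_Integration.integrable_diff) auto
        moreover have "F t * (bump (t - x - h) - bump (t - x) - 4 * max 0 (1 - (norm (t - x))\<^sup>2) * ((t - x) \<bullet> h))
          = F t * bump (t - y) - F t * bump (t - x) - k h t" for t
          by (simp add: h_def k_def algebra_simps)
        ultimately show "integrable lborel (\<lambda>t. \<bar>F t * (bump (t - x - h) - bump (t - x) - 4 * max 0 (1 - (norm (t - x))\<^sup>2) * ((t - x) \<bullet> h))\<bar>)"
          by simp
        show "integrable lborel (\<lambda>t. C * (27 * (norm h)\<^sup>2 * indicator (cball x 2) t))"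
          using emeasure_lborel_cball_finite[of x 2] by (simp add: integrable_indicator_iff)
      qed
      also have "\<dots> = A * (norm h)\<^sup>2" by (simp add: A_def)
      finally show "norm (I y - I x - D (y - x)) / norm (y - x) \<le> A * norm (y - x)"
        using h unfolding h_def[symmetric] by (simp add: divide_simps power2_eq_square mult_ac)
    qed (use blD in auto)
    then show ?thesis by (rule differentiableI)
  qed
  show thesis
  proof (rule that[of "\<lambda>x. I x / c"])
    show "(\<lambda>x. I x / c) differentiable (at x)" for x
      using I_diff[of x] c by (intro differentiable_divide) auto
    have div: "a / c - b / c = (a - b) / c" for a b by (simp add: diff_divide_distrib)
    show "\<bar>I x / c - I y / c\<bar> \<le> L * norm (x - y)" for x y
      using I_lip[of x y] c by (simp add: div abs_divide divide_simps mult_ac)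
    have "I x / c - F x = (I x - c * F x) / c" for x using c by (simp add: field_simps)
    then show "\<bar>I x / c - F x\<bar> \<le> L" for x
      using I_close[of x] c by (simp add: abs_divide divide_simps mult_ac)
    show "I (T x) / c = I x / c" if "orthogonal_transformation T" "\<And>x. F (T x) = F x" for T x
      using I_inv[OF that] by simp
  qed
qed

lemma lipschitz_smoothing:
  fixes F :: "'a::euclidean_space \<Rightarrow> real"
  assumes bd: "\<And>x. \<bar>F x\<bar> \<le> C" and L: "\<And>x y. \<bar>F x - F y\<bar> \<le> L * norm (x - y)" and L0: "0 \<le> L"
    and \<eta>: "0 < \<eta>"
  obtains G where "\<And>x. G differentiable (at x)" "\<And>x y. \<bar>G x - G y\<bar> \<le> L * norm (x - y)"
    "\<And>x. \<bar>G x - F x\<bar> \<le> \<eta> * L"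
    "\<And>T x. orthogonal_transformation T \<Longrightarrow> (\<And>x. F (T x) = F x) \<Longrightarrow> G (T x) = G x"
proof -
  have "\<bar>F (\<eta> *\<^sub>R x) - F (\<eta> *\<^sub>R y)\<bar> \<le> \<eta> * L * norm (x - y)" for x y
    using L[of "\<eta> *\<^sub>R x" "\<eta> *\<^sub>R y"] \<eta> by (simp add: scaleR_diff_right[symmetric] mult_ac)
  then obtain G where G: "\<And>x. G differentiable (at x)" "\<And>x y. \<bar>G x - G y\<bar> \<le> \<eta> * L * norm (x - y)"
    "\<And>x. \<bar>G x - F (\<eta> *\<^sub>R x)\<bar> \<le> \<eta> * L"
    "\<And>T x. orthogonal_transformation T \<Longrightarrow> (\<And>x. F (\<eta> *\<^sub>R (T x)) = F (\<eta> *\<^sub>R x)) \<Longrightarrow> G (T x) = G x"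
    using lipschitz_smoothing_unit[of "\<lambda>x. F (\<eta> *\<^sub>R x)" C "\<eta> * L"] bd L0 \<eta> by (metis less_imp_le mult_nonneg_nonneg)
  show thesis
  proof (rule that[of "\<lambda>x. G (x /\<^sub>R \<eta>)"])
    show "(\<lambda>x. G (x /\<^sub>R \<eta>)) differentiable (at x)" for x
      using differentiable_chain_at[of "\<lambda>x. x /\<^sub>R \<eta>" x G] G(1) by (simp add: o_def)
    show "\<bar>G (x /\<^sub>R \<eta>) - G (y /\<^sub>R \<eta>)\<bar> \<le> L * norm (x - y)" for x y
    proof -
      have "norm (x /\<^sub>R \<eta> - y /\<^sub>R \<eta>) = norm (x - y) / \<eta>"
        using \<eta> by (simp add: scaleR_diff_right[symmetric] divide_inverse mult.commute)
      then show ?thesis using G(2)[of "x /\<^sub>R \<eta>" "y /\<^sub>R \<eta>"] \<eta> by simp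
    qed
    show "\<bar>G (x /\<^sub>R \<eta>) - F x\<bar> \<le> \<eta> * L" for x
      using G(3)[of "x /\<^sub>R \<eta>"] \<eta> by simp
    show "G (T x /\<^sub>R \<eta>) = G (x /\<^sub>R \<eta>)" if T: "orthogonal_transformation T" and F: "\<And>x. F (T x) = F x" for T x
    proof -
      note lin = orthogonal_transformation_linear[OF T]
      have "G (T (x /\<^sub>R \<eta>)) = G (x /\<^sub>R \<eta>)"
        using F by (intro G(4)[OF T]) (simp add: linear_scale[OF lin, symmetric])
      then show ?thesis by (simp add: linear_scale[OF lin])
    qed
  qed
qed

section \<open>Rotations in coordinate planes\<close>

text \<open>
  For an involution \<open>p\<close> and angles with \<open>\<beta> (p i) = - \<beta> i\<close>, a one-parameter group of rotations:
  each plane spanned by the coordinates \<open>i\<close> and \<open>p i\<close> is rotated with angular speed \<open>\<beta> i\<close>.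
\<close>

definition rotation_group :: "('n \<Rightarrow> 'n) \<Rightarrow> ('n \<Rightarrow> real) \<Rightarrow> real \<Rightarrow> real^'n^'n" where
  "rotation_group p \<beta> s = (\<chi> i. cos (s * \<beta> i) *\<^sub>R axis i 1 + sin (s * \<beta> i) *\<^sub>R axis (p i) 1)"

text \<open>
  The coordinate frame whose \<open>j\<close>-th vector is the basis vector with index \<open>\<iota> j\<close>; multiplying by it from
  the left selects rows.
\<close>

definition row_selection :: "('k \<Rightarrow> 'n) \<Rightarrow> real^'n^'k" where
  "row_selection \<iota> = (\<chi> j. axis (\<iota> j) 1)"

lemma axis_vector_matrix: "axis i 1 v* (A :: real^'m^'n) = A $ i"
proof -
  have "(\<Sum>l\<in>UNIV. (if l = i then 1 else 0) * A $ l $ j) = A $ i $ j" for j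
    using sum.delta[of UNIV i "\<lambda>l. A $ l $ j"] by (simp add: if_distrib[of "\<lambda>x. x * _"] cong: if_cong)
  then show ?thesis by (simp add: vec_eq_iff vector_matrix_mult_def axis_def mult.commute)
qed

lemma row_selection_mult_nth: "(row_selection \<iota> ** A) $ j = A $ \<iota> j"
  by (simp add: matrix_mult_nth row_selection_def axis_vector_matrix)

lemma rotation_group_mult_nth:
  "(rotation_group p \<beta> s ** A) $ i = cos (s * \<beta> i) *\<^sub>R A $ i + sin (s * \<beta> i) *\<^sub>R A $ p i"
  by (simp add: matrix_mult_nth rotation_group_def vector_matrix_left_distrib scaleR_vector_matrix_assoc axis_vector_matrix)

context
  fixes p :: "'n::finite \<Rightarrow> 'n" and \<beta> :: "'n \<Rightarrow> real"
  assumes p: "\<And>i. p (p i) = i" and \<beta>: "\<And>i. \<beta> (p i) = - \<beta> i"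
begin

lemma rotation_group_add: "rotation_group p \<beta> s ** rotation_group p \<beta> t = rotation_group p \<beta> (s + t)"
proof -
  have "(rotation_group p \<beta> s ** rotation_group p \<beta> t) $ i = rotation_group p \<beta> (s + t) $ i" for i
    unfolding rotation_group_mult_nth
    by (simp add: rotation_group_def p \<beta> cos_add sin_add algebra_simps)
  then show ?thesis by (simp add: vec_eq_iff)
qed

lemma rotation_group_zero: "rotation_group p \<beta> 0 = mat 1"
  by (simp add: rotation_group_def vec_eq_iff mat_def axis_def)

lemma rotation_group_fixed: "p i = i \<Longrightarrow> \<beta> i = 0"
  using \<beta>[of i] by simp

lemma rotation_group_orthogonal: "orthogonal_matrix (rotation_group p \<beta> s)"
proof -
  have pe: "i = p l \<longleftrightarrow> p i = l" for i l using p by metis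
  have "transpose (rotation_group p \<beta> s) $ i $ l = rotation_group p \<beta> (- s) $ i $ l" for i l
    by (auto simp: transpose_def rotation_group_def axis_def p \<beta> pe rotation_group_fixed)
  then have "transpose (rotation_group p \<beta> s) = rotation_group p \<beta> (- s)" by (simp add: vec_eq_iff)
  then show ?thesis by (simp add: orthogonal_matrix rotation_group_add rotation_group_zero)
qed

end

definition plane_rotation :: "'n \<Rightarrow> 'n \<Rightarrow> real \<Rightarrow> real^'n^'n" where
  "plane_rotation a b = rotation_group (\<lambda>l. if l = a then b else if l = b then a else l)
     (\<lambda>l. if l = a then 1 else if l = b then - 1 else 0)"

lemma plane_rotation_orthogonal: "a \<noteq> b \<Longrightarrow> orthogonal_matrix (plane_rotation a b t)"
  unfolding plane_rotation_def by (rule rotation_group_orthogonal) auto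

lemma plane_rotation_mult_nth:
  assumes "a \<noteq> b"
  shows "(plane_rotation a b t ** A) $ a = cos t *\<^sub>R A $ a + sin t *\<^sub>R A $ b"
    "(plane_rotation a b t ** A) $ b = cos t *\<^sub>R A $ b - sin t *\<^sub>R A $ a"
    "l \<noteq> a \<Longrightarrow> l \<noteq> b \<Longrightarrow> (plane_rotation a b t ** A) $ l = A $ l"
  unfolding plane_rotation_def rotation_group_mult_nth using assms by auto

section \<open>Singular values\<close>

lemma orthogonal_matrix_rows: "orthogonal_matrix (Q :: real^'n^'n) \<longleftrightarrow> (\<forall>i j. Q $ i \<bullet> Q $ j = (if i = j then 1 else 0))"
proof -
  have "orthogonal_matrix Q \<longleftrightarrow> Q ** transpose Q = mat 1"
    by (metis orthogonal_matrix orthogonal_matrix_transpose transpose_transpose)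
  also have "\<dots> \<longleftrightarrow> (\<forall>i j. Q $ i \<bullet> Q $ j = (if i = j then 1 else 0))"
    by (simp add: vec_eq_iff matrix_matrix_mult_def transpose_def mat_def inner_vec_def)
  finally show ?thesis .
qed

lemma compact_orthogonal_matrices: "compact {Q :: real^'n^'n. orthogonal_matrix Q}"
proof -
  have "{Q :: real^'n^'n. orthogonal_matrix Q} = {Q. \<forall>i j. Q $ i \<bullet> Q $ j = (if i = j then 1 else 0)}"
    by (simp add: orthogonal_matrix_rows)
  moreover have "closed {Q :: real^'n^'n. \<forall>i j. Q $ i \<bullet> Q $ j = (if i = j then 1 else 0)}"
    by (intro closed_Collect_all closed_Collect_eq continuous_intros)
  moreover have "bounded {Q :: real^'n^'n. orthogonal_matrix Q}"
  proof (rule boundedI)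
    fix Q :: "real^'n^'n" assume "Q \<in> {Q. orthogonal_matrix Q}"
    then have "norm Q = norm (Q ** transpose Q)"
      by (simp add: norm_matrix_mult_orthogonal)
    also have "Q ** transpose Q = mat 1" using \<open>Q \<in> _\<close> by (simp add: orthogonal_matrix_def)
    finally show "norm Q \<le> norm (mat 1 :: real^'n^'n)" by simp
  qed
  ultimately show ?thesis by (simp add: compact_eq_bounded_closed)
qed

lemma max_trig_zero:
  fixes A B :: real
  assumes "\<And>t. cos t * A + sin t * B \<le> A"
  shows "B = 0"
proof -
  have "((\<lambda>t. cos t * A + sin t * B) has_real_derivative B) (at 0)"
    by (auto intro!: derivative_eq_intros)
  then show ?thesis
    by (rule DERIV_local_max[of _ _ _ 1]) (use assms in auto)
qed

text \<open>
  Maximize the weighted trace of \<open>R ** C ** transpose R'\<close> over the compact set of pairs of orthogonal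
  matrices, with distinct positive weights \<open>\<alpha>\<close>. At a maximum \<open>M\<close>, rotations of the rows and of the columns
  in the plane of \<open>i\<close> and \<open>j\<close> give \<open>\<alpha> i * M $ j $ i = \<alpha> j * M $ i $ j\<close> and the same with \<open>i, j\<close>
  exchanged on the side of \<open>M\<close>. As the weights differ, the entries off the diagonal vanish.
  Reflections show that those on the diagonal are nonnegative.
\<close>

lemma svd_exists:
  fixes C :: "real^'k^'k"
  obtains R R' :: "real^'k^'k" where "orthogonal_matrix R" "orthogonal_matrix R'"
    "\<And>i j. i \<noteq> j \<Longrightarrow> (R ** C ** transpose R') $ i $ j = 0" "\<And>i. 0 \<le> (R ** C ** transpose R') $ i $ i"
proof -
  obtain e :: "'k \<Rightarrow> nat" where e: "inj e"
    using finite_imp_inj_to_nat_seg[of "UNIV::'k set"] by auto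
  define \<alpha> where "\<alpha> i = real (e i) + 1" for i
  have \<alpha>0: "0 < \<alpha> i" for i by (simp add: \<alpha>_def)
  have \<alpha>_inj: "\<alpha> i \<noteq> \<alpha> j" if "i \<noteq> j" for i j using e that by (auto simp: \<alpha>_def inj_def)
  define m where "m A = (\<Sum>i\<in>UNIV. \<alpha> i * A $ i $ i)" for A :: "real^'k^'k"
  define O' where "O' = {Q :: real^'k^'k. orthogonal_matrix Q}"
  have cont: "continuous_on (O' \<times> O') (\<lambda>(R, R'). m (R ** C ** transpose R'))"
    unfolding m_def matrix_matrix_mult_def transpose_def split_beta by (simp, intro continuous_intros)
  have "compact (O' \<times> O')" unfolding O'_def by (intro compact_Times compact_orthogonal_matrices)
  moreover have "O' \<times> O' \<noteq> {}" using orthogonal_matrix_id by (auto simp: O'_def)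
  ultimately obtain z where z: "z \<in> O' \<times> O'"
     "\<And>y. y \<in> O' \<times> O' \<Longrightarrow> (\<lambda>(R, R'). m (R ** C ** transpose R')) y \<le> (\<lambda>(R, R'). m (R ** C ** transpose R')) z"
    using continuous_attains_sup[OF _ _ cont] by blast
  obtain R R' where RR: "z = (R, R')" by (cases z)
  have R: "orthogonal_matrix R" "orthogonal_matrix R'" using z(1) by (auto simp: RR O'_def)
  define M where "M = R ** C ** transpose R'"
  have max: "m (S ** M ** transpose S') \<le> m M" if "orthogonal_matrix S" "orthogonal_matrix S'" for S S'
  proof -
    have "(S ** R, S' ** R') \<in> O' \<times> O'" using that R by (auto simp: O'_def orthogonal_matrix_mul)
    from z(2)[OF this] show ?thesis
      by (simp add: RR M_def matrix_transpose_mul matrix_mul_assoc)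
  qed
  have max1: "m (S ** M) \<le> m M" if "orthogonal_matrix S" for S
    using max[OF that orthogonal_matrix_id] by simp
  have m_tr: "m (transpose A) = m A" for A by (simp add: m_def transpose_def)
  have max2: "m (S ** transpose M) \<le> m (transpose M)" if "orthogonal_matrix S" for S
  proof -
    have "m (S ** transpose M) = m (transpose (S ** transpose M))" by (rule m_tr[symmetric])
    also have "transpose (S ** transpose M) = mat 1 ** M ** transpose S" by (simp add: matrix_transpose_mul)
    also have "m \<dots> \<le> m M" by (rule max[OF orthogonal_matrix_id that])
    finally show ?thesis by (simp add: m_tr)
  qed
  have crit: "\<alpha> i * A $ j $ i = \<alpha> j * A $ i $ j"
    if ij: "i \<noteq> j" and mx: "\<And>S. orthogonal_matrix S \<Longrightarrow> m (S ** A) \<le> m A" for i j and A :: "real^'k^'k"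
  proof -
    have split: "(\<Sum>l\<in>UNIV. g l) = g i + g j + (\<Sum>l\<in>UNIV - {i,j}. g l)" for g :: "'k \<Rightarrow> real"
      using sum.subset_diff[of "{i,j}" UNIV g] ij by simp
    have "cos t * (\<alpha> i * A $ i $ i + \<alpha> j * A $ j $ j) + sin t * (\<alpha> i * A $ j $ i - \<alpha> j * A $ i $ j)
        \<le> \<alpha> i * A $ i $ i + \<alpha> j * A $ j $ j" for t
    proof -
      have "m (plane_rotation i j t ** A) \<le> m A" by (intro mx plane_rotation_orthogonal ij)
      moreover have "(\<Sum>l\<in>UNIV - {i,j}. \<alpha> l * (plane_rotation i j t ** A) $ l $ l) = (\<Sum>l\<in>UNIV - {i,j}. \<alpha> l * A $ l $ l)"
        by (intro sum.cong) (auto simp: plane_rotation_mult_nth[OF ij])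
      ultimately show ?thesis unfolding m_def split
        by (simp add: plane_rotation_mult_nth[OF ij] algebra_simps)
    qed
    from max_trig_zero[OF this] show ?thesis by simp
  qed
  have off: "M $ i $ j = 0" if ij: "i \<noteq> j" for i j
  proof -
    have 1: "\<alpha> i * M $ j $ i = \<alpha> j * M $ i $ j" by (rule crit[OF ij max1])
    have 2: "\<alpha> i * M $ i $ j = \<alpha> j * M $ j $ i" using crit[OF ij max2] by (simp add: transpose_def)
    have "\<alpha> i * (\<alpha> i * M $ i $ j) = \<alpha> j * (\<alpha> j * M $ i $ j)"
      unfolding 2 using 1 by (metis mult.left_commute)
    then have "(\<alpha> i - \<alpha> j) * (\<alpha> i + \<alpha> j) * M $ i $ j = 0" by (simp add: algebra_simps)
    then show ?thesis using \<alpha>_inj[OF ij] \<alpha>0[of i] \<alpha>0[of j] by auto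
  qed
  have nonneg: "0 \<le> M $ i $ i" for i
  proof -
    define S :: "real^'k^'k" where "S = (\<chi> l. (if l = i then - 1 else 1) *\<^sub>R axis l 1)"
    have "orthogonal_matrix S"
      by (auto simp: orthogonal_matrix_rows S_def inner_axis_axis)
    from max1[OF this] have "m (S ** M) \<le> m M" .
    moreover have "(S ** M) $ l = (if l = i then - 1 else 1) *\<^sub>R M $ l" for l
      unfolding matrix_mult_nth S_def by (simp only: vec_lambda_beta scaleR_vector_matrix_assoc axis_vector_matrix)
    then have "m (S ** M) = (\<Sum>l\<in>UNIV. \<alpha> l * M $ l $ l - (if l = i then 2 * (\<alpha> i * M $ i $ i) else 0))"
      unfolding m_def by (intro sum.cong) auto
    then have "m (S ** M) = m M - 2 * (\<alpha> i * M $ i $ i)"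
      by (simp add: sum_subtractf m_def)
    ultimately have "0 \<le> \<alpha> i * M $ i $ i" by linarith
    then show ?thesis using \<alpha>0[of i] by (simp add: zero_le_mult_iff)
  qed
  show thesis by (rule that[OF R]) (auto simp: M_def[symmetric] off nonneg)
qed

section \<open>Normal form of a pair of frames\<close>

lemma stiefel_iff: "\<theta> \<in> stiefel \<longleftrightarrow> \<theta> ** transpose \<theta> = mat 1"
  by (simp add: stiefel_def vec_eq_iff matrix_matrix_mult_def transpose_def mat_def inner_vec_def)

lemma stiefel_mult_left: "\<theta> \<in> stiefel \<Longrightarrow> orthogonal_matrix R \<Longrightarrow> R ** \<theta> \<in> stiefel"
proof -
  assume a: "\<theta> \<in> stiefel" "orthogonal_matrix R"
  have "R ** \<theta> ** transpose (R ** \<theta>) = R ** (\<theta> ** transpose \<theta>) ** transpose R"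
    by (simp add: matrix_transpose_mul matrix_mul_assoc)
  then show ?thesis using a by (simp add: stiefel_iff orthogonal_matrix_def)
qed

lemma orthonormal_family_extend:
  fixes S :: "(real^'d) set"
  assumes S: "\<And>x y. x \<in> S \<Longrightarrow> y \<in> S \<Longrightarrow> x \<bullet> y = (if x = y then 1 else 0)"
  obtains \<kappa> :: "'d \<Rightarrow> real^'d" where "\<And>i j. \<kappa> i \<bullet> \<kappa> j = (if i = j then 1 else 0)" "S \<subseteq> range \<kappa>"
proof -
  have pS: "pairwise orthogonal S" using S by (auto simp: pairwise_def orthogonal_def)
  obtain U where U: "U \<inter> insert 0 S = {}" "pairwise orthogonal (S \<union> U)" "span (S \<union> U) = span (S \<union> UNIV)"
    using orthogonal_extension_strong[OF pS, of UNIV] by metis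
  define B where "B = S \<union> sgn ` U"
  have U0: "u \<noteq> 0" if "u \<in> U" for u using U(1) that by auto
  have SU: "x \<bullet> y = 0" if "x \<in> S" "y \<in> U" for x y
  proof -
    have "x \<noteq> y" using U(1) that by auto
    then show ?thesis using U(2) that by (auto simp: pairwise_def orthogonal_def)
  qed
  have UU: "sgn x \<bullet> sgn y = 0" if "x \<in> U" "y \<in> U" "x \<noteq> y" for x y
    using U(2) that by (auto simp: pairwise_def orthogonal_def sgn_div_norm)
  have B: "x \<bullet> y = (if x = y then 1 else 0)" if "x \<in> B" "y \<in> B" for x y
  proof -
    have norm1: "z \<bullet> z = 1" if "z \<in> B" for z
    proof (cases "z \<in> S")
      case False
      then obtain u where "u \<in> U" "z = sgn u" using \<open>z \<in> B\<close> by (auto simp: B_def)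
      then show ?thesis using U0[of u] by (simp add: dot_square_norm norm_sgn)
    qed (use S[of z z] in auto)
    have "x \<bullet> y = 0" if ne: "x \<noteq> y"
      using \<open>x \<in> B\<close> \<open>y \<in> B\<close> ne S SU UU unfolding B_def
      by (auto simp: sgn_div_norm inner_commute) (metis inner_commute mult_zero_right)+
    then show ?thesis using norm1[OF that(1)] by auto
  qed
  have "0 \<notin> B" using B[of 0 0] by auto
  moreover have "pairwise orthogonal B" using B by (auto simp: pairwise_def orthogonal_def)
  ultimately have ind: "independent B" by (rule pairwise_orthogonal_independent[rotated])
  have "S \<union> U \<subseteq> span B"
  proof
    fix x assume "x \<in> S \<union> U"
    moreover have "u = norm u *\<^sub>R sgn u" for u :: "real^'d" by (cases "u = 0") (simp_all add: sgn_div_norm)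
    ultimately show "x \<in> span B"
      unfolding B_def by (metis UnCI UnE imageI span_base span_scale)
  qed
  then have "span (S \<union> U) \<subseteq> span B" by (simp add: span_minimal)
  then have "span B = UNIV" using U(3) by auto
  then have "card B = dim (UNIV :: (real^'d) set)"
    using dim_eq_card[of B UNIV] ind by simp
  then have cB: "card B = CARD('d)" by simp
  moreover have "finite B" using ind by (rule independent_imp_finite)
  ultimately obtain \<kappa> :: "'d \<Rightarrow> real^'d" where \<kappa>: "bij_betw \<kappa> UNIV B"
    using finite_same_card_bij[of "UNIV :: 'd set" B] by auto
  show thesis
  proof (rule that[of \<kappa>])
    show "S \<subseteq> range \<kappa>" using \<kappa> by (auto simp: bij_betw_def B_def)
    fix i j
    have "\<kappa> i \<in> B" "\<kappa> j \<in> B" "\<kappa> i = \<kappa> j \<longleftrightarrow> i = j" using \<kappa> by (auto simp: bij_betw_def inj_eq)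
    then show "\<kappa> i \<bullet> \<kappa> j = (if i = j then 1 else 0)" using B by simp
  qed
qed

text \<open>
  Principal angles. After orthogonal changes within the two spans, the frames become \<open>a\<close> and \<open>b\<close> with
  \<open>a $ i \<bullet> b $ j = 0\<close> for \<open>i \<noteq> j\<close> and \<open>b $ j = cos (\<phi> j) a $ j + sin (\<phi> j) w j\<close>, where the \<open>w j\<close> are
  orthonormal and orthogonal to all vectors of \<open>a\<close>. In an orthonormal basis \<open>h\<close> containing the \<open>a $ j\<close>
  and the \<open>w j\<close>, a rotation by the angles \<open>\<phi> j\<close>, which are at most \<open>pi / 2\<close>, moves the first frame
  to the second. The condition on \<open>p\<close> says that the rotation leaves the span of the first frame
  orthogonally.
\<close>

lemma frame_pair_normal_form:
  fixes \<theta> \<theta>' :: "real^'d^'k"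
  assumes \<theta>: "\<theta> \<in> stiefel" "\<theta>' \<in> stiefel"
  obtains R R' :: "real^'k^'k" and h :: "real^'d^'d" and \<iota> :: "'k \<Rightarrow> 'd" and p :: "'d \<Rightarrow> 'd" and \<beta> :: "'d \<Rightarrow> real"
  where "orthogonal_matrix R" "orthogonal_matrix R'" "orthogonal_matrix h" "inj \<iota>"
    "\<And>i. p (p i) = i" "\<And>i. \<beta> (p i) = - \<beta> i" "\<And>i. \<bar>\<beta> i\<bar> \<le> pi / 2"
    "\<And>j. \<beta> (\<iota> j) \<noteq> 0 \<Longrightarrow> p (\<iota> j) \<notin> range \<iota>"
    "R ** \<theta> = row_selection \<iota> ** h" "R' ** \<theta>' = row_selection \<iota> ** rotation_group p \<beta> 1 ** h"
proof -
  obtain R R' :: "real^'k^'k" where R: "orthogonal_matrix R" "orthogonal_matrix R'"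
    and off: "\<And>i j. i \<noteq> j \<Longrightarrow> (R ** (\<theta> ** transpose \<theta>') ** transpose R') $ i $ j = 0"
    and nn: "\<And>i. 0 \<le> (R ** (\<theta> ** transpose \<theta>') ** transpose R') $ i $ i"
    by (rule svd_exists[of "\<theta> ** transpose \<theta>'"]) blast
  define a where "a = R ** \<theta>"
  define b where "b = R' ** \<theta>'"
  have aa: "a $ i \<bullet> a $ j = (if i = j then 1 else 0)" and bb: "b $ i \<bullet> b $ j = (if i = j then 1 else 0)" for i j
    using stiefel_mult_left[OF \<theta>(1) R(1)] stiefel_mult_left[OF \<theta>(2) R(2)]
    unfolding a_def[symmetric] b_def[symmetric] stiefel_def by auto
  have "R ** (\<theta> ** transpose \<theta>') ** transpose R' = a ** transpose b"
    by (simp add: a_def b_def matrix_transpose_mul matrix_mul_assoc)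
  moreover have "(a ** transpose b) $ i $ j = a $ i \<bullet> b $ j" for i j
    by (simp add: matrix_matrix_mult_def transpose_def inner_vec_def)
  ultimately have ab0: "\<And>i j. i \<noteq> j \<Longrightarrow> a $ i \<bullet> b $ j = 0" and ab: "\<And>i. 0 \<le> a $ i \<bullet> b $ i"
    using off nn by auto
  define c where "c j = a $ j \<bullet> b $ j" for j
  have na: "norm (a $ j) = 1" "norm (b $ j) = 1" for j using aa[of j j] bb[of j j] by (auto simp: norm_eq_1)
  have c: "0 \<le> c j" "c j \<le> 1" for j
    using ab[of j] norm_cauchy_schwarz[of "a $ j" "b $ j"] na[of j] by (auto simp: c_def)
  define \<phi> where "\<phi> j = arccos (c j)" for j
  have cphi: "cos (\<phi> j) = c j" for j using c[of j] by (simp add: \<phi>_def)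
  have \<phi>: "0 \<le> \<phi> j" "\<phi> j \<le> pi / 2" for j
    using c[of j] arccos_le_pi2[of "c j"] arccos_lbound[of "c j"] by (auto simp: \<phi>_def)
  have sin0: "sin (\<phi> j) = 0 \<longleftrightarrow> \<phi> j = 0" for j
    using \<phi>[of j] sin_gt_zero[of "\<phi> j"] by force
  \<comment> \<open>Where the angle is \<open>0\<close> the two vectors agree and no direction \<open>w j\<close> is needed; there may be no
    room for one.\<close>
  define J where "J = {j. \<phi> j \<noteq> 0}"
  define w where "w j = (b $ j - c j *\<^sub>R a $ j) /\<^sub>R sin (\<phi> j)" for j
  have sw: "sin (\<phi> j) *\<^sub>R w j = b $ j - c j *\<^sub>R a $ j" if "j \<in> J" for j
    using that sin0[of j] by (simp add: w_def J_def)
  have bJ: "b $ j = a $ j" if "j \<notin> J" for j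
  proof -
    have "c j = 1" using that cphi[of j] by (simp add: J_def)
    then have "(b $ j - a $ j) \<bullet> (b $ j - a $ j) = 0"
      using aa[of j j] bb[of j j] by (simp add: inner_diff c_def inner_commute)
    then show ?thesis by simp
  qed
  have wa: "w j \<bullet> a $ i = 0" for i j
  proof -
    have "(b $ j - c j *\<^sub>R a $ j) \<bullet> a $ i = a $ i \<bullet> b $ j - c j * (a $ i \<bullet> a $ j)"
      by (simp only: inner_diff_left inner_scaleR_left) (simp add: inner_commute)
    also have "\<dots> = 0" using ab0[of i j] by (cases "i = j") (simp_all add: aa c_def)
    finally show ?thesis by (simp add: w_def)
  qed
  have ww: "w i \<bullet> w j = (if i = j then 1 else 0)" if "i \<in> J" "j \<in> J" for i j
  proof -
    have "(b $ i - c i *\<^sub>R a $ i) \<bullet> (b $ j - c j *\<^sub>R a $ j)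
        = b $ i \<bullet> b $ j - c j * (a $ j \<bullet> b $ i) - c i * (a $ i \<bullet> b $ j) + c i * (c j * (a $ i \<bullet> a $ j))"
      unfolding inner_diff_left inner_diff_right inner_scaleR_left inner_scaleR_right inner_commute[of "b $ i" "a $ j"]
      by (simp add: right_diff_distrib)
    also have "\<dots> = (if i = j then (sin (\<phi> i))\<^sup>2 else 0)"
    proof (cases "i = j")
      case True
      then show ?thesis using sin_squared_eq[of "\<phi> j"]
        by (simp add: aa bb c_def[symmetric] cphi power2_eq_square)
    next
      case False
      then show ?thesis using ab0[of i j] ab0[of j i] by (simp add: aa bb)
    qed
    finally have "(b $ i - c i *\<^sub>R a $ i) \<bullet> (b $ j - c j *\<^sub>R a $ j) = (if i = j then (sin (\<phi> i))\<^sup>2 else 0)" .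
    then have "w i \<bullet> w j = (if i = j then (sin (\<phi> i))\<^sup>2 else 0) / (sin (\<phi> i) * sin (\<phi> j))"
      by (simp add: w_def divide_inverse)
    then show ?thesis using that sin0[of i] sin0[of j] by (auto simp: J_def power2_eq_square)
  qed
  define S where "S = range (\<lambda>j. a $ j) \<union> w ` J"
  have a_eq: "a $ i = a $ j \<longleftrightarrow> i = j" for i j using aa[of i j] aa[of i i] by (metis zero_neq_one)
  have w_eq: "w i = w j \<longleftrightarrow> i = j" if "i \<in> J" "j \<in> J" for i j
    using ww[OF that] ww[OF that(1,1)] by (metis zero_neq_one)
  have aw: "a $ i \<noteq> w j" for i j
  proof
    assume "a $ i = w j"
    then show False using wa[of j i] aa[of i i] by simp
  qed
  obtain \<kappa> :: "'d \<Rightarrow> real^'d" where \<kappa>: "\<And>i j. \<kappa> i \<bullet> \<kappa> j = (if i = j then 1 else 0)" "S \<subseteq> range \<kappa>"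
  proof (rule orthonormal_family_extend[of S])
    fix x y assume "x \<in> S" "y \<in> S"
    then consider i j where "x = a $ i" "y = a $ j" | i j where "x = a $ i" "y = w j"
      | i j where "x = w i" "y = a $ j" | i j where "x = w i" "y = w j" "i \<in> J" "j \<in> J"
      unfolding S_def by blast
    then show "x \<bullet> y = (if x = y then 1 else 0)"
    proof cases
      case (1 i j) then show ?thesis by (simp add: aa a_eq)
    next
      case (2 i j) then show ?thesis using wa[of j i] aw[of i j] by (simp add: inner_commute[of "a $ i"])
    next
      case (3 i j) then show ?thesis using wa[of i j] aw[of j i] by (simp add: eq_commute[of "w i"])
    next
      case (4 i j) then show ?thesis by (simp add: ww w_eq)
    qed
  qed blast
  have "\<forall>j. a $ j \<in> range \<kappa>" using \<kappa>(2) unfolding S_def by blast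
  then have "\<forall>j. \<exists>i. \<kappa> i = a $ j" by (metis rangeE)
  then obtain \<iota> where \<iota>: "\<And>j. \<kappa> (\<iota> j) = a $ j" by metis
  have "\<forall>j\<in>J. w j \<in> range \<kappa>" using \<kappa>(2) unfolding S_def by blast
  then have "\<forall>j\<in>J. \<exists>i. \<kappa> i = w j" by (metis rangeE)
  then obtain \<tau> where \<tau>: "\<And>j. j \<in> J \<Longrightarrow> \<kappa> (\<tau> j) = w j" by metis
  have inji: "inj \<iota>" by (rule injI) (metis \<iota> a_eq)
  have injt: "inj_on \<tau> J" by (rule inj_onI) (metis \<tau> w_eq)
  have disj: "\<tau> j \<noteq> \<iota> i" if "j \<in> J" for i j using \<iota>[of i] \<tau>[OF that] aw[of i j] by metis
  define p where "p i = (if i \<in> \<iota> ` J then \<tau> (inv \<iota> i) else if i \<in> \<tau> ` J then \<iota> (inv_into J \<tau> i) else i)" for i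
  define \<beta> where "\<beta> i = (if i \<in> \<iota> ` J then \<phi> (inv \<iota> i) else if i \<in> \<tau> ` J then - \<phi> (inv_into J \<tau> i) else 0)" for i
  have pio: "p (\<iota> j) = \<tau> j" and bioJ: "\<beta> (\<iota> j) = \<phi> j" if "j \<in> J" for j
    using that inji by (auto simp: p_def \<beta>_def)
  have ptau: "p (\<tau> j) = \<iota> j" "\<beta> (\<tau> j) = - \<phi> j" if "j \<in> J" for j
    using that injt disj[OF that] by (auto simp: p_def \<beta>_def image_iff)
  have poth: "p i = i" "\<beta> i = 0" if "i \<notin> \<iota> ` J" "i \<notin> \<tau> ` J" for i
    using that by (auto simp: p_def \<beta>_def)
  have bio: "\<beta> (\<iota> j) = \<phi> j" for j
  proof (cases "j \<in> J")
    case False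
    then have "\<iota> j \<notin> \<iota> ` J" using inji by (auto simp: inj_image_mem_iff)
    moreover have "\<iota> j \<notin> \<tau> ` J" using disj by (metis imageE)
    ultimately show ?thesis using poth(2)[of "\<iota> j"] False by (simp add: J_def)
  qed (rule bioJ)
  show thesis
  proof (rule that[OF R, of "\<chi> i. \<kappa> i" \<iota> p \<beta>])
    show "orthogonal_matrix (\<chi> i. \<kappa> i)" by (simp add: orthogonal_matrix_rows \<kappa>(1))
    show "inj \<iota>" by fact
    fix i
    consider j where "j \<in> J" "i = \<iota> j" | j where "j \<in> J" "i = \<tau> j" | "i \<notin> \<iota> ` J" "i \<notin> \<tau> ` J" by blast
    then have "p (p i) = i \<and> \<beta> (p i) = - \<beta> i \<and> \<bar>\<beta> i\<bar> \<le> pi / 2"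
    proof cases
      case 1
      then show ?thesis using pio ptau bio \<phi>[of j] by auto
    next
      case 2
      then show ?thesis using pio ptau bio \<phi>[of j] by auto
    next
      case 3
      then show ?thesis using poth[OF 3] by simp
    qed
    then show "p (p i) = i" "\<beta> (p i) = - \<beta> i" "\<bar>\<beta> i\<bar> \<le> pi / 2" by auto
  next
    fix j assume "\<beta> (\<iota> j) \<noteq> 0"
    then have "j \<in> J" using bio by (simp add: J_def)
    then show "p (\<iota> j) \<notin> range \<iota>" using pio disj by auto
  next
    show "R ** \<theta> = row_selection \<iota> ** (\<chi> i. \<kappa> i)"
      unfolding a_def[symmetric] vec_eq_iff[of a] by (simp add: row_selection_mult_nth \<iota>)
    have "b $ j = cos (\<phi> j) *\<^sub>R a $ j + sin (\<phi> j) *\<^sub>R \<kappa> (p (\<iota> j))" for j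
    proof (cases "j \<in> J")
      case True
      then show ?thesis using sw[OF True] by (simp add: pio \<tau> cphi)
    next
      case False
      then show ?thesis using bJ[OF False] by (simp add: J_def)
    qed
    then show "R' ** \<theta>' = row_selection \<iota> ** rotation_group p \<beta> 1 ** (\<chi> i. \<kappa> i)"
      unfolding b_def[symmetric] vec_eq_iff[of b]
      by (simp add: matrix_mul_assoc[symmetric] row_selection_mult_nth rotation_group_mult_nth \<iota> bio)
  qed
qed

section \<open>Gradients\<close>

lemma vec_lambda_sum_axis: "(\<chi> j. v j) = (\<Sum>j\<in>UNIV. axis j (v j :: 'a::comm_monoid_add))"
proof -
  have "(\<Sum>j\<in>UNIV. axis j (v j)) $ i = v i" for i
    by (simp add: sum_component axis_def)
  then show ?thesis by (simp add: vec_eq_iff)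
qed

lemma bessel_rows:
  fixes Q :: "real^'n^'n" and v :: "real^'n"
  assumes "orthogonal_matrix Q"
  shows "(\<Sum>l\<in>UNIV. (v \<bullet> Q $ l)\<^sup>2) = (norm v)\<^sup>2"
proof -
  have "(norm (Q *v v))\<^sup>2 = (norm v)\<^sup>2"
    using orthogonal_transformation_norm[OF orthogonal_transformation_matrix_vector[OF assms]] by simp
  moreover have "(norm (Q *v v))\<^sup>2 = (\<Sum>l\<in>UNIV. (v \<bullet> Q $ l)\<^sup>2)"
    unfolding power2_norm_eq_inner inner_vec_def[of "Q *v v"]
    by (simp add: matrix_vector_mul_component inner_commute[of v] power2_eq_square)
  ultimately show ?thesis by simp
qed

definition gradient :: "('a::euclidean_space \<Rightarrow> real) \<Rightarrow> 'a \<Rightarrow> 'a" where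
  "gradient G x = (\<Sum>b\<in>Basis. frechet_derivative G (at x) b *\<^sub>R b)"

lemma gradient_has_derivative:
  assumes "G differentiable (at x)"
  shows "(G has_derivative (\<lambda>v. gradient G x \<bullet> v)) (at x)"
proof -
  have D: "(G has_derivative frechet_derivative G (at x)) (at x)"
    using assms by (simp add: frechet_derivative_works)
  then have lin: "linear (frechet_derivative G (at x))" by (rule has_derivative_linear)
  have "frechet_derivative G (at x) v = gradient G x \<bullet> v" for v
  proof -
    have "frechet_derivative G (at x) v = frechet_derivative G (at x) (\<Sum>b\<in>Basis. (v \<bullet> b) *\<^sub>R b)"
      by (simp add: euclidean_representation)
    also have "\<dots> = gradient G x \<bullet> v"
      by (simp add: linear_sum[OF lin] linear_scale[OF lin] gradient_def inner_sum_left mult.commute inner_commute[of v])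
    finally show ?thesis .
  qed
  then have "frechet_derivative G (at x) = (\<lambda>v. gradient G x \<bullet> v)" by auto
  with D show ?thesis by simp
qed

lemma gradient_unique:
  assumes "G differentiable (at x)" "(G has_derivative (\<lambda>v. g \<bullet> v)) (at x)"
  shows "gradient G x = g"
proof -
  have "(\<lambda>v. gradient G x \<bullet> v) = (\<lambda>v. g \<bullet> v)"
    using has_derivative_unique[OF gradient_has_derivative[OF assms(1)] assms(2)] .
  then show ?thesis by (metis vector_eq_rdot)
qed

lemma gradient_difference_quotient:
  assumes "G differentiable (at x)"
  shows "(\<lambda>n. (G (x + inverse (real (Suc n)) *\<^sub>R v) - G x) * real (Suc n)) \<longlonglongrightarrow> gradient G x \<bullet> v"
proof -
  have d: "((\<lambda>s. x + s *\<^sub>R v) has_derivative (\<lambda>s. s *\<^sub>R v)) (at 0)"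
    by (auto intro!: derivative_eq_intros)
  have "(G has_derivative (\<lambda>v. gradient G x \<bullet> v)) (at (x + 0 *\<^sub>R v))"
    using gradient_has_derivative[OF assms] by simp
  from has_derivative_compose[OF d this]
  have "((\<lambda>s. G (x + s *\<^sub>R v)) has_derivative (\<lambda>s. gradient G x \<bullet> (s *\<^sub>R v))) (at 0)" .
  then have "((\<lambda>s. G (x + s *\<^sub>R v)) has_real_derivative gradient G x \<bullet> v) (at 0)"
    by (simp add: has_field_derivative_def mult_commute_abs)
  then have lim: "((\<lambda>s. (G (x + s *\<^sub>R v) - G x) / s) \<longlongrightarrow> gradient G x \<bullet> v) (at 0)"
    by (simp add: has_field_derivative_iff)
  have "(\<lambda>n. inverse (real (Suc n))) \<longlonglongrightarrow> 0" by (rule LIMSEQ_inverse_real_of_nat)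
  then have "filterlim (\<lambda>n. inverse (real (Suc n))) (at 0) sequentially"
    by (auto simp: filterlim_at intro!: always_eventually)
  from filterlim_compose[OF lim this] show ?thesis by (simp add: divide_inverse del: of_nat_Suc)
qed

lemma gradient_norm_le:
  assumes "G differentiable (at x)" "\<And>x y. \<bar>G x - G y\<bar> \<le> l * norm (x - y)"
  shows "norm (gradient G x) \<le> l"
proof -
  define v where "v = gradient G x"
  have "v \<bullet> v \<le> l * norm v"
  proof (rule LIMSEQ_le_const2)
    show "(\<lambda>n. (G (x + inverse (real (Suc n)) *\<^sub>R v) - G x) * real (Suc n)) \<longlonglongrightarrow> v \<bullet> v"
      using gradient_difference_quotient[OF assms(1), of v] by (simp add: v_def)
    have "(G (x + inverse (real (Suc n)) *\<^sub>R v) - G x) * real (Suc n) \<le> l * norm v" for n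
    proof -
      have "G (x + inverse (real (Suc n)) *\<^sub>R v) - G x \<le> l * (inverse (real (Suc n)) * norm v)"
        using assms(2)[of "x + inverse (real (Suc n)) *\<^sub>R v" x] by simp
      from mult_right_mono[OF this, of "real (Suc n)"]
      have "(G (x + inverse (real (Suc n)) *\<^sub>R v) - G x) * real (Suc n)
          \<le> l * (inverse (real (Suc n)) * norm v) * real (Suc n)" by linarith
      also have "\<dots> = l * norm v" by simp
      finally show ?thesis .
    qed
    then show "\<exists>N. \<forall>n\<ge>N. (G (x + inverse (real (Suc n)) *\<^sub>R v) - G x) * real (Suc n) \<le> l * norm v" by blast
  qed
  then have "norm v * norm v \<le> l * norm v" by (simp add: dot_square_norm power2_eq_square)
  moreover have "0 \<le> l"
  proof -
    obtain b :: 'a where b: "b \<in> Basis" using nonempty_Basis by blast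
    have "0 \<le> \<bar>G (x + b) - G x\<bar>" by simp
    also have "\<dots> \<le> l * norm ((x + b) - x)" by (rule assms(2))
    finally show ?thesis using b by simp
  qed
  ultimately show ?thesis unfolding v_def[symmetric] by (cases "v = 0") auto
qed

lemma borel_measurable_gradient:
  fixes G :: "'a::euclidean_space \<Rightarrow> real"
  assumes "\<And>x. G differentiable (at x)"
  shows "gradient G \<in> borel_measurable borel"
proof -
  have "continuous_on UNIV G"
    using assms by (intro differentiable_imp_continuous_on) (simp add: differentiable_on_def)
  then have [measurable]: "G \<in> borel_measurable borel" by (rule borel_measurable_continuous_onI)
  have "(\<lambda>x. gradient G x \<bullet> b) \<in> borel_measurable borel" for b
    by (rule borel_measurable_LIMSEQ_real[OF gradient_difference_quotient[OF assms]]) measurable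
  then show ?thesis using borel_measurable_euclidean_space[of "gradient G" borel] by simp
qed

section \<open>The geodesic between two frames under a random rotation\<close>

text \<open>
  A fixed pair of frames in normal form, a differentiable Lipschitz function \<open>G\<close> which depends on a
  frame only through its span, and a random orthogonal matrix \<open>Q\<close>. The geodesic from \<open>frame Q\<close> to
  \<open>frame (rotation_group p \<beta> 1 ** Q)\<close> starts with velocity \<open>speed Q\<close>, and \<open>slope Q\<close> is the
  derivative of \<open>G\<close> along it.
\<close>

locale rotated_frame = nu: prob_space \<nu>
  for \<nu> :: "(real^'d^'d) measure" +
  fixes G :: "real^'d^'k \<Rightarrow> real" and l :: real and \<iota> :: "'k \<Rightarrow> 'd" and p :: "'d \<Rightarrow> 'd" and \<beta> :: "'d \<Rightarrow> real"
  assumes sets_nu: "sets \<nu> = sets (orthogonal_space :: (real^'d^'d) measure)"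
    and nu_measurable: "\<And>h. orthogonal_matrix h \<Longrightarrow> (\<lambda>Q. h ** Q) \<in> measurable \<nu> \<nu>"
    and nu_invariant: "\<And>h. orthogonal_matrix h \<Longrightarrow> distr \<nu> \<nu> (\<lambda>Q. h ** Q) = \<nu>"
    and diff: "\<And>x. G differentiable (at x)"
    and lip: "\<And>x y. \<bar>G x - G y\<bar> \<le> l * norm (x - y)"
    and inv: "\<And>R \<theta>. orthogonal_matrix R \<Longrightarrow> G (R ** \<theta>) = G \<theta>"
    and inj: "inj \<iota>"
    and p: "\<And>i. p (p i) = i" and \<beta>p: "\<And>i. \<beta> (p i) = - \<beta> i" and \<beta>_le: "\<And>i. \<bar>\<beta> i\<bar> \<le> pi / 2"
    and transversal: "\<And>j. \<beta> (\<iota> j) \<noteq> 0 \<Longrightarrow> p (\<iota> j) \<notin> range \<iota>"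
begin

abbreviation frame :: "real^'d^'d \<Rightarrow> real^'d^'k" where
  "frame Q \<equiv> row_selection \<iota> ** Q"

definition speed :: "real^'d^'d \<Rightarrow> real^'d^'k" where
  "speed Q = (\<chi> j. \<beta> (\<iota> j) *\<^sub>R Q $ p (\<iota> j))"

definition slope :: "real^'d^'d \<Rightarrow> real" where
  "slope Q = gradient G (frame Q) \<bullet> speed Q"

lemma space_nu: "space \<nu> = {Q. orthogonal_matrix Q}"
  using sets_eq_imp_space_eq[OF sets_nu] by (simp add: space_restrict_space)

lemma measurable_nu:
  assumes "f \<in> borel_measurable borel" shows "f \<in> borel_measurable \<nu>"
  unfolding measurable_cong_sets[OF sets_nu refl] by (rule measurable_restrict_space1[OF assms])

lemma continuous_on_G: "continuous_on UNIV G"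
  using diff by (intro differentiable_imp_continuous_on) (simp add: differentiable_on_def)

lemma continuous_on_matrix_mult: "continuous_on UNIV (\<lambda>Q :: real^'m^'d. (A :: real^'d^'k) ** Q)"
  by (intro linear_continuous_on bounded_linear_matrix_mult_left)

lemma G_measurable: "(\<lambda>Q. G ((A :: real^'d^'k) ** Q)) \<in> borel_measurable \<nu>"
  by (intro measurable_nu borel_measurable_continuous_onI
      continuous_on_compose2[OF continuous_on_G continuous_on_matrix_mult]) auto

lemma gradient_measurable: "(\<lambda>Q. gradient G (frame Q) $ j $ i) \<in> borel_measurable \<nu>"
proof (rule measurable_nu)
  have g: "(\<lambda>Q. gradient G (frame Q)) \<in> borel_measurable borel"
    by (rule measurable_compose[OF borel_measurable_continuous_onI[OF continuous_on_matrix_mult] borel_measurable_gradient[OF diff]])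
  have "(\<lambda>\<theta>::real^'d^'k. \<theta> $ j $ i) \<in> borel_measurable borel"
    by (intro borel_measurable_continuous_onI continuous_intros)
  from measurable_compose[OF g this] show "(\<lambda>Q. gradient G (frame Q) $ j $ i) \<in> borel_measurable borel" .
qed

lemma entry_measurable: "(\<lambda>Q :: real^'d^'d. Q $ j $ i) \<in> borel_measurable \<nu>"
  by (intro measurable_nu borel_measurable_continuous_onI continuous_intros)

lemma gradient_row_inner_measurable:
  "(\<lambda>Q. gradient G (frame Q) $ j \<bullet> Q $ i) \<in> borel_measurable \<nu>"
  unfolding inner_vec_def inner_real_def
  by (intro borel_measurable_sum borel_measurable_times gradient_measurable entry_measurable)

lemma invariant_integral:
  assumes "orthogonal_matrix h" "f \<in> borel_measurable \<nu>"
  shows "(\<integral>Q. f (h ** Q) \<partial>\<nu>) = (\<integral>Q. (f Q :: real) \<partial>\<nu>)"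
  using integral_distr[OF nu_measurable[OF assms(1)] assms(2)] nu_invariant[OF assms(1)] by simp

lemma slope_eq: "slope Q = (\<Sum>j\<in>UNIV. \<beta> (\<iota> j) * (gradient G (frame Q) $ j \<bullet> Q $ p (\<iota> j)))"
  by (simp add: slope_def speed_def inner_vec_def[of _ "vec_lambda _"])

lemma slope_measurable: "slope \<in> borel_measurable \<nu>"
  unfolding slope_eq[abs_def] by (intro borel_measurable_sum borel_measurable_times gradient_row_inner_measurable) auto

lemma gradient_sq: "(\<Sum>j\<in>UNIV. (norm (gradient G \<theta> $ j))\<^sup>2) \<le> l\<^sup>2"
proof -
  have "(\<Sum>j\<in>UNIV. (norm (gradient G \<theta> $ j))\<^sup>2) = (norm (gradient G \<theta>))\<^sup>2"
    unfolding power2_norm_eq_inner inner_vec_def[of "gradient G \<theta>"] ..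
  also have "\<dots> \<le> l\<^sup>2" using gradient_norm_le[OF diff lip, of \<theta>] by (intro power_mono) auto
  finally show ?thesis .
qed

lemma gradient_equivariant:
  assumes R: "orthogonal_matrix R"
  shows "gradient G (R ** \<theta>) = R ** gradient G \<theta>"
proof (rule gradient_unique[OF diff])
  let ?S = "transpose R"
  have S: "orthogonal_matrix ?S" using R by simp
  have SR: "?S ** (R ** \<theta>) = \<theta>" using R by (simp add: matrix_mul_assoc orthogonal_matrix)
  have "((\<lambda>x. ?S ** x) has_derivative (\<lambda>v. ?S ** v)) (at (R ** \<theta>))"
    by (intro bounded_linear_imp_has_derivative bounded_linear_matrix_mult_left)
  then have "((\<lambda>x. G (?S ** x)) has_derivative (\<lambda>v. gradient G \<theta> \<bullet> (?S ** v))) (at (R ** \<theta>))"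
    using has_derivative_compose[of "\<lambda>x. ?S ** x" _ "R ** \<theta>" UNIV G] gradient_has_derivative[OF diff[of \<theta>]] SR by simp
  moreover have "gradient G \<theta> \<bullet> (?S ** v) = (R ** gradient G \<theta>) \<bullet> v" for v
  proof -
    have "gradient G \<theta> \<bullet> (?S ** v) = (R ** gradient G \<theta>) \<bullet> (R ** (?S ** v))"
      by (simp add: inner_matrix_mult_left_orthogonal[OF R])
    also have "R ** (?S ** v) = v" using R by (simp add: matrix_mul_assoc orthogonal_matrix_def)
    finally show ?thesis .
  qed
  ultimately show "(G has_derivative (\<lambda>v. (R ** gradient G \<theta>) \<bullet> v)) (at (R ** \<theta>))"
    by (simp add: inv[OF S])
qed

section \<open>The moment generating function of the slope\<close>

text \<open>
  Rotations of the span of the frame, of dimension \<open>k\<close>, are transferred by the invariance of \<open>G\<close> to the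
  rows of its gradient and leave the velocity alone, because it is orthogonal to that span. So the slope is
  the trace of a matrix \<open>x\<close> indexed by the \<open>k\<close> vectors of the frame, whose law is invariant under
  rotations of the second index.
\<close>

lemma slope_mgf_inside:
  assumes k: "2 \<le> CARD('k)" and \<tau>: "0 \<le> \<tau>"
  shows "nu.expectation (\<lambda>Q. exp (\<tau> * slope Q)) \<le> exp (\<tau>\<^sup>2 * (pi / 2 * l)\<^sup>2 / real (CARD('k) - 1))"
proof -
  define x where "x a b Q = \<beta> (\<iota> a) * (gradient G (frame Q) $ b \<bullet> Q $ p (\<iota> a))" for a b Q
  have "slope Q = (\<Sum>a\<in>UNIV. x a a Q)" for Q by (simp add: slope_eq x_def)
  moreover have "nu.expectation (\<lambda>Q. exp (\<tau> * (\<Sum>a\<in>UNIV. x a a Q))) \<le> exp (\<tau>\<^sup>2 * (pi / 2 * l)\<^sup>2 / real (card (UNIV :: 'k set) - 1))"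
  proof (rule nu.rotation_invariant_trace_mgf[where x=x, OF _ k _ _ _ \<tau>])
    show "x a b \<in> borel_measurable \<nu>" for a b
      unfolding x_def by (intro borel_measurable_times gradient_row_inner_measurable) auto
    fix Q assume "Q \<in> space \<nu>"
    then have Q: "orthogonal_matrix Q" by (simp add: space_nu)
    have inj': "inj (\<lambda>a. p (\<iota> a))" by (rule injI) (metis p inj injD)
    have "(\<Sum>a\<in>UNIV. \<Sum>b\<in>UNIV. (x a b Q)\<^sup>2) \<le> (\<Sum>a\<in>UNIV. \<Sum>b\<in>UNIV. (pi / 2)\<^sup>2 * (gradient G (frame Q) $ b \<bullet> Q $ p (\<iota> a))\<^sup>2)"
      unfolding x_def power_mult_distrib using \<beta>_le
      by (intro sum_mono mult_right_mono) (auto simp: abs_le_square_iff[symmetric])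
    also have "\<dots> = (pi / 2)\<^sup>2 * (\<Sum>b\<in>UNIV. \<Sum>a\<in>UNIV. (gradient G (frame Q) $ b \<bullet> Q $ p (\<iota> a))\<^sup>2)"
      by (subst sum.swap) (simp add: sum_distrib_left)
    also have "\<dots> \<le> (pi / 2)\<^sup>2 * (\<Sum>b\<in>UNIV. (norm (gradient G (frame Q) $ b))\<^sup>2)"
    proof (intro mult_left_mono sum_mono)
      fix b
      have "(\<Sum>a\<in>UNIV. (gradient G (frame Q) $ b \<bullet> Q $ p (\<iota> a))\<^sup>2) = (\<Sum>i\<in>range (\<lambda>a. p (\<iota> a)). (gradient G (frame Q) $ b \<bullet> Q $ i)\<^sup>2)"
        by (subst sum.reindex[OF inj']) simp
      also have "\<dots> \<le> (\<Sum>i\<in>UNIV. (gradient G (frame Q) $ b \<bullet> Q $ i)\<^sup>2)"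
        by (intro sum_mono2) auto
      finally show "(\<Sum>a\<in>UNIV. (gradient G (frame Q) $ b \<bullet> Q $ p (\<iota> a))\<^sup>2) \<le> (norm (gradient G (frame Q) $ b))\<^sup>2"
        by (simp add: bessel_rows[OF Q])
    qed simp
    also have "\<dots> \<le> (pi / 2)\<^sup>2 * l\<^sup>2" by (intro mult_left_mono gradient_sq) simp
    finally show "(\<Sum>a\<in>UNIV. \<Sum>b\<in>UNIV. (x a b Q)\<^sup>2) \<le> (pi / 2 * l)\<^sup>2" by (simp only: power_mult_distrib)
  next
    fix a b :: 'k and t :: real assume ab: "a \<noteq> b"
    have iab: "\<iota> a \<noteq> \<iota> b" using ab inj by (auto dest: injD)
    define \<rho> where "\<rho> = (plane_rotation (\<iota> a) (\<iota> b) t :: real^'d^'d)"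
    have \<rho>: "orthogonal_matrix \<rho>" unfolding \<rho>_def by (rule plane_rotation_orthogonal[OF iab])
    have "frame (\<rho> ** Q) $ j = (plane_rotation a b t ** frame Q) $ j" for Q j
      using ab by (cases "j = a"; cases "j = b")
        (simp_all add: row_selection_mult_nth \<rho>_def plane_rotation_mult_nth[OF iab]
          plane_rotation_mult_nth[OF ab] inj_eq[OF inj] ab)
    then have fr: "frame (\<rho> ** Q) = plane_rotation a b t ** frame Q" for Q by (simp add: vec_eq_iff)
    have gr: "gradient G (frame (\<rho> ** Q)) = plane_rotation a b t ** gradient G (frame Q)" for Q
      unfolding fr by (rule gradient_equivariant[OF plane_rotation_orthogonal[OF ab]])
    have row: "\<beta> (\<iota> c) = 0 \<or> (\<rho> ** Q) $ p (\<iota> c) = Q $ p (\<iota> c)" for c Q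
    proof (cases "\<beta> (\<iota> c) = 0")
      case False
      from transversal[OF this] have "p (\<iota> c) \<noteq> \<iota> a" "p (\<iota> c) \<noteq> \<iota> b" by auto
      then show ?thesis unfolding \<rho>_def by (simp add: plane_rotation_mult_nth(3)[OF iab])
    qed simp
    have xr: "x c m (\<rho> ** Q) = \<beta> (\<iota> c) * ((plane_rotation a b t ** gradient G (frame Q)) $ m \<bullet> Q $ p (\<iota> c))" for c m Q
      using row[of c Q] by (auto simp: x_def gr)
    show "\<exists>T. T \<in> measurable \<nu> \<nu> \<and> distr \<nu> \<nu> T = \<nu> \<and>
       (\<forall>Q\<in>space \<nu>. \<forall>c\<in>UNIV. x c a (T Q) = cos t * x c a Q + sin t * x c b Q \<and>
          x c b (T Q) = cos t * x c b Q - sin t * x c a Q \<and>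
          (\<forall>m\<in>UNIV - {a, b}. x c m (T Q) = x c m Q))"
    proof (intro exI[of _ "\<lambda>Q. \<rho> ** Q"] conjI ballI nu_measurable[OF \<rho>] nu_invariant[OF \<rho>])
      fix Q c
      show "x c a (\<rho> ** Q) = cos t * x c a Q + sin t * x c b Q"
        unfolding xr unfolding x_def plane_rotation_mult_nth(1)[OF ab] by (simp add: inner_add_left algebra_simps)
      show "x c b (\<rho> ** Q) = cos t * x c b Q - sin t * x c a Q"
        unfolding xr unfolding x_def plane_rotation_mult_nth(2)[OF ab] by (simp add: inner_diff_left algebra_simps)
      fix m assume "m \<in> UNIV - {a, b}"
      then show "x c m (\<rho> ** Q) = x c m Q"
        unfolding xr unfolding x_def by (simp add: plane_rotation_mult_nth(3)[OF ab])
    qed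
  qed simp
  ultimately show ?thesis by simp
qed

text \<open>
  The complementary estimate. Rotations of the orthogonal complement of the frame, of dimension \<open>d - k\<close>,
  leave the gradient alone and rotate the velocity. In order to index rows and columns by the same set,
  a gradient row is attached to the index of the direction in which its vector moves.

  Of the two estimates the one for the larger of the dimensions \<open>k\<close> and \<open>d - k\<close> is used.
\<close>

lemma slope_mgf_outside:
  assumes n: "2 \<le> CARD('d) - CARD('k)" and \<tau>: "0 \<le> \<tau>"
  shows "nu.expectation (\<lambda>Q. exp (\<tau> * slope Q)) \<le> exp (\<tau>\<^sup>2 * (pi / 2 * l)\<^sup>2 / real (CARD('d) - CARD('k) - 1))"
proof -
  define I where "I = - range \<iota>"
  have cardI: "card I = CARD('d) - CARD('k)"
    unfolding I_def using inj by (simp add: Compl_eq_Diff_UNIV card_Diff_subset card_image)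
  define x where "x a b Q = (\<Sum>j\<in>UNIV. if a = p (\<iota> j) then \<beta> (\<iota> j) * (gradient G (frame Q) $ j \<bullet> Q $ b) else 0)" for a b Q
  have "slope Q = (\<Sum>a\<in>I. x a a Q)" for Q
  proof -
    have "(\<Sum>a\<in>I. x a a Q) = (\<Sum>j\<in>UNIV. \<Sum>a\<in>I. if a = p (\<iota> j) then \<beta> (\<iota> j) * (gradient G (frame Q) $ j \<bullet> Q $ a) else 0)"
      unfolding x_def by (rule sum.swap)
    also have "\<dots> = (\<Sum>j\<in>UNIV. \<beta> (\<iota> j) * (gradient G (frame Q) $ j \<bullet> Q $ p (\<iota> j)))"
      using transversal by (intro sum.cong) (auto simp: I_def)
    finally show ?thesis by (simp add: slope_eq)
  qed
  moreover have "nu.expectation (\<lambda>Q. exp (\<tau> * (\<Sum>a\<in>I. x a a Q))) \<le> exp (\<tau>\<^sup>2 * (pi / 2 * l)\<^sup>2 / real (card I - 1))"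
  proof (rule nu.rotation_invariant_trace_mgf[where x=x, OF _ _ _ _ _ \<tau>])
    show "2 \<le> card I" using n cardI by simp
    show "x a b \<in> borel_measurable \<nu>" for a b
      unfolding x_def using gradient_row_inner_measurable
      by (intro borel_measurable_sum) (auto intro!: borel_measurable_times)
    fix Q assume "Q \<in> space \<nu>"
    then have Q: "orthogonal_matrix Q" by (simp add: space_nu)
    have sq: "(x a b Q)\<^sup>2 = (\<Sum>j\<in>UNIV. if a = p (\<iota> j) then (\<beta> (\<iota> j))\<^sup>2 * (gradient G (frame Q) $ j \<bullet> Q $ b)\<^sup>2 else 0)" for a b
    proof (cases "\<exists>i. a = p (\<iota> i)")
      case True
      then obtain i where i: "a = p (\<iota> i)" by auto
      have "a = p (\<iota> j) \<longleftrightarrow> j = i" for j unfolding i using p inj by (metis injD)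
      then show ?thesis by (simp add: x_def power_mult_distrib)
    qed (simp add: x_def)
    define t where "t a b j = (if a = p (\<iota> j) then (\<beta> (\<iota> j))\<^sup>2 * (gradient G (frame Q) $ j \<bullet> Q $ b)\<^sup>2 else 0)" for a b j
    have "(\<Sum>a\<in>I. \<Sum>b\<in>I. (x a b Q)\<^sup>2) \<le> (\<Sum>a\<in>I. \<Sum>b\<in>UNIV. (x a b Q)\<^sup>2)"
      by (intro sum_mono sum_mono2) auto
    also have "\<dots> \<le> (\<Sum>a\<in>UNIV. \<Sum>b\<in>UNIV. (x a b Q)\<^sup>2)"
      by (rule sum_mono2) (auto intro: sum_nonneg)
    also have "\<dots> = (\<Sum>a\<in>UNIV. \<Sum>j\<in>UNIV. \<Sum>b\<in>UNIV. t a b j)"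
      unfolding sq t_def by (intro sum.cong refl sum.swap)
    also have "\<dots> = (\<Sum>j\<in>UNIV. \<Sum>a\<in>UNIV. \<Sum>b\<in>UNIV. t a b j)" by (rule sum.swap)
    also have "\<dots> = (\<Sum>j\<in>UNIV. \<Sum>b\<in>UNIV. \<Sum>a\<in>UNIV. t a b j)" by (intro sum.cong refl sum.swap)
    also have "\<dots> = (\<Sum>j\<in>UNIV. (\<beta> (\<iota> j))\<^sup>2 * (norm (gradient G (frame Q) $ j))\<^sup>2)"
      by (simp add: t_def sum_distrib_left[symmetric] bessel_rows[OF Q])
    also have "\<dots> \<le> (\<Sum>j\<in>UNIV. (pi / 2)\<^sup>2 * (norm (gradient G (frame Q) $ j))\<^sup>2)"
      using \<beta>_le by (intro sum_mono mult_right_mono) (auto simp: abs_le_square_iff[symmetric])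
    also have "\<dots> \<le> (pi / 2)\<^sup>2 * l\<^sup>2"
      unfolding sum_distrib_left[symmetric] by (intro mult_left_mono gradient_sq) simp
    finally show "(\<Sum>a\<in>I. \<Sum>b\<in>I. (x a b Q)\<^sup>2) \<le> (pi / 2 * l)\<^sup>2" by (simp only: power_mult_distrib)
  next
    fix a b and t :: real assume aI: "a \<in> I" "b \<in> I" and ab: "a \<noteq> b"
    define \<rho> where "\<rho> = (plane_rotation a b t :: real^'d^'d)"
    have \<rho>: "orthogonal_matrix \<rho>" unfolding \<rho>_def by (rule plane_rotation_orthogonal[OF ab])
    have "frame (\<rho> ** Q) $ j = frame Q $ j" for Q j
    proof -
      have "\<iota> j \<noteq> a" "\<iota> j \<noteq> b" using aI by (auto simp: I_def)
      then show ?thesis by (simp add: row_selection_mult_nth \<rho>_def plane_rotation_mult_nth(3)[OF ab])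
    qed
    then have fr: "frame (\<rho> ** Q) = frame Q" for Q by (simp add: vec_eq_iff)
    show "\<exists>T. T \<in> measurable \<nu> \<nu> \<and> distr \<nu> \<nu> T = \<nu> \<and>
       (\<forall>Q\<in>space \<nu>. \<forall>c\<in>I. x c a (T Q) = cos t * x c a Q + sin t * x c b Q \<and>
          x c b (T Q) = cos t * x c b Q - sin t * x c a Q \<and>
          (\<forall>m\<in>I - {a, b}. x c m (T Q) = x c m Q))"
    proof (intro exI[of _ "\<lambda>Q. \<rho> ** Q"] conjI ballI nu_measurable[OF \<rho>] nu_invariant[OF \<rho>])
      fix Q c
      show "x c a (\<rho> ** Q) = cos t * x c a Q + sin t * x c b Q"
        unfolding x_def fr unfolding \<rho>_def plane_rotation_mult_nth(1)[OF ab] sum_distrib_left sum.distrib[symmetric]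
        by (intro sum.cong) (auto simp: inner_add_right algebra_simps)
      show "x c b (\<rho> ** Q) = cos t * x c b Q - sin t * x c a Q"
        unfolding x_def fr unfolding \<rho>_def plane_rotation_mult_nth(2)[OF ab] sum_distrib_left sum_subtractf[symmetric]
        by (intro sum.cong) (auto simp: inner_diff_right algebra_simps)
      fix m assume "m \<in> I - {a, b}"
      then have "(\<rho> ** Q) $ m = Q $ m" unfolding \<rho>_def by (intro plane_rotation_mult_nth(3)[OF ab]) auto
      then show "x c m (\<rho> ** Q) = x c m Q" unfolding x_def fr by (simp cong: if_cong)
    qed
  qed simp
  ultimately show ?thesis by (simp add: cardI)
qed

section \<open>From the slope to the endpoints\<close>

abbreviation rot :: "real \<Rightarrow> real^'d^'d" where
  "rot s \<equiv> rotation_group p \<beta> s"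

lemma rot_orthogonal: "orthogonal_matrix (rot s)"
  by (rule rotation_group_orthogonal) (rule p \<beta>p)+

lemma rot_zero: "rot 0 = mat 1"
  by (rule rotation_group_zero[where p=p and \<beta>=\<beta>, OF p \<beta>p])

lemma rot_add: "rot s ** rot t = rot (s + t)"
  by (rule rotation_group_add[where p=p and \<beta>=\<beta>, OF p \<beta>p])

lemma frame_rot: "frame (rot s ** Q)
   = (\<Sum>j\<in>UNIV. cos (s * \<beta> (\<iota> j)) *\<^sub>R axis j (Q $ \<iota> j) + sin (s * \<beta> (\<iota> j)) *\<^sub>R axis j (Q $ p (\<iota> j)))"
proof -
  have sc: "c *\<^sub>R axis j v = axis j (c *\<^sub>R v)" for c and j :: 'k and v :: "real^'d"
    by (simp add: axis_def vec_eq_iff)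
  have ad: "axis j v + axis j w = axis j (v + w)" for j :: 'k and v w :: "real^'d"
    by (simp add: axis_def vec_eq_iff)
  have "frame (rot s ** Q) = (\<chi> j. cos (s * \<beta> (\<iota> j)) *\<^sub>R Q $ \<iota> j + sin (s * \<beta> (\<iota> j)) *\<^sub>R Q $ p (\<iota> j))"
    by (simp add: vec_eq_iff[of "frame _"] row_selection_mult_nth rotation_group_mult_nth)
  then show ?thesis unfolding sc ad vec_lambda_sum_axis by simp
qed

lemma frame_rot_derivative: "((\<lambda>s. frame (rot s ** Q)) has_vector_derivative speed Q) (at 0)"
proof -
  have sc: "c *\<^sub>R axis j v = axis j (c *\<^sub>R v)" for c and j :: 'k and v :: "real^'d"
    by (simp add: axis_def vec_eq_iff)
  have "((\<lambda>s. cos (s * b) *\<^sub>R v + sin (s * b) *\<^sub>R w) has_vector_derivative b *\<^sub>R w) (at 0)" for b and v w :: "real^'d^'k"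
    by (auto intro!: derivative_eq_intros simp: has_vector_derivative_def algebra_simps)
  then have "((\<lambda>s. frame (rot s ** Q)) has_vector_derivative (\<Sum>j\<in>UNIV. \<beta> (\<iota> j) *\<^sub>R axis j (Q $ p (\<iota> j)))) (at 0)"
    unfolding frame_rot by (intro has_vector_derivative_sum) auto
  then show ?thesis unfolding speed_def vec_lambda_sum_axis sc .
qed

abbreviation increment :: "nat \<Rightarrow> real^'d^'d \<Rightarrow> real" where
  "increment n Q \<equiv> G (frame (rot (inverse (real (Suc n))) ** Q)) - G (frame Q)"

lemma increment_limit: "(\<lambda>n. real (Suc n) * increment n Q) \<longlonglongrightarrow> slope Q"
proof -
  have z: "frame (rot 0 ** Q) = frame Q" by (simp add: rot_zero)
  have "((\<lambda>s. frame (rot s ** Q)) has_derivative (\<lambda>s. s *\<^sub>R speed Q)) (at 0)"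
    using frame_rot_derivative unfolding has_vector_derivative_def .
  from has_derivative_compose[OF this, of G "\<lambda>v. gradient G (frame Q) \<bullet> v"] gradient_has_derivative[OF diff, of "frame Q"] z
  have "((\<lambda>s. G (frame (rot s ** Q))) has_real_derivative slope Q) (at 0)"
    by (simp add: has_field_derivative_def slope_def mult_commute_abs)
  then have lim: "((\<lambda>s. (G (frame (rot s ** Q)) - G (frame Q)) / s) \<longlongrightarrow> slope Q) (at 0)"
    using z by (simp add: has_field_derivative_iff)
  have "filterlim (\<lambda>n. inverse (real (Suc n))) (at 0) sequentially"
    using LIMSEQ_inverse_real_of_nat by (auto simp: filterlim_at intro!: always_eventually)
  from filterlim_compose[OF lim this] show ?thesis by (simp add: divide_inverse mult.commute del: of_nat_Suc)
qed

lemma increment_bounded: "\<exists>K. \<forall>n Q. orthogonal_matrix Q \<longrightarrow> \<bar>real (Suc n) * increment n Q\<bar> \<le> K"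
proof -
  define K where "K = (\<Sum>j\<in>UNIV. 2 * \<bar>\<beta> (\<iota> j)\<bar>)"
  have l0: "0 \<le> l" using gradient_norm_le[OF diff lip] norm_ge_zero order_trans by blast
  have cos_le: "\<bar>cos x - 1\<bar> \<le> \<bar>x\<bar>" for x :: real
  proof -
    have "\<bar>cos x - 1\<bar> = 2 * (\<bar>sin (x / 2)\<bar> * \<bar>sin (x / 2)\<bar>)"
      using cos_double_sin[of "x / 2"] by (simp add: power2_eq_square abs_mult)
    also have "\<dots> \<le> 2 * (\<bar>x / 2\<bar> * 1)"
      by (intro mult_left_mono mult_mono abs_sin_x_le_abs_x abs_sin_le_one) auto
    finally show ?thesis by simp
  qed
  have dist: "norm (frame (rot s ** Q) - frame Q) \<le> \<bar>s\<bar> * K" if Q: "orthogonal_matrix Q" for s Q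
  proof -
    have row: "norm (axis j (Q $ i) :: real^'d^'k) = 1" for j i
    proof -
      have "norm (axis j (Q $ i) :: real^'d^'k) = norm (Q $ i)"
        by (simp add: norm_eq_sqrt_inner inner_axis_axis)
      then show ?thesis using Q by (simp add: orthogonal_matrix_rows norm_eq_sqrt_inner)
    qed
    have "frame (rot s ** Q) - frame Q = frame (rot s ** Q) - frame (rot 0 ** Q)" by (simp add: rot_zero)
    also have "\<dots> = (\<Sum>j\<in>UNIV. (cos (s * \<beta> (\<iota> j)) - 1) *\<^sub>R axis j (Q $ \<iota> j) + sin (s * \<beta> (\<iota> j)) *\<^sub>R axis j (Q $ p (\<iota> j)))"
      unfolding frame_rot sum_subtractf[symmetric] by (simp add: algebra_simps)
    also have "norm \<dots> \<le> (\<Sum>j\<in>UNIV. \<bar>s\<bar> * (2 * \<bar>\<beta> (\<iota> j)\<bar>))"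
    proof (intro order_trans[OF norm_sum] sum_mono)
      fix j
      have "norm ((cos (s * \<beta> (\<iota> j)) - 1) *\<^sub>R (axis j (Q $ \<iota> j) :: real^'d^'k) + sin (s * \<beta> (\<iota> j)) *\<^sub>R axis j (Q $ p (\<iota> j)))
          \<le> \<bar>cos (s * \<beta> (\<iota> j)) - 1\<bar> + \<bar>sin (s * \<beta> (\<iota> j))\<bar>"
        by (rule order_trans[OF norm_triangle_ineq]) (simp add: row)
      also have "\<dots> \<le> \<bar>s * \<beta> (\<iota> j)\<bar> + \<bar>s * \<beta> (\<iota> j)\<bar>"
        by (intro add_mono cos_le abs_sin_x_le_abs_x)
      also have "\<dots> = \<bar>s\<bar> * (2 * \<bar>\<beta> (\<iota> j)\<bar>)" by (simp add: abs_mult)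
      finally show "norm ((cos (s * \<beta> (\<iota> j)) - 1) *\<^sub>R (axis j (Q $ \<iota> j) :: real^'d^'k) + sin (s * \<beta> (\<iota> j)) *\<^sub>R axis j (Q $ p (\<iota> j)))
          \<le> \<bar>s\<bar> * (2 * \<bar>\<beta> (\<iota> j)\<bar>)" .
    qed
    finally show ?thesis by (simp add: K_def sum_distrib_left)
  qed
  have "\<bar>real (Suc n) * increment n Q\<bar> \<le> l * K" if Q: "orthogonal_matrix Q" for n Q
  proof -
    have "\<bar>increment n Q\<bar> \<le> l * (\<bar>inverse (real (Suc n))\<bar> * K)"
      using lip[of "frame (rot (inverse (real (Suc n))) ** Q)" "frame Q"] mult_left_mono[OF dist[OF Q] l0]
      by (rule order_trans)
    from mult_left_mono[OF this, of "real (Suc n)"]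
    have "\<bar>real (Suc n) * increment n Q\<bar> \<le> real (Suc n) * (l * (\<bar>inverse (real (Suc n))\<bar> * K))"
      by (simp add: abs_mult del: of_nat_Suc)
    also have "\<dots> = l * K" by simp
    finally show ?thesis .
  qed
  then show ?thesis by blast
qed

text \<open>
  The geodesic is cut into \<open>n + 1\<close> pieces of equal length. By convexity the exponential of the sum of the
  increments is at most the mean of the exponentials of \<open>n + 1\<close> times each increment. The pieces are
  translates of each other under the one-parameter group, hence all have the same law.
\<close>

lemma endpoint_le_increment:
  "nu.expectation (\<lambda>Q. exp (\<tau> * (G (frame (rot 1 ** Q)) - G (frame Q))))
     \<le> nu.expectation (\<lambda>Q. exp (\<tau> * (real (Suc n) * increment n Q)))"
proof -
  define N where "N = real (Suc n)"
  have N: "N > 0" by (simp add: N_def)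
  define \<Delta> where "\<Delta> Q = increment n Q" for Q
  have \<Delta>m: "\<Delta> \<in> borel_measurable \<nu>"
    unfolding \<Delta>_def matrix_mul_assoc by (intro borel_measurable_diff G_measurable)
  obtain K where K: "\<And>Q. orthogonal_matrix Q \<Longrightarrow> \<bar>N * \<Delta> Q\<bar> \<le> K"
    using increment_bounded unfolding N_def \<Delta>_def by metis
  have em: "(\<lambda>Q. exp (\<tau> * (N * \<Delta> Q))) \<in> borel_measurable \<nu>"
    using \<Delta>m by measurable
  have eb: "exp (\<tau> * (N * \<Delta> Q)) \<le> exp (\<bar>\<tau>\<bar> * K)" if "orthogonal_matrix Q" for Q
    using mult_left_mono[OF K[OF that], of "\<bar>\<tau>\<bar>"] by (simp add: abs_mult[symmetric])
  define r where "r i = rot (real i / N)" for i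
  have r: "orthogonal_matrix (r i)" for i by (simp add: r_def rot_orthogonal)
  have int: "integrable \<nu> (\<lambda>Q. exp (\<tau> * (N * \<Delta> (r i ** Q))))" for i
  proof (rule nu.integrable_bounded)
    show "(\<lambda>Q. exp (\<tau> * (N * \<Delta> (r i ** Q)))) \<in> borel_measurable \<nu>"
      using measurable_compose[OF nu_measurable[OF r] em] .
    show "\<bar>exp (\<tau> * (N * \<Delta> (r i ** Q)))\<bar> \<le> exp (\<bar>\<tau>\<bar> * K)" if "Q \<in> space \<nu>" for Q
      using eb[OF orthogonal_matrix_mul[OF r]] that by (simp add: space_nu)
  qed
  have tel: "G (frame (rot 1 ** Q)) - G (frame Q) = (\<Sum>i<Suc n. \<Delta> (r i ** Q))" for Q
  proof -
    have "rot (inverse N) ** r i = r (Suc i)" for i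
      unfolding r_def rot_add using N by (simp add: field_simps)
    then have "\<Delta> (r i ** Q) = G (frame (r (Suc i) ** Q)) - G (frame (r i ** Q))" for i
      by (simp add: \<Delta>_def N_def[symmetric] matrix_mul_assoc del: of_nat_Suc)
    then have "(\<Sum>i<Suc n. \<Delta> (r i ** Q)) = G (frame (r (Suc n) ** Q)) - G (frame (r 0 ** Q))"
      using sum_lessThan_telescope[of "\<lambda>i. G (frame (r i ** Q))" "Suc n"] by simp
    then show ?thesis using N by (simp add: r_def N_def rot_zero del: of_nat_Suc)
  qed
  have "exp (\<tau> * (G (frame (rot 1 ** Q)) - G (frame Q))) \<le> (\<Sum>i<Suc n. 1 / N * exp (\<tau> * (N * \<Delta> (r i ** Q))))" for Q
  proof -
    have "exp (\<Sum>i<Suc n. (1 / N) *\<^sub>R (\<tau> * (N * \<Delta> (r i ** Q)))) \<le> (\<Sum>i<Suc n. 1 / N * exp (\<tau> * (N * \<Delta> (r i ** Q))))"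
      by (rule convex_on_sum[OF _ _ exp_convex]) (use N in \<open>auto simp: N_def simp del: of_nat_Suc\<close>)
    moreover have "(\<Sum>i<Suc n. (1 / N) *\<^sub>R (\<tau> * (N * \<Delta> (r i ** Q)))) = \<tau> * (\<Sum>i<Suc n. \<Delta> (r i ** Q))"
      unfolding sum_distrib_left using N by (intro sum.cong) auto
    ultimately show ?thesis unfolding tel by simp
  qed
  then have "nu.expectation (\<lambda>Q. exp (\<tau> * (G (frame (rot 1 ** Q)) - G (frame Q))))
     \<le> nu.expectation (\<lambda>Q. \<Sum>i<Suc n. 1 / N * exp (\<tau> * (N * \<Delta> (r i ** Q))))"
    using int N by (intro integral_mono_AE') (auto intro!: AE_I2 add_nonneg_nonneg sum_nonneg)
  also have "\<dots> = (\<Sum>i<Suc n. 1 / N * nu.expectation (\<lambda>Q. exp (\<tau> * (N * \<Delta> (r i ** Q)))))"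
    using int by (subst Bochner_Integration.integral_sum) (auto simp del: of_nat_Suc)
  also have "\<dots> = (\<Sum>i<Suc n. 1 / N * nu.expectation (\<lambda>Q. exp (\<tau> * (N * \<Delta> Q))))"
    using invariant_integral[OF r em] by simp
  also have "\<dots> = nu.expectation (\<lambda>Q. exp (\<tau> * (N * \<Delta> Q)))"
    using N by (simp add: N_def del: of_nat_Suc)
  finally show ?thesis by (simp add: N_def \<Delta>_def)
qed

text \<open>
  As the pieces become short, the rescaled first increment tends to the slope, boundedly.
\<close>

lemma endpoint_le_slope:
  "nu.expectation (\<lambda>Q. exp (\<tau> * (G (frame (rot 1 ** Q)) - G (frame Q))))
     \<le> nu.expectation (\<lambda>Q. exp (\<tau> * slope Q))"
proof -
  obtain K where K: "\<And>n Q. orthogonal_matrix Q \<Longrightarrow> \<bar>real (Suc n) * increment n Q\<bar> \<le> K"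
    using increment_bounded by metis
  have "(\<lambda>n. nu.expectation (\<lambda>Q. exp (\<tau> * (real (Suc n) * increment n Q)))) \<longlonglongrightarrow> nu.expectation (\<lambda>Q. exp (\<tau> * slope Q))"
  proof (rule integral_dominated_convergence[where w="\<lambda>_. exp (\<bar>\<tau>\<bar> * K)"])
    show "(\<lambda>Q. exp (\<tau> * slope Q)) \<in> borel_measurable \<nu>" using slope_measurable by measurable
    have "(\<lambda>Q. increment n Q) \<in> borel_measurable \<nu>" for n
      unfolding matrix_mul_assoc by (intro borel_measurable_diff G_measurable)
    then show "(\<lambda>Q. exp (\<tau> * (real (Suc n) * increment n Q))) \<in> borel_measurable \<nu>" for n
      by measurable
    show "AE Q in \<nu>. (\<lambda>n. exp (\<tau> * (real (Suc n) * increment n Q))) \<longlonglongrightarrow> exp (\<tau> * slope Q)"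
      by (intro AE_I2 tendsto_intros increment_limit)
    show "AE Q in \<nu>. norm (exp (\<tau> * (real (Suc n) * increment n Q))) \<le> exp (\<bar>\<tau>\<bar> * K)" for n
    proof (rule AE_I2)
      fix Q assume "Q \<in> space \<nu>"
      then have "\<bar>\<tau>\<bar> * \<bar>real (Suc n) * increment n Q\<bar> \<le> \<bar>\<tau>\<bar> * K"
        by (intro mult_left_mono K) (auto simp: space_nu)
      then show "norm (exp (\<tau> * (real (Suc n) * increment n Q))) \<le> exp (\<bar>\<tau>\<bar> * K)"
        unfolding abs_mult[symmetric] by simp
    qed
  qed simp
  then show ?thesis using endpoint_le_increment by (intro LIMSEQ_le_const) auto
qed

end

section \<open>Numerical estimates\<close>

lemma sin_taylor_5: "\<bar>sin x - (x - x ^ 3 / 6)\<bar> \<le> \<bar>x\<bar> ^ 5 / 120" for x :: real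
proof -
  have "\<bar>sin x - (\<Sum>m<5. sin_coeff m * x ^ m)\<bar> \<le> inverse (fact 5) * \<bar>x\<bar> ^ 5"
    by (rule Maclaurin_sin_bound)
  moreover have "(\<Sum>m<5. sin_coeff m * x ^ m) = x - x ^ 3 / 6"
  proof -
    have five: "(\<Sum>m<5. f m) = f 0 + f 1 + f 2 + f 3 + f (4::nat)" for f :: "nat \<Rightarrow> real"
      by (simp add: eval_nat_numeral)
    have "sin_coeff 0 = 0" "sin_coeff 1 = 1" "sin_coeff 2 = 0" "sin_coeff 3 = - 1 / 6" "sin_coeff 4 = 0"
      by (simp_all add: sin_coeff_def fact_numeral)
    note coeffs = this
    show ?thesis unfolding five coeffs by simp
  qed
  moreover have "inverse (fact 5) * \<bar>x\<bar> ^ 5 = \<bar>x\<bar> ^ 5 / 120"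
    by (simp add: fact_numeral)
  ultimately show ?thesis by (simp only:)
qed

lemma pi_bounds: "25 / 8 \<le> pi" "pi \<le> 63 / 20"
proof -
  show "25 / 8 \<le> pi"
  proof (rule ccontr)
    assume "\<not> 25 / 8 \<le> pi"
    then have "sin (pi / 6) \<le> sin (25 / 48)" using pi_ge_two by (intro sin_monotone_2pi_le) linarith+
    moreover have "(25/48 - (25/48) ^ 3 / 6) + \<bar>25/48\<bar> ^ 5 / 120 < (1 / 2 :: real)" by (simp add: power_divide)
    ultimately show False using sin_taylor_5[of "25/48"] unfolding sin_30 by linarith
  qed
  show "pi \<le> 63 / 20"
  proof (rule ccontr)
    assume "\<not> pi \<le> 63 / 20"
    then have "sin (21 / 40) \<le> sin (pi / 6)" using pi_ge_two by (intro sin_monotone_2pi_le) linarith+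
    moreover have "1 / 2 < (21/40 - (21/40) ^ 3 / 6) - \<bar>21/40\<bar> ^ 5 / (120 :: real)" by (simp add: power_divide)
    ultimately show False using sin_taylor_5[of "21/40"] unfolding sin_30 by linarith
  qed
qed

lemma pi_sq_bounds: "39 < 4 * pi\<^sup>2" "pi\<^sup>2 \<le> 3969 / 400"
proof -
  have "(25 / 8)\<^sup>2 \<le> pi\<^sup>2" using pi_bounds by (intro power_mono) auto
  then show "39 < 4 * pi\<^sup>2" by (simp add: power_divide)
  have "pi\<^sup>2 \<le> (63 / 20)\<^sup>2" using pi_bounds by (intro power_mono) auto
  then show "pi\<^sup>2 \<le> 3969 / 400" by (simp add: power_divide)
qed

lemma exp_upper_16:
  assumes "0 \<le> x" "x \<le> (1::real)"
  shows "exp (16 * x) \<le> (1 + x + x\<^sup>2) ^ 16"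
proof -
  have "exp (real 16 * x) = exp x ^ 16" by (rule exp_of_nat_mult)
  then have "exp (16 * x) = exp x ^ 16" by (simp only: of_nat_numeral)
  also have "\<dots> \<le> (1 + x + x\<^sup>2) ^ 16" by (rule power_mono[OF exp_bound[OF assms] exp_ge_zero])
  finally show ?thesis .
qed

text \<open>
  The variable \<open>T\<close> stands for \<open>d \<epsilon>\<^sup>2 / B\<close>. The exponential bound has the better exponent but the worse
  constant, so it wins for large \<open>T\<close>; between \<open>4 pi\<^sup>2\<close> and \<open>76\<close> the Chebyshev bound is below the right
  hand side. The interval is cut at \<open>55\<close> and \<open>70\<close> so that on each piece the value of \<open>exp (T / 32)\<close> at
  the right end is below the value of the linear function at the left end.
\<close>

lemma tail_comparison:
  fixes T :: real
  assumes T: "4 * pi\<^sup>2 < T"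
  shows "min (2 * pi\<^sup>2 / (3 * T)) (2 * exp (- 3 * T / (8 * pi\<^sup>2))) \<le> sqrt (pi / 2) * exp (- (T / 32))"
proof -
  have T39: "39 < T" using T pi_sq_bounds by linarith
  have "(5 / 4)\<^sup>2 \<le> pi / 2" using pi_bounds by (simp add: power_divide)
  then have sq: "5 / 4 \<le> sqrt (pi / 2)" by (rule real_le_rsqrt)
  show ?thesis
  proof (cases "T \<le> 76")
    case True
    consider "T \<le> 55" | "55 \<le> T" "T \<le> 70" | "70 \<le> T" by linarith
    then have ub: "exp (T / 32) \<le> 18896 / 100000 * T"
    proof cases
      case 1
      have "exp (T / 32) \<le> exp (16 * (55/512))" using 1 by simp
      also have "\<dots> \<le> (1 + 55/512 + (55/512)\<^sup>2) ^ 16" by (rule exp_upper_16) auto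
      also have "\<dots> \<le> 7" by (simp add: power_divide)
      finally show ?thesis using T39 by linarith
    next
      case 2
      have "exp (T / 32) \<le> exp (16 * (70/512))" using 2 by simp
      also have "\<dots> \<le> (1 + 70/512 + (70/512)\<^sup>2) ^ 16" by (rule exp_upper_16) auto
      also have "\<dots> \<le> 103/10" by (simp add: power_divide)
      finally show ?thesis using 2 by linarith
    next
      case 3
      have "exp (T / 32) \<le> exp (16 * (76/512))" using True by simp
      also have "\<dots> \<le> (1 + 76/512 + (76/512)\<^sup>2) ^ 16" by (rule exp_upper_16) auto
      also have "\<dots> \<le> 13" by (simp add: power_divide)
      finally show ?thesis using 3 by linarith
    qed
    have pos: "0 < 18896 / 100000 * T * exp (T / 32)" using T39 by simp
    have "2 * pi\<^sup>2 / (3 * T) \<le> 6615 / 1000 / T"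
      using pi_sq_bounds T39 by (simp add: divide_simps)
    moreover have "6615 / 1000 / T \<le> 5 / 4 / (18896 / 100000 * T)"
      using T39 by (simp add: divide_simps)
    moreover have "5 / 4 / (18896 / 100000 * T) \<le> 5 / 4 / exp (T / 32)"
      by (rule divide_left_mono[OF ub _ pos]) simp
    moreover have "5 / 4 / exp (T / 32) \<le> sqrt (pi / 2) * exp (- (T / 32))"
    proof -
      have "5 / 4 / exp (T / 32) = 5 / 4 * exp (- (T / 32))" unfolding exp_minus by (rule divide_inverse)
      also have "\<dots> \<le> sqrt (pi / 2) * exp (- (T / 32))" by (rule mult_right_mono[OF sq exp_ge_zero])
      finally show ?thesis .
    qed
    ultimately show ?thesis by (intro min.coboundedI1) linarith
  next
    case False
    define \<delta> where "\<delta> = 3 / (8 * pi\<^sup>2) - 1 / 32"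
    have "3 / (8 * (3969 / 400)) \<le> 3 / (8 * pi\<^sup>2)"
      using pi_sq_bounds by (intro divide_left_mono mult_left_mono) auto
    then have \<delta>: "65 / 10000 \<le> \<delta>" unfolding \<delta>_def by simp
    have "494 / 1000 \<le> T * \<delta>"
      using mult_mono[of 76 T "65/10000" \<delta>] False \<delta> by simp
    then have e: "exp (494 / 1000) \<le> exp (T * \<delta>)" by simp
    have "1 + 494 / 1000 + (494 / 1000)\<^sup>2 / 2 \<le> exp (494 / 1000 :: real)"
      by (rule exp_lower_Taylor_quadratic) simp
    moreover have "8 / 5 \<le> 1 + 494 / 1000 + (494 / 1000)\<^sup>2 / (2 :: real)" by (simp add: power_divide)
    ultimately have "8 / 5 \<le> exp (T * \<delta>)" using e by linarith
    then have "2 / exp (T * \<delta>) \<le> 5 / 4" by (simp add: divide_simps)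
    moreover have "2 * exp (- 3 * T / (8 * pi\<^sup>2)) = 2 / exp (T * \<delta>) * exp (- (T / 32))"
    proof -
      have "- 3 * T / (8 * pi\<^sup>2) = - (T * \<delta>) + - (T / 32)" unfolding \<delta>_def by (simp add: algebra_simps)
      then have "exp (- 3 * T / (8 * pi\<^sup>2)) = exp (- (T * \<delta>)) * exp (- (T / 32))" by (simp only: exp_add)
      then show ?thesis unfolding exp_minus[of "T * \<delta>"] divide_inverse[of 2] by (simp only: mult.assoc)
    qed
    ultimately have "2 * exp (- 3 * T / (8 * pi\<^sup>2)) \<le> sqrt (pi / 2) * exp (- (T / 32))"
      using mult_right_mono[OF order_trans[OF _ sq] exp_ge_zero] by metis
    then show ?thesis by (rule min.coboundedI2)
  qed
qed

section \<open>Tails from the symmetrized moment generating function\<close>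

lemma cosh_lower: "2 + x\<^sup>2 \<le> exp x + exp (- x)" for x :: real
proof -
  have *: "2 + x\<^sup>2 \<le> exp x + exp (- x)" if "0 \<le> x" for x :: real
  proof -
    have "x / 2 \<le> (exp (x / 2) - inverse (exp (x / 2))) / 2" using that by (intro real_le_x_sinh) simp
    then have "x\<^sup>2 \<le> (exp (x / 2) - inverse (exp (x / 2)))\<^sup>2" using that by (intro power_mono) auto
    also have "\<dots> = exp x + exp (- x) - 2"
    proof -
      define a where "a = exp (x / 2)"
      have "a \<noteq> 0" "exp x = a * a" "exp (- x) = inverse a * inverse a"
        by (simp_all add: a_def exp_minus flip: exp_add inverse_mult_distrib)
      then show ?thesis unfolding a_def[symmetric] by (simp add: power2_eq_square algebra_simps)
    qed
    finally show ?thesis by simp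
  qed
  show ?thesis using *[of x] *[of "- x"] by (cases "0 \<le> x") auto
qed

context prob_space
begin

text \<open>
  The product on the left of the hypothesis is \<open>E (exp (t (Y - Y')))\<close> for an independent copy \<open>Y'\<close> of
  \<open>Y\<close>. By Jensen's inequality it dominates \<open>E (exp (\<plusminus> t (Y - E Y)))\<close>, which gives the exponential tail.
  Expanding it to second order at \<open>t = 0\<close> gives \<open>Var Y \<le> c\<close> and so the Chebyshev tail.
\<close>

lemma symmetrized_mgf_tail:
  fixes Y :: "'a \<Rightarrow> real"
  assumes Y [measurable]: "Y \<in> borel_measurable M" and bd: "\<And>\<omega>. \<omega> \<in> space M \<Longrightarrow> \<bar>Y \<omega>\<bar> \<le> C"
    and mgf: "\<And>t. 0 \<le> t \<Longrightarrow> expectation (\<lambda>\<omega>. exp (t * Y \<omega>)) * expectation (\<lambda>\<omega>. exp (- t * Y \<omega>)) \<le> exp (c * t\<^sup>2)"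
    and c: "0 < c" and \<epsilon>: "0 < \<epsilon>"
  shows "prob {\<omega> \<in> space M. \<bar>Y \<omega> - expectation Y\<bar> > \<epsilon>} \<le> 2 * exp (- \<epsilon>\<^sup>2 / (4 * c))"
    and "prob {\<omega> \<in> space M. \<bar>Y \<omega> - expectation Y\<bar> > \<epsilon>} \<le> c / \<epsilon>\<^sup>2"
proof -
  define m where "m = expectation Y"
  have intY: "integrable M Y" by (rule integrable_bounded[OF Y bd])
  have inte: "integrable M (\<lambda>\<omega>. exp (t * Y \<omega>))" for t
  proof (rule integrable_bounded)
    show "\<bar>exp (t * Y \<omega>)\<bar> \<le> exp (\<bar>t\<bar> * C)" if "\<omega> \<in> space M" for \<omega>
      using mult_left_mono[OF bd[OF that], of "\<bar>t\<bar>"] by (simp add: abs_mult[symmetric])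
  qed measurable
  have int2: "integrable M (\<lambda>\<omega>. (Y \<omega>)\<^sup>2)"
  proof (rule integrable_bounded)
    show "\<bar>(Y \<omega>)\<^sup>2\<bar> \<le> C\<^sup>2" if "\<omega> \<in> space M" for \<omega>
      using power_mono[OF bd[OF that] abs_ge_zero, of 2] by simp
  qed measurable
  define A where "A t = expectation (\<lambda>\<omega>. exp (t * Y \<omega>))" for t
  have jensen: "exp (t * m) \<le> A t" for t
  proof -
    have "exp (t * m) * (1 + t * (Y \<omega> - m)) \<le> exp (t * Y \<omega>)" for \<omega>
    proof -
      have "exp (t * m) * (1 + t * (Y \<omega> - m)) \<le> exp (t * m) * exp (t * (Y \<omega> - m))"
        by (intro mult_left_mono exp_ge_add_one_self) auto
      then show ?thesis by (simp add: algebra_simps flip: exp_add)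
    qed
    then have "expectation (\<lambda>\<omega>. exp (t * m) * (1 + t * (Y \<omega> - m))) \<le> A t"
      unfolding A_def using intY inte by (intro integral_mono) auto
    moreover have "expectation (\<lambda>\<omega>. exp (t * m) * (1 + t * (Y \<omega> - m))) = exp (t * m)"
      using intY by (simp add: m_def prob_space)
    ultimately show ?thesis by simp
  qed
  have AA: "A t * A (- t) \<le> exp (c * t\<^sup>2)" for t
    using mgf[of t] mgf[of "- t"] by (cases "0 \<le> t") (auto simp: A_def mult.commute)
  have Apos: "0 \<le> A t" for t unfolding A_def by (intro integral_nonneg_AE) auto
  have one_side: "prob {\<omega> \<in> space M. s * (Y \<omega> - m) \<ge> \<epsilon>} \<le> exp (- \<epsilon>\<^sup>2 / (4 * c))" if s: "s = 1 \<or> s = - 1" for s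
  proof -
    define t where "t = \<epsilon> / (2 * c)"
    have t: "t > 0" using c \<epsilon> by (simp add: t_def)
    have e: "exp (t * (s * (Y \<omega> - m))) = exp (- (t * s) * m) * exp ((t * s) * Y \<omega>)" for \<omega>
      by (simp add: algebra_simps flip: exp_add)
    have int1: "integrable M (\<lambda>\<omega>. exp (t * (s * (Y \<omega> - m))))"
      unfolding e by (intro integrable_mult_right inte)
    have "set_integrable M (space M) (\<lambda>\<omega>. exp (t * (s * (Y \<omega> - m))))"
      unfolding set_integrable_def by (intro integrable_mult_indicator int1 sets.top)
    then have "prob {\<omega> \<in> space M. s * (Y \<omega> - m) \<ge> \<epsilon>} \<le> exp (- t * \<epsilon>) * (\<integral>\<omega>\<in>space M. exp (t * (s * (Y \<omega> - m))) \<partial>M)"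
      by (intro Chernoff_ineq_ge[OF t]) auto
    also have "(\<integral>\<omega>\<in>space M. exp (t * (s * (Y \<omega> - m))) \<partial>M) = expectation (\<lambda>\<omega>. exp (t * (s * (Y \<omega> - m))))"
      by (rule set_integral_space[OF int1])
    also have "\<dots> = exp (- (t * s) * m) * A (t * s)"
      unfolding A_def e by (rule integral_mult_right_zero)
    also have "exp (- (t * s) * m) * A (t * s) \<le> A (- (t * s)) * A (t * s)"
      by (intro mult_right_mono jensen Apos)
    also have "\<dots> \<le> exp (c * t\<^sup>2)" using AA[of "- (t * s)"] s by auto
    also have "exp (- t * \<epsilon>) * exp (c * t\<^sup>2) = exp (- \<epsilon>\<^sup>2 / (4 * c))"
    proof -
      have "- t * \<epsilon> + c * t\<^sup>2 = - \<epsilon>\<^sup>2 / (4 * c)" using c unfolding t_def by (simp add: field_simps power2_eq_square)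
      then show ?thesis by (simp flip: exp_add)
    qed
    finally show ?thesis by simp
  qed
  have "prob {\<omega> \<in> space M. \<bar>Y \<omega> - m\<bar> > \<epsilon>} \<le> prob ({\<omega> \<in> space M. 1 * (Y \<omega> - m) \<ge> \<epsilon>} \<union> {\<omega> \<in> space M. (- 1) * (Y \<omega> - m) \<ge> \<epsilon>})"
    by (intro finite_measure_mono) auto
  also have "\<dots> \<le> prob {\<omega> \<in> space M. 1 * (Y \<omega> - m) \<ge> \<epsilon>} + prob {\<omega> \<in> space M. (- 1) * (Y \<omega> - m) \<ge> \<epsilon>}"
    by (intro measure_Un_le) auto
  also have "\<dots> \<le> 2 * exp (- \<epsilon>\<^sup>2 / (4 * c))" using one_side[of 1] one_side[of "- 1"] by simp
  finally show "prob {\<omega> \<in> space M. \<bar>Y \<omega> - expectation Y\<bar> > \<epsilon>} \<le> 2 * exp (- \<epsilon>\<^sup>2 / (4 * c))" unfolding m_def .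
  have var: "variance Y \<le> c"
  proof -
    define V where "V = variance Y"
    have V: "V = expectation (\<lambda>\<omega>. (Y \<omega>)\<^sup>2) - m\<^sup>2" unfolding V_def m_def by (rule variance_eq[OF intY int2])
    \<comment> \<open>Integrate \<open>cosh x \<ge> 1 + x\<^sup>2 / 2\<close> at \<open>x = t (Y \<omega> - Y \<omega>')\<close> over \<open>\<omega>'\<close> and then over \<open>\<omega>\<close>.\<close>
    have key: "1 + t\<^sup>2 * V \<le> exp (c * t\<^sup>2)" for t
    proof -
      have inner: "2 + t\<^sup>2 * ((Y \<omega>)\<^sup>2 - 2 * Y \<omega> * m + (V + m\<^sup>2)) \<le> exp (t * Y \<omega>) * A (- t) + exp (- t * Y \<omega>) * A t" for \<omega>
      proof -
        have "expectation (\<lambda>\<omega>'. 2 + t\<^sup>2 * ((Y \<omega>)\<^sup>2 - 2 * Y \<omega> * Y \<omega>' + (Y \<omega>')\<^sup>2))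
           \<le> expectation (\<lambda>\<omega>'. exp (t * Y \<omega>) * exp (- t * Y \<omega>') + exp (- t * Y \<omega>) * exp (t * Y \<omega>'))"
        proof (intro integral_mono)
          fix \<omega>'
          show "2 + t\<^sup>2 * ((Y \<omega>)\<^sup>2 - 2 * Y \<omega> * Y \<omega>' + (Y \<omega>')\<^sup>2)
             \<le> exp (t * Y \<omega>) * exp (- t * Y \<omega>') + exp (- t * Y \<omega>) * exp (t * Y \<omega>')"
            using cosh_lower[of "t * (Y \<omega> - Y \<omega>')"]
            by (simp add: algebra_simps power2_eq_square flip: exp_add)
        qed (use intY int2 inte inte[of "- t"] in auto)
        then show ?thesis
          using intY int2 inte[of t] inte[of "- t"] by (simp add: A_def V m_def prob_space)
      qed
      have "2 + t\<^sup>2 * (2 * V) = expectation (\<lambda>\<omega>. 2 + t\<^sup>2 * ((Y \<omega>)\<^sup>2 - 2 * Y \<omega> * m + (V + m\<^sup>2)))"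
        using intY int2 by (simp add: V prob_space m_def[symmetric] power2_eq_square algebra_simps)
      also have "\<dots> \<le> expectation (\<lambda>\<omega>. exp (t * Y \<omega>) * A (- t) + exp (- t * Y \<omega>) * A t)"
        using intY int2 inte[of t] inte[of "- t"] by (intro integral_mono inner) auto
      also have "\<dots> = 2 * (A t * A (- t))"
        using inte[of t] inte[of "- t"] by (simp add: A_def)
      finally show ?thesis using AA[of t] by simp
    qed
    have "V \<le> (exp (c * s) - 1) / s" if s: "0 < s" for s
      using key[of "sqrt s"] s by (simp add: field_simps)
    moreover have "((\<lambda>s. (exp (c * s) - 1) / s) \<longlongrightarrow> c) (at_right 0)"
    proof -
      have "((\<lambda>s. exp (c * s)) has_real_derivative c) (at 0)" by (auto intro!: derivative_eq_intros)
      then have "((\<lambda>s. (exp (c * s) - 1) / s) \<longlongrightarrow> c) (at 0)" by (simp add: has_field_derivative_iff)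
      then show ?thesis by (rule filterlim_mono) (auto simp: at_within_le_at)
    qed
    ultimately show ?thesis unfolding V_def[symmetric]
      by (intro tendsto_lowerbound[where f="\<lambda>s. (exp (c * s) - 1) / s" and F="at_right 0"])
        (auto intro!: eventually_at_right_less[THEN eventually_mono])
  qed
  have "prob {\<omega> \<in> space M. \<bar>Y \<omega> - expectation Y\<bar> > \<epsilon>} \<le> prob {\<omega> \<in> space M. \<bar>Y \<omega> - expectation Y\<bar> \<ge> \<epsilon>}"
    by (intro finite_measure_mono) auto
  also have "\<dots> \<le> variance Y / \<epsilon>\<^sup>2" by (rule Chebyshev_inequality[OF Y int2 \<epsilon>])
  also have "\<dots> \<le> c / \<epsilon>\<^sup>2" using var by (intro divide_right_mono) auto
  finally show "prob {\<omega> \<in> space M. \<bar>Y \<omega> - expectation Y\<bar> > \<epsilon>} \<le> c / \<epsilon>\<^sup>2" .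
qed

end

section \<open>Concentration on the Stiefel manifold\<close>

text \<open>
  The two frames may be brought to normal form because \<open>F\<close> depends only on their spans and because the law of
  \<open>Q\<close> absorbs the change of basis \<open>h\<close>. The estimate for differentiable functions is applied to a
  smoothing of \<open>F\<close> at scale \<open>1 / (i + 1)\<close> and passes to the limit.
\<close>

lemma rotated_pair_mgf:
  fixes F :: "real^'d^'k \<Rightarrow> real" and \<nu> :: "(real^'d^'d) measure"
  assumes nu: "prob_space \<nu>" "sets \<nu> = sets (orthogonal_space :: (real^'d^'d) measure)"
    "\<And>h. orthogonal_matrix h \<Longrightarrow> (\<lambda>Q. h ** Q) \<in> measurable \<nu> \<nu>"
    "\<And>h. orthogonal_matrix h \<Longrightarrow> distr \<nu> \<nu> (\<lambda>Q. h ** Q) = \<nu>"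
    and bd: "\<And>x. \<bar>F x\<bar> \<le> C" and lip: "\<And>x y. \<bar>F x - F y\<bar> \<le> l * norm (x - y)" and l0: "0 \<le> l"
    and inv: "\<And>R \<theta>. orthogonal_matrix R \<Longrightarrow> F (R ** \<theta>) = F \<theta>"
    and \<theta>: "\<theta> \<in> stiefel" "\<theta>' \<in> stiefel"
    and n: "n = CARD('k) \<or> n = CARD('d) - CARD('k)" "2 \<le> n" and \<tau>: "0 \<le> \<tau>"
  shows "(\<integral>Q. exp (\<tau> * (F (\<theta>' ** Q) - F (\<theta> ** Q))) \<partial>\<nu>) \<le> exp (\<tau>\<^sup>2 * (pi / 2 * l)\<^sup>2 / real (n - 1))"
proof -
  interpret nu: prob_space \<nu> by fact
  obtain R R' :: "real^'k^'k" and h :: "real^'d^'d" and \<iota> p \<beta>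
    where R: "orthogonal_matrix R" "orthogonal_matrix R'" and h: "orthogonal_matrix h" and nf: "inj \<iota>"
    "\<And>i. p (p i) = i" "\<And>i. \<beta> (p i) = - \<beta> i" "\<And>i. \<bar>\<beta> i\<bar> \<le> pi / 2"
    "\<And>j. \<beta> (\<iota> j) \<noteq> 0 \<Longrightarrow> p (\<iota> j) \<notin> range \<iota>"
    and frames: "R ** \<theta> = row_selection \<iota> ** h" "R' ** \<theta>' = row_selection \<iota> ** rotation_group p \<beta> 1 ** h"
    by (rule frame_pair_normal_form[OF \<theta>]) blast
  define f where "f G Q = exp (\<tau> * (G (row_selection \<iota> ** (rotation_group p \<beta> 1 ** Q)) - G (row_selection \<iota> ** Q)))"
    for G :: "real^'d^'k \<Rightarrow> real" and Q :: "real^'d^'d"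
  define E where "E = exp (\<tau>\<^sup>2 * (pi / 2 * l)\<^sup>2 / real (n - 1))"
  have cont_f: "f G \<in> borel_measurable \<nu>" if "continuous_on UNIV G" for G
  proof -
    have 1: "continuous_on UNIV (\<lambda>Q :: real^'d^'d. G (A ** Q))" for A :: "real^'d^'k"
      by (intro continuous_on_compose2[OF that] linear_continuous_on bounded_linear_matrix_mult_left) auto
    have "continuous_on UNIV (f G)"
      unfolding f_def matrix_mul_assoc by (intro continuous_intros 1)
    then have "f G \<in> borel_measurable borel" by (rule borel_measurable_continuous_onI)
    then show ?thesis unfolding measurable_cong_sets[OF nu(2) refl] by (rule measurable_restrict_space1)
  qed
  have contF: "continuous_on UNIV F"
    by (rule lipschitz_on_continuous_on[of l]) (auto intro!: lipschitz_onI simp: lip l0 dist_norm)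
  have "exp (\<tau> * (F (\<theta>' ** Q) - F (\<theta> ** Q))) = f F (h ** Q)" for Q
  proof -
    have "F (\<theta>' ** Q) = F (R' ** \<theta>' ** Q)" "F (\<theta> ** Q) = F (R ** \<theta> ** Q)"
      using inv R by (simp_all flip: matrix_mul_assoc)
    then show ?thesis unfolding f_def frames by (simp add: matrix_mul_assoc)
  qed
  then have "(\<integral>Q. exp (\<tau> * (F (\<theta>' ** Q) - F (\<theta> ** Q))) \<partial>\<nu>) = (\<integral>Q. f F Q \<partial>\<nu>)"
    using integral_distr[OF nu(3)[OF h] cont_f[OF contF]] nu(4)[OF h] by simp
  also have "\<dots> \<le> E"
  proof (rule LIMSEQ_le_const)
    show "(\<lambda>i. exp (2 * \<tau> * l * inverse (real (Suc i))) * E) \<longlonglongrightarrow> E"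
      using tendsto_mult[OF tendsto_exp[OF tendsto_mult[OF tendsto_const[of "2 * \<tau> * l"] LIMSEQ_inverse_real_of_nat]] tendsto_const[of E]]
      by simp
    have "(\<integral>Q. f F Q \<partial>\<nu>) \<le> exp (2 * \<tau> * l * inverse (real (Suc i))) * E" for i
    proof -
      define \<eta> where "\<eta> = inverse (real (Suc i))"
      have \<eta>: "0 < \<eta>" by (simp add: \<eta>_def)
      obtain G where G: "\<And>x. G differentiable (at x)" "\<And>x y. \<bar>G x - G y\<bar> \<le> l * norm (x - y)"
        "\<And>x. \<bar>G x - F x\<bar> \<le> \<eta> * l"
        "\<And>T x. orthogonal_transformation T \<Longrightarrow> (\<And>x. F (T x) = F x) \<Longrightarrow> G (T x) = G x"
        using lipschitz_smoothing[OF bd lip l0 \<eta>] by blast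
      have Ginv: "G (S ** \<theta>) = G \<theta>" if "orthogonal_matrix S" for S \<theta>
        using G(4)[OF orthogonal_transformation_matrix_mult_left[OF that]] inv[OF that] by blast
      interpret rotated_frame \<nu> G l \<iota> p \<beta>
        by unfold_locales (use nu G(1,2) Ginv nf in auto)
      have contG: "continuous_on UNIV G" by (rule continuous_on_G)
      have Gb: "\<bar>G x\<bar> \<le> C + \<eta> * l" for x using G(3)[of x] bd[of x] by linarith
      have fb: "f H Q \<le> exp (\<tau> * (2 * D))" if "\<And>x. \<bar>H x\<bar> \<le> D" for H D Q
        unfolding f_def using that[of "row_selection \<iota> ** (rotation_group p \<beta> 1 ** Q)"] that[of "row_selection \<iota> ** Q"] \<tau>
        by (auto intro!: mult_left_mono)
      have int: "integrable \<nu> (f H)" if "continuous_on UNIV H" "\<And>x. \<bar>H x\<bar> \<le> D" for H D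
        using cont_f[OF that(1)] fb[OF that(2)] by (intro nu.integrable_bounded[of _ "exp (\<tau> * (2 * D))"]) (auto simp: f_def)
      have "(\<integral>Q. f F Q \<partial>\<nu>) \<le> (\<integral>Q. exp (2 * \<tau> * l * \<eta>) * f G Q \<partial>\<nu>)"
      proof (intro integral_mono integrable_mult_right int[OF contF bd] int[OF contG Gb])
        fix Q :: "real^'d^'d"
        let ?x = "row_selection \<iota> ** (rotation_group p \<beta> 1 ** Q)" and ?y = "row_selection \<iota> ** Q"
        have "F ?x - F ?y \<le> 2 * (\<eta> * l) + (G ?x - G ?y)" using G(3)[of ?x] G(3)[of ?y] by linarith
        from mult_left_mono[OF this \<tau>]
        have "\<tau> * (F ?x - F ?y) \<le> 2 * \<tau> * l * \<eta> + \<tau> * (G ?x - G ?y)" by (simp add: algebra_simps)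
        then show "f F Q \<le> exp (2 * \<tau> * l * \<eta>) * f G Q" unfolding f_def by (simp flip: exp_add)
      qed
      also have "\<dots> = exp (2 * \<tau> * l * \<eta>) * (\<integral>Q. f G Q \<partial>\<nu>)" by simp
      also have "(\<integral>Q. f G Q \<partial>\<nu>) \<le> nu.expectation (\<lambda>Q. exp (\<tau> * slope Q))"
        unfolding f_def by (rule endpoint_le_slope)
      also have "\<dots> \<le> E"
        using n(1)
      proof
        assume "n = CARD('k)"
        with n(2) show ?thesis unfolding E_def by (simp only: slope_mgf_inside[OF _ \<tau>])
      next
        assume "n = CARD('d) - CARD('k)"
        with n(2) show ?thesis unfolding E_def by (simp only: slope_mgf_outside[OF _ \<tau>])
      qed
      finally show ?thesis by (simp add: \<eta>_def)
    qed
    then show "\<exists>N. \<forall>i\<ge>N. (\<integral>Q. f F Q \<partial>\<nu>) \<le> exp (2 * \<tau> * l * inverse (real (Suc i))) * E" by blast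
  qed
  finally show ?thesis unfolding E_def .
qed

lemma stiefel_mult_right:
  assumes "\<theta> \<in> stiefel" "orthogonal_matrix Q"
  shows "\<theta> ** Q \<in> stiefel"
proof -
  have "\<theta> ** Q ** transpose (\<theta> ** Q) = \<theta> ** (Q ** transpose Q) ** transpose \<theta>"
    by (simp add: matrix_transpose_mul matrix_mul_assoc)
  then show ?thesis using assms by (simp add: stiefel_iff orthogonal_matrix_def)
qed

lemma stiefel_haar_rotation:
  fixes \<mu> :: "(real^'d^'k) measure"
  assumes \<mu>: "stiefel_haar \<mu>" and Q: "orthogonal_matrix Q"
  shows "(\<lambda>\<theta>. \<theta> ** Q) \<in> measurable \<mu> \<mu>" "distr \<mu> \<mu> (\<lambda>\<theta>. \<theta> ** Q) = \<mu>"
proof -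
  have sets: "sets \<mu> = sets stiefel_space" using \<mu> by (simp add: stiefel_haar_def)
  have "(\<lambda>\<theta> :: real^'d^'k. \<theta> ** Q) \<in> measurable stiefel_space stiefel_space"
    unfolding stiefel_space_def
  proof (intro measurable_restrict_space2 measurable_restrict_space1)
    show "(\<lambda>\<theta> :: real^'d^'k. \<theta> ** Q) \<in> borel_measurable borel"
      by (intro borel_measurable_continuous_onI linear_continuous_on bounded_linear_matrix_mult_right)
    show "(\<lambda>\<theta> :: real^'d^'k. \<theta> ** Q) \<in> space (restrict_space borel stiefel) \<rightarrow> stiefel"
      using Q by (auto simp: space_restrict_space stiefel_mult_right)
  qed
  then show "(\<lambda>\<theta>. \<theta> ** Q) \<in> measurable \<mu> \<mu>" unfolding measurable_cong_sets[OF sets sets] .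
  have T: "orthogonal_transformation (\<lambda>x. x v* Q)"
    using orthogonal_transformation_matrix_vector[of "transpose Q"] Q by simp
  have "distr \<mu> \<mu> (\<lambda>\<theta>. \<chi> i. U (\<theta> $ i)) = \<mu>" if "orthogonal_transformation U" for U
    using \<mu> that unfolding stiefel_haar_def by blast
  from this[OF T] have "distr \<mu> \<mu> (\<lambda>\<theta>. \<chi> i. (\<theta> $ i) v* Q) = \<mu>" .
  moreover have "(\<lambda>\<theta> :: real^'d^'k. \<chi> i. (\<theta> $ i) v* Q) = (\<lambda>\<theta>. \<theta> ** Q)"
    by (auto simp: vec_eq_iff[of "vec_lambda _"] matrix_mult_nth)
  ultimately show "distr \<mu> \<mu> (\<lambda>\<theta>. \<theta> ** Q) = \<mu>" by (simp only:)
qed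

text \<open>
  By invariance, a pair of independent frames may be replaced by its image under any fixed
  orthogonal matrix, hence also under a random one. By Fubini it suffices to bound the inner average over
  the rotation, for each fixed pair.
\<close>

lemma stiefel_haar_mgf:
  fixes F :: "real^'d^'k \<Rightarrow> real" and \<mu> :: "(real^'d^'k) measure"
  assumes \<mu>: "stiefel_haar \<mu>"
    and bd: "\<And>x. \<bar>F x\<bar> \<le> C" and lip: "\<And>x y. \<bar>F x - F y\<bar> \<le> l * norm (x - y)" and l0: "0 \<le> l"
    and inv: "\<And>R \<theta>. orthogonal_matrix R \<Longrightarrow> F (R ** \<theta>) = F \<theta>"
    and n: "n = CARD('k) \<or> n = CARD('d) - CARD('k)" "2 \<le> n" and \<tau>: "0 \<le> \<tau>"
  shows "(\<integral>\<theta>. exp (\<tau> * F \<theta>) \<partial>\<mu>) * (\<integral>\<theta>. exp (- \<tau> * F \<theta>) \<partial>\<mu>) \<le> exp (\<tau>\<^sup>2 * (pi / 2 * l)\<^sup>2 / real (n - 1))"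
proof -
  obtain \<nu> :: "(real^'d^'d) measure" where nu: "prob_space \<nu>" "sets \<nu> = sets (orthogonal_space :: (real^'d^'d) measure)"
    "\<And>h. orthogonal_matrix h \<Longrightarrow> (\<lambda>Q. h ** Q) \<in> measurable \<nu> \<nu>"
    "\<And>h. orthogonal_matrix h \<Longrightarrow> distr \<nu> \<nu> (\<lambda>Q. h ** Q) = \<nu>"
    by (rule orthogonal_haar_exists) blast
  interpret nu: prob_space \<nu> by fact
  interpret mu: prob_space \<mu> using \<mu> by (simp add: stiefel_haar_def)
  interpret mm: pair_prob_space \<mu> \<mu> ..
  interpret Pnu: pair_prob_space "\<mu> \<Otimes>\<^sub>M \<mu>" \<nu> ..
  have sets: "sets \<mu> = sets stiefel_space" using \<mu> by (simp add: stiefel_haar_def)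
  have space: "space \<mu> = stiefel"
    using sets_eq_imp_space_eq[OF sets] by (simp add: stiefel_space_def space_restrict_space)
  have space_nu: "space \<nu> = {Q. orthogonal_matrix Q}"
    using sets_eq_imp_space_eq[OF nu(2)] by (simp add: space_restrict_space)
  have id_mu [measurable]: "(\<lambda>\<theta>. \<theta>) \<in> borel_measurable \<mu>"
    unfolding measurable_cong_sets[OF sets refl] stiefel_space_def by (rule measurable_restrict_space1) simp
  have id_nu [measurable]: "(\<lambda>Q. Q) \<in> borel_measurable \<nu>"
    unfolding measurable_cong_sets[OF nu(2) refl] by (rule measurable_restrict_space1) simp
  have contF: "continuous_on UNIV F"
    by (rule lipschitz_on_continuous_on[of l]) (auto intro!: lipschitz_onI simp: lip l0 dist_norm)
  have "continuous_on UNIV (\<lambda>p :: (real^'d^'k) \<times> (real^'d^'d). fst p ** snd p)"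
    unfolding matrix_matrix_mult_def by (intro continuous_intros)
  from continuous_on_compose2[OF contF this]
  have Fm: "(\<lambda>p :: (real^'d^'k) \<times> (real^'d^'d). F (fst p ** snd p)) \<in> borel_measurable (borel \<Otimes>\<^sub>M borel)"
    unfolding borel_prod by (intro borel_measurable_continuous_onI) auto
  define f where "f z Q = exp (\<tau> * (F (snd z ** Q) - F (fst z ** Q)))" for z :: "(real^'d^'k) \<times> (real^'d^'k)" and Q :: "real^'d^'d"
  have fst_m: "(\<lambda>w. (fst (fst w), snd w)) \<in> measurable ((\<mu> \<Otimes>\<^sub>M \<mu>) \<Otimes>\<^sub>M \<nu>) (borel \<Otimes>\<^sub>M borel)"
    and snd_m: "(\<lambda>w. (snd (fst w), snd w)) \<in> measurable ((\<mu> \<Otimes>\<^sub>M \<mu>) \<Otimes>\<^sub>M \<nu>) (borel \<Otimes>\<^sub>M borel)"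
    using measurable_compose[OF _ id_mu] measurable_compose[OF _ id_nu]
    by (auto intro!: measurable_Pair)
  have f_m [measurable]: "case_prod f \<in> borel_measurable ((\<mu> \<Otimes>\<^sub>M \<mu>) \<Otimes>\<^sub>M \<nu>)"
    unfolding f_def split_beta
    using measurable_compose[OF fst_m Fm] measurable_compose[OF snd_m Fm] by simp
  have fb: "\<bar>f z Q\<bar> \<le> exp (\<tau> * (2 * C))" for z Q
    unfolding f_def using bd[of "snd z ** Q"] bd[of "fst z ** Q"] \<tau> by (auto intro!: mult_left_mono)
  have intf: "integrable ((\<mu> \<Otimes>\<^sub>M \<mu>) \<Otimes>\<^sub>M \<nu>) (case_prod f)"
    by (rule Pnu.integrable_const_bound[of _ "exp (\<tau> * (2 * C))"]) (use fb in auto)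
  have F_mu: "F \<in> borel_measurable \<mu>"
    using measurable_compose[OF id_mu borel_measurable_continuous_onI[OF contF]] .
  define A where "A t = (\<integral>\<theta>. exp (t * F \<theta>) \<partial>\<mu>)" for t
  have rot: "A \<tau> * A (- \<tau>) = (\<integral>z. f z Q \<partial>(\<mu> \<Otimes>\<^sub>M \<mu>))" if Q: "Q \<in> space \<nu>" for Q
  proof -
    have oQ: "orthogonal_matrix Q" using Q by (simp add: space_nu)
    have At: "A t = (\<integral>\<theta>. exp (t * F (\<theta> ** Q)) \<partial>\<mu>)" for t
    proof -
      have "(\<lambda>\<theta>. exp (t * F \<theta>)) \<in> borel_measurable \<mu>" using F_mu by measurable
      from integral_distr[OF stiefel_haar_rotation(1)[OF \<mu> oQ] this] show ?thesis
        unfolding stiefel_haar_rotation(2)[OF \<mu> oQ] A_def .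
    qed
    have "integrable (\<mu> \<Otimes>\<^sub>M \<mu>) (\<lambda>z. f z Q)"
      using measurable_Pair_compose_split[OF f_m, of "\<lambda>z. z" "\<mu> \<Otimes>\<^sub>M \<mu>" "\<lambda>_. Q"] Q fb
      by (intro mm.integrable_const_bound[of _ "exp (\<tau> * (2 * C))"]) auto
    from mm.integral_fst'[OF this] have "(\<integral>z. f z Q \<partial>(\<mu> \<Otimes>\<^sub>M \<mu>)) = (\<integral>\<theta>. \<integral>\<theta>'. f (\<theta>, \<theta>') Q \<partial>\<mu> \<partial>\<mu>)" by simp
    also have "\<dots> = (\<integral>\<theta>. \<integral>\<theta>'. exp (\<tau> * F (\<theta>' ** Q)) * exp (- \<tau> * F (\<theta> ** Q)) \<partial>\<mu> \<partial>\<mu>)"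
      unfolding f_def by (simp add: right_diff_distrib flip: exp_add)
    also have "\<dots> = A \<tau> * A (- \<tau>)" unfolding At by simp
    finally show ?thesis by simp
  qed
  have "A \<tau> * A (- \<tau>) = (\<integral>Q. A \<tau> * A (- \<tau>) \<partial>\<nu>)" by (simp add: nu.prob_space)
  also have "\<dots> = (\<integral>Q. (\<integral>z. f z Q \<partial>(\<mu> \<Otimes>\<^sub>M \<mu>)) \<partial>\<nu>)"
    by (rule Bochner_Integration.integral_cong) (simp_all add: rot)
  also have "\<dots> = (\<integral>z. (\<integral>Q. f z Q \<partial>\<nu>) \<partial>(\<mu> \<Otimes>\<^sub>M \<mu>))"
    by (rule Pnu.Fubini_integral[OF intf])
  also have "\<dots> \<le> (\<integral>z. exp (\<tau>\<^sup>2 * (pi / 2 * l)\<^sup>2 / real (n - 1)) \<partial>(\<mu> \<Otimes>\<^sub>M \<mu>))"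
  proof (rule integral_mono)
    show "integrable (\<mu> \<Otimes>\<^sub>M \<mu>) (\<lambda>z. \<integral>Q. f z Q \<partial>\<nu>)"
      using Pnu.integrable_fst[OF intf] .
    fix z assume "z \<in> space (\<mu> \<Otimes>\<^sub>M \<mu>)"
    then have z: "fst z \<in> stiefel" "snd z \<in> stiefel" by (auto simp: space_pair_measure space)
    from rotated_pair_mgf[OF nu bd lip l0 inv z n \<tau>]
    show "(\<integral>Q. f z Q \<partial>\<nu>) \<le> exp (\<tau>\<^sup>2 * (pi / 2 * l)\<^sup>2 / real (n - 1))"
      unfolding f_def by simp
  qed simp
  also have "\<dots> = exp (\<tau>\<^sup>2 * (pi / 2 * l)\<^sup>2 / real (n - 1))" by (simp add: mm.prob_space)
  finally show ?thesis unfolding A_def .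
qed

text \<open>
  Replacing \<open>\<theta>'\<close> by \<open>- \<theta>'\<close> does not change the value of \<open>F\<close>, so the inner product of the two frames may be
  taken to be nonnegative.
\<close>

lemma stiefel_diameter:
  fixes F :: "real^'d^'k \<Rightarrow> real"
  assumes lip: "\<And>x y. \<bar>F x - F y\<bar> \<le> l * norm (x - y)" and l0: "0 \<le> l"
    and inv: "\<And>R \<theta>. orthogonal_matrix R \<Longrightarrow> F (R ** \<theta>) = F \<theta>"
    and \<theta>: "\<theta> \<in> stiefel" "\<theta>' \<in> stiefel"
  shows "\<bar>F \<theta> - F \<theta>'\<bar> \<le> l * sqrt (2 * real CARD('k))"
proof -
  have nrm: "\<theta> \<bullet> \<theta> = real CARD('k)" if "\<theta> \<in> stiefel" for \<theta> :: "real^'d^'k"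
    using that by (simp add: stiefel_def inner_vec_def[of \<theta>])
  define s :: real where "s = (if 0 \<le> \<theta> \<bullet> \<theta>' then 1 else - 1)"
  define R :: "real^'k^'k" where "R = s *\<^sub>R mat 1"
  have s: "s * s = 1" by (simp add: s_def)
  have "(mat 1 :: real^'k^'k) $ i \<bullet> mat 1 $ j = (if i = j then 1 else 0)" for i j
    using orthogonal_matrix_id[where 'n='k and 'a=real] unfolding orthogonal_matrix_rows by blast
  then have R: "orthogonal_matrix R"
    unfolding orthogonal_matrix_rows R_def by (simp add: s mult.assoc[symmetric])
  have R\<theta>: "R ** \<theta>' = s *\<^sub>R \<theta>'"
    by (simp add: R_def vec_eq_iff matrix_matrix_mult_def mat_def if_distrib[of "\<lambda>x. x * _"] if_distrib[of "\<lambda>x. _ * x"] cong: if_cong)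
  have "(norm (\<theta> - s *\<^sub>R \<theta>'))\<^sup>2 = \<theta> \<bullet> \<theta> + s * s * (\<theta>' \<bullet> \<theta>') - 2 * (s * (\<theta> \<bullet> \<theta>'))"
    unfolding power2_norm_eq_inner by (simp add: inner_diff inner_commute algebra_simps)
  also have "\<dots> \<le> 2 * real CARD('k)"
    unfolding s nrm[OF \<theta>(1)] nrm[OF \<theta>(2)] by (simp add: s_def)
  finally have "norm (\<theta> - s *\<^sub>R \<theta>') \<le> sqrt (2 * real CARD('k))" by (rule real_le_rsqrt)
  then have "l * norm (\<theta> - R ** \<theta>') \<le> l * sqrt (2 * real CARD('k))" unfolding R\<theta> by (intro mult_left_mono l0)
  moreover have "\<bar>F \<theta> - F \<theta>'\<bar> = \<bar>F \<theta> - F (R ** \<theta>')\<bar>" using inv[OF R] by simp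
  ultimately show ?thesis using lip[of \<theta> "R ** \<theta>'"] by linarith
qed

lemma dimension_bound:
  fixes k d :: nat
  assumes "k \<le> d" "20 \<le> k * d"
  shows "2 \<le> max k (d - k)" "3 * d \<le> 8 * (max k (d - k) - 1)"
proof -
  have d5: "5 \<le> d"
  proof (rule ccontr)
    assume "\<not> 5 \<le> d"
    then have "k * d \<le> 4 * 4" using assms(1) by (intro mult_le_mono) auto
    then show False using assms(2) by simp
  qed
  have half: "d \<le> 2 * max k (d - k)" by linarith
  show "2 \<le> max k (d - k)" using half d5 by linarith
  consider "8 \<le> d" | "d = 5" | "d = 6" | "d = 7" using d5 by linarith
  then show "3 * d \<le> 8 * (max k (d - k) - 1)"
  proof cases
    case 1 then show ?thesis using half by linarith
  next
    case 2 then show ?thesis using half assms by auto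
  next
    case 3 then have "4 \<le> k" using assms by simp
    then show ?thesis using 3 by auto
  next
    case 4 then have "4 \<le> max k (d - k)" using half by linarith
    then show ?thesis using 4 by linarith
  qed
qed

text \<open>
  In low dimension, \<open>k d \<le> 19\<close>, the oscillation of \<open>F\<close> is smaller than \<open>\<epsilon>\<close>. Otherwise the larger one \<open>n\<close>
  of the dimensions \<open>k\<close> and \<open>d - k\<close> satisfies \<open>3 d \<le> 8 (n - 1)\<close>, and the moment generating function
  of the difference of two independent copies is at most \<open>exp (c t\<^sup>2)\<close> with \<open>c = 2 pi\<^sup>2 B / (3 d)\<close>.

  Invariance under the orthogonal group of \<open>\<real>\<^sup>k\<close> cannot be dropped: for \<open>k = d\<close> the Stiefel manifold has two
  components, whose indicators are Lipschitz functions that do not concentrate.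
\<close>

theorem stiefel_concentration:
  fixes F :: "real^'d^'k \<Rightarrow> real" and \<mu> :: "(real^'d^'k) measure" and B \<epsilon> :: real
  assumes kd: "CARD('k) \<le> CARD('d)" and \<mu>: "stiefel_haar \<mu>"
    and bd: "\<And>x. \<bar>F x\<bar> \<le> C" and lip: "\<And>x y. \<bar>F x - F y\<bar> \<le> sqrt B * norm (x - y)" and B: "0 < B"
    and inv: "\<And>R \<theta>. orthogonal_matrix R \<Longrightarrow> F (R ** \<theta>) = F \<theta>"
    and \<epsilon>: "\<epsilon> > 2 * pi * sqrt (B / real CARD('d))"
  shows "measure \<mu> {\<theta> \<in> space \<mu>. \<bar>F \<theta> - (\<integral>\<theta>. F \<theta> \<partial>\<mu>)\<bar> > \<epsilon>}
      \<le> sqrt (pi / 2) * exp (- (real CARD('d) * \<epsilon>\<^sup>2 / (32 * B)))"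
proof -
  define k where "k = CARD('k)"
  define d where "d = CARD('d)"
  have kd0: "0 < k" "0 < d" by (simp_all add: k_def d_def)
  interpret prob_space \<mu> using \<mu> by (simp add: stiefel_haar_def)
  have sets: "sets \<mu> = sets stiefel_space" using \<mu> by (simp add: stiefel_haar_def)
  have space: "space \<mu> = stiefel"
    using sets_eq_imp_space_eq[OF sets] by (simp add: stiefel_space_def space_restrict_space)
  have l0: "0 \<le> sqrt B" using B by simp
  have contF: "continuous_on UNIV F"
    by (rule lipschitz_on_continuous_on[of "sqrt B"]) (auto intro!: lipschitz_onI simp: lip dist_norm less_imp_le[OF B])
  have Fm: "F \<in> borel_measurable \<mu>"
    unfolding measurable_cong_sets[OF sets refl] stiefel_space_def
    by (rule measurable_restrict_space1) (rule borel_measurable_continuous_onI[OF contF])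
  have nn: "0 \<le> 2 * pi * sqrt (B / real d)" using B by simp
  then have \<epsilon>0: "0 < \<epsilon>" using \<epsilon> unfolding d_def by linarith
  have "(2 * pi * sqrt (B / real d))\<^sup>2 < \<epsilon>\<^sup>2"
    by (rule power_strict_mono[OF _ nn]) (use \<epsilon> in \<open>simp_all add: d_def\<close>)
  then have \<epsilon>sq: "4 * pi\<^sup>2 * (B / real d) < \<epsilon>\<^sup>2" using B by (simp add: power_mult_distrib)
  define T where "T = real d * \<epsilon>\<^sup>2 / B"
  have T: "4 * pi\<^sup>2 < T" using \<epsilon>sq B kd0 unfolding T_def by (simp add: field_simps)
  let ?S = "{\<theta> \<in> space \<mu>. \<bar>F \<theta> - expectation F\<bar> > \<epsilon>}"
  have goal: "measure \<mu> ?S \<le> sqrt (pi / 2) * exp (- (T / 32))"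
  \<comment> \<open>The diameter bound is below \<open>\<epsilon>\<close> as soon as \<open>2 k d < 4 pi\<^sup>2\<close>, and \<open>38 < 4 pi\<^sup>2 < 40\<close>.\<close>
  proof (cases "k * d \<le> 19")
    case True
    have intF: "integrable \<mu> F" by (rule integrable_bounded[OF Fm bd])
    have small: "sqrt B * sqrt (2 * real k) < \<epsilon>"
    proof (rule power2_less_imp_less)
      have "real (k * d) \<le> 19" using True by linarith
      moreover have "2 * real k * real d = 2 * real (k * d)" by simp
      ultimately have "2 * real k * real d < 4 * pi\<^sup>2" using pi_sq_bounds(1) by linarith
      then have "B * (2 * real k) < 4 * pi\<^sup>2 * (B / real d)" using B kd0 by (simp add: field_simps)
      then show "(sqrt B * sqrt (2 * real k))\<^sup>2 < \<epsilon>\<^sup>2" using \<epsilon>sq B by (simp add: power_mult_distrib)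
    qed (use \<epsilon>0 in simp)
    have "\<bar>F \<theta> - expectation F\<bar> \<le> sqrt B * sqrt (2 * real k)" if "\<theta> \<in> space \<mu>" for \<theta>
    proof -
      have "\<bar>F \<theta> - expectation F\<bar> = \<bar>expectation (\<lambda>\<theta>'. F \<theta> - F \<theta>')\<bar>" using intF by (simp add: prob_space)
      also have "\<dots> \<le> expectation (\<lambda>\<theta>'. sqrt B * sqrt (2 * real k))"
        using intF that stiefel_diameter[OF lip l0 inv]
        by (intro order_trans[OF integral_abs_bound] integral_mono) (auto simp: space k_def)
      finally show ?thesis by (simp add: prob_space)
    qed
    with small have "?S = {}" by force
    then show ?thesis by (simp only: measure_empty) simp
  next
    case False
    define n where "n = max k (d - k)"
    have n: "2 \<le> n" "3 * d \<le> 8 * (n - 1)"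
      using dimension_bound[of k d] kd False unfolding n_def k_def d_def by auto
    define c where "c = 2 * pi\<^sup>2 * B / (3 * real d)"
    have c: "0 < c" using B kd0 by (simp add: c_def)
    have c_ge: "(pi / 2 * sqrt B)\<^sup>2 / real (n - 1) \<le> c"
    proof -
      have n1: "0 < real (n - 1)" using n(1) by simp
      have "3 * real d \<le> 8 * real (n - 1)" using n(2) by linarith
      then have "pi\<^sup>2 * B * (3 * real d) \<le> pi\<^sup>2 * B * (8 * real (n - 1))" using B by (intro mult_left_mono) auto
      then show ?thesis using n1 kd0 B unfolding c_def by (simp add: power_mult_distrib power_divide field_simps)
    qed
    have mgf: "expectation (\<lambda>\<theta>. exp (t * F \<theta>)) * expectation (\<lambda>\<theta>. exp (- t * F \<theta>)) \<le> exp (c * t\<^sup>2)" if t: "0 \<le> t" for t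
    proof -
      have "n = CARD('k) \<or> n = CARD('d) - CARD('k)" by (auto simp: n_def k_def d_def max_def)
      from stiefel_haar_mgf[OF \<mu> bd lip l0 inv this n(1) t]
      have "expectation (\<lambda>\<theta>. exp (t * F \<theta>)) * expectation (\<lambda>\<theta>. exp (- t * F \<theta>))
          \<le> exp (t\<^sup>2 * (pi / 2 * sqrt B)\<^sup>2 / real (n - 1))" .
      also have "\<dots> \<le> exp (c * t\<^sup>2)"
        using mult_left_mono[OF c_ge, of "t\<^sup>2"] by (simp add: mult.commute)
      finally show ?thesis .
    qed
    have "- \<epsilon>\<^sup>2 / (4 * c) = - 3 * T / (8 * pi\<^sup>2)" "c / \<epsilon>\<^sup>2 = 2 * pi\<^sup>2 / (3 * T)"
      using B kd0 \<epsilon>0 unfolding c_def T_def by (simp_all add: field_simps power2_eq_square)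
    then have "measure \<mu> ?S \<le> min (2 * pi\<^sup>2 / (3 * T)) (2 * exp (- 3 * T / (8 * pi\<^sup>2)))"
      using symmetrized_mgf_tail[OF Fm bd mgf c \<epsilon>0] by simp
    also have "\<dots> \<le> sqrt (pi / 2) * exp (- (T / 32))" by (rule tail_comparison[OF T])
    finally show ?thesis .
  qed
  have "T / 32 = real CARD('d) * \<epsilon>\<^sup>2 / (32 * B)" by (simp add: T_def d_def)
  with goal show ?thesis by simp
qed

section \<open>Rotation invariance of the standard normal law\<close>

lemma prod_Basis_cart: "(\<Prod>b\<in>(Basis :: (real^'k) set). g b) = (\<Prod>i\<in>UNIV. g (axis i 1))"
proof -
  have "(Basis :: (real^'k) set) = range (\<lambda>i. axis i 1)" by (auto simp: Basis_vec_def)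
  moreover have "inj (\<lambda>i::'k. axis i (1::real))" by (auto simp: inj_on_def axis_eq_axis)
  ultimately show ?thesis by (metis (no_types, lifting) prod.reindex_cong)
qed

lemma norm_sq_cart: "(norm (x :: real^'n))\<^sup>2 = (\<Sum>i\<in>UNIV. (x $ i)\<^sup>2)"
  unfolding power2_norm_eq_inner inner_vec_def by (simp add: power2_eq_square)

text \<open>
  Both measures agree on boxes, where independence and Tonelli's theorem factor them in the same way.
\<close>

lemma standard_normal_vector_distr:
  fixes Z :: "'b \<Rightarrow> real^'k"
  assumes N: "prob_space N" and Z: "standard_normal_vector N Z"
  shows "Z \<in> borel_measurable N"
    and "distr N borel Z = density lborel (\<lambda>z. \<Prod>i\<in>UNIV. ennreal (std_normal_density (z $ i)))"
proof -
  interpret N: prob_space N by fact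
  have ind: "N.indep_vars (\<lambda>_. borel) (\<lambda>i \<omega>. Z \<omega> $ i) UNIV"
    and dist: "distributed N lborel (\<lambda>\<omega>. Z \<omega> $ i) std_normal_density" for i
    using Z by (auto simp: standard_normal_vector_def)
  have comp [measurable]: "(\<lambda>\<omega>. Z \<omega> $ i) \<in> borel_measurable N" for i
    using distributed_measurable[OF dist[of i]] by simp
  show [measurable]: "Z \<in> borel_measurable N"
    unfolding borel_measurable_euclidean_space[of Z]
    by (auto simp: Basis_vec_def inner_axis)
  define \<rho> where "\<rho> z = (\<Prod>i\<in>UNIV. ennreal (std_normal_density (z $ i)))" for z :: "real^'k"
  have [measurable]: "\<rho> \<in> borel_measurable borel" unfolding \<rho>_def by measurable
  have "distr N borel Z = density lborel \<rho>"
  proof (rule measure_eqI_generator_eq)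
    let ?E = "range (\<lambda>(a, b). box a b::(real^'k) set)"
    show "Int_stable ?E" by (auto simp: Int_stable_def box_Int_box)
    show "?E \<subseteq> Pow UNIV" "sets (distr N borel Z) = sigma_sets UNIV ?E" "sets (density lborel \<rho>) = sigma_sets UNIV ?E"
      by (simp_all add: borel_eq_box)
    let ?A = "\<lambda>n::nat. box (- (real n *\<^sub>R One)) (real n *\<^sub>R One) :: (real^'k) set"
    show "range ?A \<subseteq> ?E" "(\<Union>i. ?A i) = UNIV" unfolding UN_box_eq_UNIV by auto
    show "emeasure (distr N borel Z) (?A i) \<noteq> \<infinity>" for i
      by (simp add: emeasure_distr)
    fix X assume "X \<in> ?E"
    then obtain a b where X: "X = box a b" by auto
    have memX: "z \<in> X \<longleftrightarrow> (\<forall>i. z $ i \<in> {a $ i <..< b $ i})" for z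
      unfolding X by (auto simp: mem_box_cart)
    have one: "emeasure N ((\<lambda>\<omega>. Z \<omega> $ i) -` {a $ i <..< b $ i} \<inter> space N)
       = (\<integral>\<^sup>+x. ennreal (std_normal_density x) * indicator {a $ i <..< b $ i} x \<partial>lborel)" for i
      using distributed_emeasure[OF dist[of i], of "{a $ i <..< b $ i}"] by simp
    have "emeasure (distr N borel Z) X = emeasure N (\<Inter>i\<in>UNIV. (\<lambda>\<omega>. Z \<omega> $ i) -` {a $ i <..< b $ i} \<inter> space N)"
      by (subst emeasure_distr) (auto simp: X[symmetric] memX intro!: arg_cong[where f="emeasure N"], simp add: X)
    also have "\<dots> = ennreal (\<Prod>i\<in>UNIV. measure N ((\<lambda>\<omega>. Z \<omega> $ i) -` {a $ i <..< b $ i} \<inter> space N))"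
      using N.indep_varsD_finite[OF ind, of "\<lambda>i. {a $ i <..< b $ i}"] by (simp add: N.emeasure_eq_measure)
    also have "\<dots> = (\<Prod>i\<in>UNIV. emeasure N ((\<lambda>\<omega>. Z \<omega> $ i) -` {a $ i <..< b $ i} \<inter> space N))"
      by (simp add: N.emeasure_eq_measure prod_ennreal)
    also have "\<dots> = (\<Prod>i\<in>UNIV. (\<integral>\<^sup>+x. ennreal (std_normal_density x) * indicator {a $ i <..< b $ i} x \<partial>lborel))"
      by (simp add: one)
    also have "\<dots> = (\<Prod>e\<in>Basis. (\<integral>\<^sup>+x. ennreal (std_normal_density x) * indicator {a \<bullet> e <..< b \<bullet> e} x \<partial>lborel))"
      unfolding prod_Basis_cart by (simp add: inner_axis)
    also have "\<dots> = (\<integral>\<^sup>+z. (\<Prod>e\<in>Basis. ennreal (std_normal_density (z \<bullet> e)) * indicator {a \<bullet> e <..< b \<bullet> e} (z \<bullet> e)) \<partial>lborel)"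
      by (subst nn_integral_lborel_prod[symmetric]) auto
    also have "\<dots> = (\<integral>\<^sup>+z. \<rho> z * indicator X z \<partial>lborel)"
    proof (rule nn_integral_cong)
      fix z :: "real^'k"
      have "(\<Prod>i\<in>UNIV. indicator {a $ i <..< b $ i} (z $ i) :: ennreal) = indicator X z"
        by (auto simp: indicator_def memX prod_zero_iff)
      then show "(\<Prod>e\<in>Basis. ennreal (std_normal_density (z \<bullet> e)) * indicator {a \<bullet> e <..< b \<bullet> e} (z \<bullet> e)) = \<rho> z * indicator X z"
        unfolding prod_Basis_cart by (simp add: inner_axis prod.distrib \<rho>_def)
    qed
    also have "\<dots> = emeasure (density lborel \<rho>) X"
      by (subst emeasure_density) (auto simp: X)
    finally show "emeasure (distr N borel Z) X = emeasure (density lborel \<rho>) X" .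
  qed
  then show "distr N borel Z = density lborel (\<lambda>z. \<Prod>i\<in>UNIV. ennreal (std_normal_density (z $ i)))"
    unfolding \<rho>_def .
qed

lemma standard_normal_vector_rotation:
  fixes Z :: "'b \<Rightarrow> real^'k"
  assumes N: "prob_space N" and Z: "standard_normal_vector N Z" and T: "orthogonal_transformation T"
  shows "distr N borel (\<lambda>\<omega>. T (Z \<omega>)) = distr N borel Z"
proof -
  define \<rho> where "\<rho> z = (\<Prod>i\<in>UNIV. ennreal (std_normal_density (z $ i)))" for z :: "real^'k"
  have [measurable]: "\<rho> \<in> borel_measurable borel" unfolding \<rho>_def by measurable
  note ZN = standard_normal_vector_distr[OF N Z, folded \<rho>_def]
  note ZN(1) [measurable]
  have [measurable]: "T \<in> borel_measurable borel"
    using orthogonal_transformation_linear[OF T]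
    by (intro borel_measurable_continuous_onI linear_continuous_on) (simp add: linear_conv_bounded_linear)
  have radial: "\<rho> z = ennreal ((1 / sqrt (2 * pi)) ^ CARD('k) * exp (- (norm z)\<^sup>2 / 2))" for z
  proof -
    have "(\<Prod>i\<in>UNIV. std_normal_density (z $ i)) = (1 / sqrt (2 * pi)) ^ CARD('k) * exp (\<Sum>i\<in>UNIV. - (z $ i)\<^sup>2 / 2)"
      by (simp add: std_normal_density_def prod.distrib prod_dividef exp_sum power_divide)
    also have "(\<Sum>i\<in>UNIV. - (z $ i)\<^sup>2 / 2) = - (norm z)\<^sup>2 / 2"
      by (simp add: norm_sq_cart sum_divide_distrib sum_negf)
    finally show ?thesis unfolding \<rho>_def by (simp add: prod_ennreal)
  qed
  have \<rho>T: "\<rho> (T z) = \<rho> z" for z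
    unfolding radial using orthogonal_transformation_norm[OF T, of z] by simp
  have "distr N borel (\<lambda>\<omega>. T (Z \<omega>)) = distr (density lborel \<rho>) borel T"
    unfolding ZN(2)[symmetric] by (subst distr_distr) (auto simp: o_def)
  also have "\<dots> = density lborel \<rho>"
  proof (rule measure_eqI)
    fix A assume "A \<in> sets (distr (density lborel \<rho>) borel T)"
    then have [measurable]: "A \<in> sets borel" by simp
    have pre: "T -` A \<in> sets borel" using measurable_sets[of T borel borel A] by simp
    have "emeasure (distr (density lborel \<rho>) borel T) A = (\<integral>\<^sup>+z. \<rho> z * indicator (T -` A) z \<partial>lborel)"
      using pre by (subst emeasure_distr) (auto simp: emeasure_density)
    also have "\<dots> = (\<integral>\<^sup>+z. \<rho> (T z) * indicator A (T z) \<partial>lborel)"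
      by (intro nn_integral_cong) (auto simp: \<rho>T indicator_def)
    also have "\<dots> = (\<integral>\<^sup>+z. \<rho> z * indicator A z \<partial>distr lborel borel T)"
      by (subst nn_integral_distr) auto
    also have "\<dots> = emeasure (density lborel \<rho>) A"
      unfolding lborel_distr_orthogonal[OF T] by (simp add: emeasure_density)
    finally show "emeasure (distr (density lborel \<rho>) borel T) A = emeasure (density lborel \<rho>) A" .
  qed simp
  finally show ?thesis using ZN(2) by simp
qed

section \<open>The bounded-Lipschitz distance\<close>

lemma bl_function_measurable:
  assumes "bl_norm f \<le> 1"
  shows "f \<in> borel_measurable borel"
  using assms by (auto simp: bl_norm_le_1_iff intro!: borel_measurable_continuous_onI lipschitz_on_continuous_on)

lemma bl_function_bound: "bl_norm f \<le> 1 \<Longrightarrow> \<bar>f x\<bar> \<le> 1"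
  by (simp add: bl_norm_le_1_iff)

lemma bl_function_lipschitz: "bl_norm f \<le> 1 \<Longrightarrow> \<bar>f x - f y\<bar> \<le> norm (x - y)"
  using lipschitz_onD[of 1 UNIV f x y] by (simp add: bl_norm_le_1_iff dist_norm)

lemma bl_norm_zero: "bl_norm (\<lambda>_. 0) \<le> 1"
  by (simp add: bl_norm_le_1_iff lipschitz_on_def)

lemma bl_norm_orthogonal:
  assumes T: "orthogonal_transformation T" and f: "bl_norm f \<le> 1"
  shows "bl_norm (\<lambda>x. f (T x)) \<le> 1"
proof -
  have "dist (f (T x)) (f (T y)) \<le> 1 * dist x y" for x y
    using bl_function_lipschitz[OF f, of "T x" "T y"] orthogonal_transformation_norm[OF T, of "x - y"]
    by (simp add: dist_norm linear_diff[OF orthogonal_transformation_linear[OF T]])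
  then show ?thesis using f by (auto simp: bl_norm_le_1_iff lipschitz_on_def)
qed

lemma bl_expectation_bound:
  assumes M: "prob_space M" and V: "V \<in> borel_measurable M" and f: "bl_norm f \<le> 1"
  shows "integrable M (\<lambda>\<omega>. f (V \<omega>))" "\<bar>\<integral>\<omega>. f (V \<omega>) \<partial>M\<bar> \<le> 1"
proof -
  interpret prob_space M by fact
  have [measurable]: "(\<lambda>\<omega>. f (V \<omega>)) \<in> borel_measurable M"
    using measurable_compose[OF V bl_function_measurable[OF f]] .
  show int: "integrable M (\<lambda>\<omega>. f (V \<omega>))"
    by (rule integrable_const_bound[of _ 1]) (auto simp: bl_function_bound[OF f])
  have "\<bar>\<integral>\<omega>. f (V \<omega>) \<partial>M\<bar> \<le> (\<integral>\<omega>. 1 \<partial>M)"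
    by (intro order_trans[OF integral_abs_bound] integral_mono) (use int in \<open>auto simp: bl_function_bound[OF f]\<close>)
  then show "\<bar>\<integral>\<omega>. f (V \<omega>) \<partial>M\<bar> \<le> 1" by (simp add: prob_space)
qed

context
  fixes M :: "'a measure" and N :: "'b measure" and W :: "'b \<Rightarrow> real^'k"
  assumes M: "prob_space M" and N: "prob_space N" and W: "W \<in> borel_measurable N"
begin

lemma bl_term_bound:
  assumes "V \<in> borel_measurable M" "bl_norm f \<le> 1"
  shows "\<bar>(\<integral>\<omega>. f (V \<omega>) \<partial>M) - (\<integral>\<omega>. f (W \<omega>) \<partial>N)\<bar> \<le> 2"
  using bl_expectation_bound(2)[OF M assms] bl_expectation_bound(2)[OF N W assms(2)] by linarith

lemma bl_term_le_dist:
  assumes "V \<in> borel_measurable M" "bl_norm f \<le> 1"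
  shows "\<bar>(\<integral>\<omega>. f (V \<omega>) \<partial>M) - (\<integral>\<omega>. f (W \<omega>) \<partial>N)\<bar> \<le> bl_dist M V N W"
  unfolding bl_dist_def using assms bl_term_bound[OF assms(1)]
  by (intro cSUP_upper bdd_aboveI[where M=2]) auto

lemma bl_dist_bounds:
  assumes "V \<in> borel_measurable M"
  shows "0 \<le> bl_dist M V N W" "bl_dist M V N W \<le> 2"
proof -
  show "0 \<le> bl_dist M V N W" using bl_term_le_dist[OF assms bl_norm_zero] by simp
  show "bl_dist M V N W \<le> 2" unfolding bl_dist_def
    using bl_term_bound[OF assms] bl_norm_zero by (intro cSUP_least) auto
qed

lemma bl_dist_triangle:
  assumes V: "V \<in> borel_measurable M" and V': "V' \<in> borel_measurable M"
    and int: "integrable M (\<lambda>\<omega>. norm (V \<omega> - V' \<omega>))"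
  shows "bl_dist M V N W \<le> bl_dist M V' N W + (\<integral>\<omega>. norm (V \<omega> - V' \<omega>) \<partial>M)"
  unfolding bl_dist_def[of M V]
proof (rule cSUP_least)
  show "{f :: real^'k \<Rightarrow> real. bl_norm f \<le> 1} \<noteq> {}" using bl_norm_zero by blast
  fix f :: "real^'k \<Rightarrow> real" assume "f \<in> {f. bl_norm f \<le> 1}"
  then have f: "bl_norm f \<le> 1" by simp
  have "\<bar>(\<integral>\<omega>. f (V \<omega>) \<partial>M) - (\<integral>\<omega>. f (V' \<omega>) \<partial>M)\<bar> = \<bar>\<integral>\<omega>. f (V \<omega>) - f (V' \<omega>) \<partial>M\<bar>"
    using bl_expectation_bound(1)[OF M V f] bl_expectation_bound(1)[OF M V' f] by simp
  also have "\<dots> \<le> (\<integral>\<omega>. norm (V \<omega> - V' \<omega>) \<partial>M)"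
    using bl_expectation_bound(1)[OF M V f] bl_expectation_bound(1)[OF M V' f]
    by (intro order_trans[OF integral_abs_bound] integral_mono int) (auto simp: bl_function_lipschitz[OF f])
  finally show "\<bar>(\<integral>\<omega>. f (V \<omega>) \<partial>M) - (\<integral>\<omega>. f (W \<omega>) \<partial>N)\<bar>
      \<le> bl_dist M V' N W + (\<integral>\<omega>. norm (V \<omega> - V' \<omega>) \<partial>M)"
    using bl_term_le_dist[OF V' f] by linarith
qed

text \<open>
  Composition with an orthogonal transformation permutes the test functions and does not change the
  expectations with respect to \<open>W\<close>.
\<close>

lemma bl_dist_orthogonal_le:
  assumes V: "V \<in> borel_measurable M" and T: "orthogonal_transformation T"
    and law: "distr N borel (\<lambda>\<omega>. T (W \<omega>)) = distr N borel W"
  shows "bl_dist M (\<lambda>\<omega>. T (V \<omega>)) N W \<le> bl_dist M V N W"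
  unfolding bl_dist_def[of M "\<lambda>\<omega>. T (V \<omega>)"]
proof (rule cSUP_least)
  show "{f :: real^'k \<Rightarrow> real. bl_norm f \<le> 1} \<noteq> {}" using bl_norm_zero by blast
  fix f :: "real^'k \<Rightarrow> real" assume "f \<in> {f. bl_norm f \<le> 1}"
  then have f: "bl_norm f \<le> 1" by simp
  note [measurable] = bl_function_measurable[OF f] W
  have [measurable]: "T \<in> borel_measurable borel"
    using orthogonal_transformation_linear[OF T]
    by (intro borel_measurable_continuous_onI linear_continuous_on) (simp add: linear_conv_bounded_linear)
  have "(\<integral>\<omega>. f (W \<omega>) \<partial>N) = (\<integral>x. f x \<partial>distr N borel W)"
    by (subst integral_distr) auto
  also have "\<dots> = (\<integral>\<omega>. f (T (W \<omega>)) \<partial>N)"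
    unfolding law[symmetric] by (subst integral_distr) auto
  finally show "\<bar>(\<integral>\<omega>. f (T (V \<omega>)) \<partial>M) - (\<integral>\<omega>. f (W \<omega>) \<partial>N)\<bar> \<le> bl_dist M V N W"
    using bl_term_le_dist[OF V bl_norm_orthogonal[OF T f]] by simp
qed

end

section \<open>The conditional distance as a function of the frame\<close>

lemma frame_coords_diff: "frame_coords \<theta> x - frame_coords \<eta> x = frame_coords (\<theta> - \<eta>) x"
  by (simp add: frame_coords_def vec_eq_iff inner_diff_right)

lemma frame_coords_matrix_mult: "frame_coords (R ** \<theta>) x = R *v frame_coords \<theta> x"
proof -
  have "x \<bullet> ((R ** \<theta>) $ i) = (\<Sum>n\<in>UNIV. R $ i $ n * (x \<bullet> (\<theta> $ n)))" for i
    unfolding inner_vec_def matrix_matrix_mult_def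
    by (simp add: sum_distrib_left) (subst sum.swap, simp add: mult_ac)
  then show ?thesis by (simp add: frame_coords_def vec_eq_iff matrix_vector_mult_def)
qed

lemma norm_frame_coords_sq: "(norm (frame_coords \<theta> x))\<^sup>2 = (\<Sum>i\<in>UNIV. (x \<bullet> (\<theta> $ i))\<^sup>2)"
  by (simp add: norm_sq_cart frame_coords_def)

text \<open>
  The conditional distance \<open>F\<close> is regarded as a function of an arbitrary \<open>k \<times> d\<close> matrix, not only of an
  orthonormal frame. This gives room for smoothing it.
\<close>

locale projected_vector = M: prob_space M + N: prob_space N
  for M :: "'a measure" and N :: "'b measure" +
  fixes X :: "'a \<Rightarrow> real ^ 'd" and Z :: "'b \<Rightarrow> real ^ 'k" and \<sigma> B :: real
  assumes X [measurable]: "X \<in> borel_measurable M"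
    and X2: "integrable M (\<lambda>\<omega>. (norm (X \<omega>))\<^sup>2)"
    and var: "(\<integral>\<omega>. (norm (X \<omega>))\<^sup>2 \<partial>M) = \<sigma>\<^sup>2 * real CARD('d)"
    and \<sigma>: "\<sigma> > 0"
    and B: "B = (SUP \<xi> \<in> sphere 0 1. \<integral>\<omega>. (X \<omega> \<bullet> \<xi>)\<^sup>2 \<partial>M)"
    and Z: "standard_normal_vector N Z"
begin

abbreviation F :: "real^'d^'k \<Rightarrow> real" where
  "F \<equiv> cond_bl_dist M X N Z \<sigma>"

lemma inner_sq_integrable: "integrable M (\<lambda>\<omega>. (X \<omega> \<bullet> v)\<^sup>2)"
proof (rule Bochner_Integration.integrable_bound)
  show "integrable M (\<lambda>\<omega>. (norm (X \<omega>))\<^sup>2 * (norm v)\<^sup>2)" using X2 by simp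
  show "AE \<omega> in M. norm ((X \<omega> \<bullet> v)\<^sup>2) \<le> norm ((norm (X \<omega>))\<^sup>2 * (norm v)\<^sup>2)"
  proof (rule AE_I2)
    fix \<omega>
    have "\<bar>X \<omega> \<bullet> v\<bar>\<^sup>2 \<le> (norm (X \<omega>) * norm v)\<^sup>2" by (intro power_mono Cauchy_Schwarz_ineq2) auto
    then show "norm ((X \<omega> \<bullet> v)\<^sup>2) \<le> norm ((norm (X \<omega>))\<^sup>2 * (norm v)\<^sup>2)" by (simp add: power_mult_distrib)
  qed
qed measurable

lemma inner_sq_le: "(\<integral>\<omega>. (X \<omega> \<bullet> v)\<^sup>2 \<partial>M) \<le> B * (norm v)\<^sup>2"
proof (cases "v = 0")
  case False
  define \<xi> where "\<xi> = v /\<^sub>R norm v"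
  have bdd: "bdd_above ((\<lambda>\<xi>. \<integral>\<omega>. (X \<omega> \<bullet> \<xi>)\<^sup>2 \<partial>M) ` sphere 0 1)"
  proof (rule bdd_aboveI2)
    fix \<xi> :: "real^'d" assume \<xi>: "\<xi> \<in> sphere 0 1"
    show "(\<integral>\<omega>. (X \<omega> \<bullet> \<xi>)\<^sup>2 \<partial>M) \<le> (\<integral>\<omega>. (norm (X \<omega>))\<^sup>2 \<partial>M)"
    proof (intro integral_mono X2 inner_sq_integrable)
      fix \<omega>
      have "\<bar>X \<omega> \<bullet> \<xi>\<bar> \<le> norm (X \<omega>)" using Cauchy_Schwarz_ineq2[of "X \<omega>" \<xi>] \<xi> by simp
      then show "(X \<omega> \<bullet> \<xi>)\<^sup>2 \<le> (norm (X \<omega>))\<^sup>2" by (simp add: abs_le_square_iff[symmetric])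
    qed
  qed
  have "\<xi> \<in> sphere 0 1" using False by (simp add: \<xi>_def)
  with bdd have "(\<integral>\<omega>. (X \<omega> \<bullet> \<xi>)\<^sup>2 \<partial>M) \<le> B" unfolding B by (intro cSUP_upper) auto
  moreover have "X \<omega> \<bullet> v = norm v * (X \<omega> \<bullet> \<xi>)" for \<omega> using False by (simp add: \<xi>_def)
  then have "(X \<omega> \<bullet> v)\<^sup>2 = (norm v)\<^sup>2 * (X \<omega> \<bullet> \<xi>)\<^sup>2" for \<omega>
    by (simp add: power_mult_distrib)
  ultimately show ?thesis by (simp add: mult.commute[of B] mult_left_mono)
qed simp

lemma B_pos: "0 < B"
proof -
  have "\<sigma>\<^sup>2 * real CARD('d) = (\<integral>\<omega>. (\<Sum>i\<in>UNIV. (X \<omega> \<bullet> axis i 1)\<^sup>2) \<partial>M)"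
    unfolding var[symmetric] by (simp add: inner_axis norm_sq_cart)
  also have "\<dots> = (\<Sum>i\<in>UNIV. \<integral>\<omega>. (X \<omega> \<bullet> axis i 1)\<^sup>2 \<partial>M)"
    by (intro Bochner_Integration.integral_sum inner_sq_integrable)
  also have "\<dots> \<le> (\<Sum>i\<in>(UNIV::'d set). B)"
  proof (rule sum_mono)
    fix i :: 'd show "(\<integral>\<omega>. (X \<omega> \<bullet> axis i 1)\<^sup>2 \<partial>M) \<le> B" using inner_sq_le[of "axis i 1"] by simp
  qed
  finally have "\<sigma>\<^sup>2 * real CARD('d) \<le> B * real CARD('d)" by (simp add: mult.commute)
  then have "\<sigma>\<^sup>2 \<le> B" by (simp)
  moreover have "0 < \<sigma>\<^sup>2" using \<sigma> by simp
  ultimately show ?thesis by linarith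
qed

lemma frame_coords_measurable [measurable]: "(\<lambda>\<omega>. frame_coords \<theta> (X \<omega>)) \<in> borel_measurable M"
proof -
  have "continuous_on UNIV (frame_coords \<theta>)" unfolding frame_coords_def by (intro continuous_intros)
  then show ?thesis using measurable_compose[OF X borel_measurable_continuous_onI] by blast
qed

lemma target_measurable: "(\<lambda>\<omega>. \<sigma> *\<^sub>R Z \<omega>) \<in> borel_measurable N"
  using standard_normal_vector_distr(1)[OF N.prob_space_axioms Z] by measurable

lemma F_bounds: "0 \<le> F \<theta>" "F \<theta> \<le> 2"
  unfolding cond_bl_dist_def
  by (intro bl_dist_bounds M.prob_space_axioms N.prob_space_axioms target_measurable frame_coords_measurable)+

text \<open>
  A coupling estimate: \<open>F \<theta> - F \<eta>\<close> is at most the mean distance of the two projections, whose square is by the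
  Cauchy-Schwarz inequality at most \<open>\<Sum>i. E \<langle>X, \<theta>\<^sub>i - \<eta>\<^sub>i\<rangle>\<^sup>2\<close>.
\<close>

lemma F_lipschitz: "\<bar>F \<theta> - F \<eta>\<bar> \<le> sqrt B * norm (\<theta> - \<eta>)"
proof -
  have le: "F \<theta> \<le> F \<eta> + sqrt B * norm (\<theta> - \<eta>)" for \<theta> \<eta>
  proof -
    let ?Y = "\<lambda>\<omega>. norm (frame_coords (\<theta> - \<eta>) (X \<omega>))"
    have Y2: "integrable M (\<lambda>\<omega>. (?Y \<omega>)\<^sup>2)"
      unfolding norm_frame_coords_sq by (intro Bochner_Integration.integrable_sum inner_sq_integrable)
    have Y1: "integrable M ?Y"
      by (rule M.square_integrable_imp_integrable[OF _ Y2]) measurable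
    have "(M.expectation ?Y)\<^sup>2 \<le> M.expectation (\<lambda>\<omega>. (?Y \<omega>)\<^sup>2)"
      using M.variance_positive[of ?Y] M.variance_eq[OF Y1 Y2] by simp
    also have "\<dots> = (\<Sum>i\<in>UNIV. \<integral>\<omega>. (X \<omega> \<bullet> ((\<theta> - \<eta>) $ i))\<^sup>2 \<partial>M)"
      unfolding norm_frame_coords_sq by (intro Bochner_Integration.integral_sum inner_sq_integrable)
    also have "\<dots> \<le> (\<Sum>i\<in>UNIV. B * (norm ((\<theta> - \<eta>) $ i))\<^sup>2)"
      by (intro sum_mono inner_sq_le)
    also have "\<dots> = B * (norm (\<theta> - \<eta>))\<^sup>2"
      unfolding power2_norm_eq_inner inner_vec_def[of "\<theta> - \<eta>"] by (simp add: sum_distrib_left)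
    finally have "M.expectation ?Y \<le> sqrt (B * (norm (\<theta> - \<eta>))\<^sup>2)" by (rule real_le_rsqrt)
    also have "\<dots> = sqrt B * norm (\<theta> - \<eta>)" by (simp add: real_sqrt_mult)
    finally have "M.expectation ?Y \<le> sqrt B * norm (\<theta> - \<eta>)" .
    moreover have "F \<theta> \<le> F \<eta> + M.expectation ?Y"
      unfolding cond_bl_dist_def frame_coords_diff[symmetric]
      by (rule bl_dist_triangle[OF M.prob_space_axioms N.prob_space_axioms target_measurable])
        (use Y1 in \<open>auto simp: frame_coords_diff\<close>)
    ultimately show ?thesis by linarith
  qed
  show ?thesis using le[of \<theta> \<eta>] le[of \<eta> \<theta>] by (simp add: norm_minus_commute abs_le_iff)
qed

lemma F_orthogonal_invariant:
  assumes R: "orthogonal_matrix R"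
  shows "F (R ** \<theta>) = F \<theta>"
proof -
  have le: "F (R ** \<theta>) \<le> F \<theta>" if R: "orthogonal_matrix R" for R :: "real^'k^'k" and \<theta>
  proof -
    note T = orthogonal_transformation_matrix_vector[OF R]
    have [measurable]: "Z \<in> borel_measurable N"
      using standard_normal_vector_distr(1)[OF N.prob_space_axioms Z] .
    have [measurable]: "(\<lambda>z. R *v z) \<in> borel_measurable borel"
      by (intro borel_measurable_continuous_onI linear_continuous_on matrix_vector_mul_bounded_linear)
    have law: "distr N borel (\<lambda>\<omega>. R *v (\<sigma> *\<^sub>R Z \<omega>)) = distr N borel (\<lambda>\<omega>. \<sigma> *\<^sub>R Z \<omega>)"
    proof -
      have "distr N borel (\<lambda>\<omega>. R *v (\<sigma> *\<^sub>R Z \<omega>)) = distr (distr N borel (\<lambda>\<omega>. R *v Z \<omega>)) borel (\<lambda>z. \<sigma> *\<^sub>R z)"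
        by (subst distr_distr) (auto simp: o_def matrix_vector_mult_scaleR)
      also have "\<dots> = distr (distr N borel Z) borel (\<lambda>z. \<sigma> *\<^sub>R z)"
        by (simp add: standard_normal_vector_rotation[OF N.prob_space_axioms Z T])
      also have "\<dots> = distr N borel (\<lambda>\<omega>. \<sigma> *\<^sub>R Z \<omega>)"
        by (subst distr_distr) (auto simp: o_def)
      finally show ?thesis .
    qed
    show ?thesis unfolding cond_bl_dist_def frame_coords_matrix_mult
      by (rule bl_dist_orthogonal_le[OF M.prob_space_axioms N.prob_space_axioms target_measurable frame_coords_measurable T law])
  qed
  have "F \<theta> = F (transpose R ** (R ** \<theta>))"
    using R by (simp add: matrix_mul_assoc orthogonal_matrix)
  also have "\<dots> \<le> F (R ** \<theta>)" using R by (intro le) simp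
  finally show ?thesis using le[OF R, of \<theta>] by simp
qed

end

section \<open>The conditional distance concentrates\<close>

theorem theorem5:
  fixes M :: "'a measure" and N :: "'b measure"
    and X :: "'a \<Rightarrow> real ^ 'd"
    and \<Theta> :: "'a \<Rightarrow> real ^ 'd ^ 'k"
    and Z :: "'b \<Rightarrow> real ^ 'k"
    and \<mu> :: "(real ^ 'd ^ 'k) measure"
    and \<sigma> B \<epsilon> :: real
  assumes "CARD('k) \<le> CARD('d)"
    and "prob_space M" and "prob_space N"
    and "X \<in> borel_measurable M"
    and "integrable M (\<lambda>\<omega>. (norm (X \<omega>))\<^sup>2)"
    and "(\<integral>\<omega>. X \<omega> \<partial>M) = 0"
    and "\<sigma> > 0"
    and "(\<integral>\<omega>. (norm (X \<omega>))\<^sup>2 \<partial>M) = \<sigma>\<^sup>2 * real CARD('d)"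
    and "B = (SUP \<xi> \<in> sphere 0 1. \<integral>\<omega>. (X \<omega> \<bullet> \<xi>)\<^sup>2 \<partial>M)"
    and "standard_normal_vector N Z"
    and "stiefel_haar \<mu>"
    and "\<Theta> \<in> measurable M stiefel_space"
    and "distr M stiefel_space \<Theta> = \<mu>"
    and "indep_pair M borel X stiefel_space \<Theta>"
    and "\<epsilon> > 2 * pi * sqrt (B / real CARD('d))"
  shows "measure M {\<omega> \<in> space M.
             \<bar>cond_bl_dist M X N Z \<sigma> (\<Theta> \<omega>) - (\<integral>\<omega>'. cond_bl_dist M X N Z \<sigma> (\<Theta> \<omega>') \<partial>M)\<bar> > \<epsilon>}
         \<le> sqrt (pi / 2) * exp (- (real CARD('d) * \<epsilon>\<^sup>2 / (32 * B)))"
proof -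
  interpret projected_vector M N X Z \<sigma> B
    by (intro projected_vector.intro projected_vector_axioms.intro assms)
  note \<Theta> [measurable] = assms(12)
  have sets: "sets \<mu> = sets stiefel_space" and sp: "space \<mu> = space stiefel_space"
    using assms(13) by auto
  have "continuous_on UNIV F"
    by (rule lipschitz_on_continuous_on[of "sqrt B"])
      (use F_lipschitz B_pos in \<open>auto intro!: lipschitz_onI simp: dist_norm\<close>)
  then have F [measurable]: "F \<in> borel_measurable stiefel_space"
    unfolding stiefel_space_def by (intro measurable_restrict_space1 borel_measurable_continuous_onI)
  have mean: "(\<integral>\<omega>. F (\<Theta> \<omega>) \<partial>M) = (\<integral>\<theta>. F \<theta> \<partial>\<mu>)"
    unfolding assms(13)[symmetric] by (rule integral_distr[symmetric]) measurable
  have "measure M {\<omega> \<in> space M. \<bar>F (\<Theta> \<omega>) - (\<integral>\<theta>. F \<theta> \<partial>\<mu>)\<bar> > \<epsilon>}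
      = measure \<mu> {\<theta> \<in> space \<mu>. \<bar>F \<theta> - (\<integral>\<theta>. F \<theta> \<partial>\<mu>)\<bar> > \<epsilon>}"
  proof -
    define m where "m = (\<integral>\<theta>. F \<theta> \<partial>\<mu>)"
    have "{\<theta> \<in> space stiefel_space. \<bar>F \<theta> - m\<bar> > \<epsilon>} \<in> sets stiefel_space" by measurable
    then have "measure \<mu> {\<theta> \<in> space \<mu>. \<bar>F \<theta> - m\<bar> > \<epsilon>}
        = measure M (\<Theta> -` {\<theta> \<in> space stiefel_space. \<bar>F \<theta> - m\<bar> > \<epsilon>} \<inter> space M)"
      unfolding sp unfolding assms(13)[symmetric] by (rule measure_distr[OF \<Theta>])
    also have "\<Theta> -` {\<theta> \<in> space stiefel_space. \<bar>F \<theta> - m\<bar> > \<epsilon>} \<inter> space M = {\<omega> \<in> space M. \<bar>F (\<Theta> \<omega>) - m\<bar> > \<epsilon>}"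
      using measurable_space[OF \<Theta>] by auto
    finally show ?thesis unfolding m_def by simp
  qed
  also have "\<dots> \<le> sqrt (pi / 2) * exp (- (real CARD('d) * \<epsilon>\<^sup>2 / (32 * B)))"
    by (rule stiefel_concentration[OF assms(1,11) _ F_lipschitz B_pos F_orthogonal_invariant assms(15), of 2])
      (use F_bounds in \<open>auto simp: abs_le_iff intro: order_trans[of _ 0]\<close>)
  finally show ?thesis unfolding mean .
qed

end
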